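(* Define \[ \mathcal{S} = \left\{(p,\beta)\in [3,4)\times(0,2] : \frac{p-3}{p-2} < \beta \leq 2\right\}. \] Assume that $(p,\beta)\in [1,3)\times(0,2]$ or that $(p,\beta)\in \mathcal{S}$. Let $L>0$ be sufficiently large, depending on $\beta$ (i.e., there is $L_0=L_0(\beta)>0$ such that the following holds for every $L\geq L_0$). Let $b_n = c\, n^{-2/(2\beta+1)}$ for all $n\in\mathbb{N}$ and some constant $c\in(0,\infty)$. Then \[ \limsup_{n\to\infty} \frac{R_n\{\hat f_{n,b_n},\Sigma(\beta,L)\}}{r_n\{\Sigma(\beta,L)\}} < \infty, \] i.e., the sequence $\{\hat f_{n,b_n}: n\in\mathbb{N}\}$ of gamma kernel density estimators achieves the minimax rate over $\Sigma(\beta,L)$ under $L^p$ loss.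
   Context: Let $X_1,\ldots,X_n$ be iid random variables with unknown density $f$ supported on $[0,\infty)$. Gamma kernel and estimator: for $b\in(0,\infty)$ and $x\in[0,\infty)$, \[ K_b(x,t) = \frac{t^{x/b}e^{-t/b}}{b^{x/b+1}\,\Gamma(x/b+1)}\,\mathbf{1}_{[0,\infty)}(t),\quad t\in[0,\infty),\qquad \hat f_{n,b}(x) = \frac1n\sum_{i=1}^n K_b(x,X_i),\quad x\in[0,\infty), \] where $\Gamma$ is Euler's gamma function. The estimator is considered on all of $[0,\infty)$ (no truncation or renormalization). Risks: for $p\in[1,\infty)$ and measurable $g:[0,\infty)\to\mathbb{R}$, $\|g\|_p = (\int_0^\infty |g(x)|^p\,dx)^{1/p}$. For an estimator $f_n$ (based on $X_1,\dots,X_n$) of $f$, $R_n(f_n,f) = \{\mathbb{E}(\|f_n-f\|_p^p)\}^{1/p}$, the expectation being under iid sampling from $f$. For a class of densities $\mathcal{F}$, the maximal risk is $R_n(f_n,\mathcal{F}) = \sup_{f\in\mathcal{F}}R_n(f_n,f)$ and the minimax risk is $r_n(\mathcal{F}) = \inf_{f_n}R_n(f_n,\mathcal{F})$, the infimum being over all estimators based on $(X_1,\ldots,X_n)$. Hölder class: for $\beta\in(0,\infty)$, let $m=\sup\{\ell\in\mathbb{N}_0:\ell<\beta\}$. $\Sigma(\beta,L)$ is the set of all densities $f$ supported on $[0,1]$ that are $m$-times differentiable on $(0,\infty)$ (so a jump is allowed at $0$ but not at $1$) and such that \[ \max_{0\le k\le m}\sup_{u\in(0,\infty)}|f^{(k)}(u)|\le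 L\quad\text{and}\quad \sup_{u,v\in(0,\infty),\,u\ne v}\frac{|f^{(m)}(u)-f^{(m)}(v)|}{|u-v|^{\beta-m}}\le L, \] where $f^{(k)}$ is the $k$th derivative and $f^{(0)}=f$. Known fact taken from the literature in the paper: for every fixed $\beta\in(0,\infty)$ and $p\in[1,\infty)$, provided $L$ is sufficiently large depending on $\beta$, $r_n\{\Sigma(\beta,L)\}\asymp n^{-\beta/(2\beta+1)}$ as $n\to\infty$. *)

theory Defs
  imports "HOL-Probability.Probability"
begin

text \<open>Only used with exponents \<open>a > 0\<close>, so that the value at infinity is infinity.\<close>

definition ennreal_powr :: "ennreal \<Rightarrow> real \<Rightarrow> ennreal" where
  "ennreal_powr x a = (if x = \<top> then \<top> else ennreal (enn2real x powr a))"

text \<open>A density on \<open>[0,\<infinity>)\<close> is represented by a function on all reals that vanishes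
  on the negative half-line.\<close>

definition is_density :: "(real \<Rightarrow> real) \<Rightarrow> bool" where
  "is_density f \<longleftrightarrow> f \<in> borel_measurable borel \<and> (\<forall>x. 0 \<le> f x) \<and> (\<forall>x<0. f x = 0) \<and>
     (\<integral>\<^sup>+x. ennreal (f x) \<partial>lborel) = 1"

text \<open>The joint law of an iid sample \<open>X 1, \<dots>, X n\<close> with density \<open>f\<close>.\<close>

definition sample_law :: "nat \<Rightarrow> (real \<Rightarrow> real) \<Rightarrow> (nat \<Rightarrow> real) measure" where
  "sample_law n f = (\<Pi>\<^sub>M i\<in>{1..n}. density lborel (\<lambda>t. ennreal (f t)))"

text \<open>For \<open>x = 0\<close> the factor \<open>t powr (x / b)\<close> is read as \<open>1\<close> also at \<open>t = 0\<close>, whereas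
  \<open>0 powr 0 = 0\<close> in the library.\<close>

definition gamma_kernel :: "real \<Rightarrow> real \<Rightarrow> real \<Rightarrow> real" where
  "gamma_kernel b x t =
     (if x = 0 then 1 else t powr (x / b)) * exp (- t / b) /
       (b powr (x / b + 1) * Gamma (x / b + 1)) * indicator {0..} t"

text \<open>An estimator maps a sample and a point \<open>x \<ge> 0\<close> to a real; its values at \<open>x < 0\<close>
  are never used.\<close>

definition gamma_kde :: "nat \<Rightarrow> real \<Rightarrow> (nat \<Rightarrow> real) \<Rightarrow> real \<Rightarrow> real" where
  "gamma_kde n b X x = 1 / real n * (\<Sum>i=1..n. gamma_kernel b x (X i))"

text \<open>Joint measurability makes the \<open>L\<^sup>p\<close> loss a measurable function of the sample, so that
  its expectation is a genuine integral.\<close>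

definition estimators :: "nat \<Rightarrow> ((nat \<Rightarrow> real) \<Rightarrow> real \<Rightarrow> real) set" where
  "estimators n = {T. (\<lambda>(X, x). T X x) \<in>
     borel_measurable ((\<Pi>\<^sub>M i\<in>{1..n}. borel) \<Otimes>\<^sub>M restrict_space borel {0..})}"

definition Lp_norm :: "real \<Rightarrow> (real \<Rightarrow> real) \<Rightarrow> ennreal" where
  "Lp_norm p g = ennreal_powr (\<integral>\<^sup>+x\<in>{0..}. ennreal (\<bar>g x\<bar> powr p) \<partial>lborel) (1 / p)"

definition risk :: "real \<Rightarrow> nat \<Rightarrow> ((nat \<Rightarrow> real) \<Rightarrow> real \<Rightarrow> real) \<Rightarrow> (real \<Rightarrow> real) \<Rightarrow> ennreal" where
  "risk p n T f =
     ennreal_powr (\<integral>\<^sup>+X. ennreal_powr (Lp_norm p (\<lambda>x. T X x - f x)) p \<partial>sample_law n f) (1 / p)"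

definition max_risk :: "real \<Rightarrow> nat \<Rightarrow> ((nat \<Rightarrow> real) \<Rightarrow> real \<Rightarrow> real) \<Rightarrow> (real \<Rightarrow> real) set \<Rightarrow> ennreal" where
  "max_risk p n T F = (SUP f\<in>F. risk p n T f)"

definition minimax_risk :: "real \<Rightarrow> nat \<Rightarrow> (real \<Rightarrow> real) set \<Rightarrow> ennreal" where
  "minimax_risk p n F = (INF T\<in>estimators n. max_risk p n T F)"

definition holder_order :: "real \<Rightarrow> nat" where
  "holder_order \<beta> = Sup {l. real l < \<beta>}"

text \<open>The derivatives are taken at points of the open half-line only, so a jump at \<open>0\<close> is
  allowed, but none at \<open>1\<close>.\<close>

definition holder_class :: "real \<Rightarrow> real \<Rightarrow> (real \<Rightarrow> real) set" where
  "holder_class \<beta> L = {f. is_density f \<and> (\<forall>x. x \<notin> {0..1} \<longrightarrow> f x = 0) \<and>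
     (let m = holder_order \<beta> in
       (\<forall>k<m. \<forall>u>0. (deriv ^^ k) f field_differentiable at u) \<and>
       (\<forall>k\<le>m. \<forall>u>0. \<bar>(deriv ^^ k) f u\<bar> \<le> L) \<and>
       (\<forall>u>0. \<forall>v>0. u \<noteq> v \<longrightarrow>
          \<bar>(deriv ^^ m) f u - (deriv ^^ m) f v\<bar> / \<bar>u - v\<bar> powr (\<beta> - real m) \<le> L))}"

definition S_region :: "(real \<times> real) set" where
  "S_region = {(p, \<beta>). (p, \<beta>) \<in> {3..<4} \<times> {0<..2} \<and> (p - 3) / (p - 2) < \<beta> \<and> \<beta> \<le> 2}"

text \<open>In \<^typ>\<open>ennreal\<close>, \<open>\<top> / \<top> = 0\<close>; finiteness of the minimax risk shows that this never
  occurs in the ratio of the two risks.\<close>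

lemma minimax_risk_holder_finite:
  assumes p: "p \<ge> 1" and L: "L > 0"
  shows "minimax_risk p n (holder_class \<beta> L) < \<top>"
proof -
  let ?T = "\<lambda>(X :: nat \<Rightarrow> real) (x :: real). 0 :: real"
  have T: "?T \<in> estimators n" by (simp add: estimators_def)
  have "risk p n ?T f \<le> ennreal L" if f: "f \<in> holder_class \<beta> L" for f
  proof -
    have nn: "\<And>x. 0 \<le> f x" and out: "\<And>x. x \<notin> {0..1} \<Longrightarrow> f x = 0"
      and meas: "f \<in> borel_measurable borel"
      and int: "(\<integral>\<^sup>+x. ennreal (f x) \<partial>lborel) = 1"
      using f by (auto simp: holder_class_def is_density_def)
    have bnd: "f x \<le> L" if "x > 0" for x
    proof -
      have "\<forall>k\<le>holder_order \<beta>. \<forall>u>0. \<bar>(deriv ^^ k) f u\<bar> \<le> L"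
        using f unfolding holder_class_def Let_def by blast
      from this[rule_format, of 0 x] that show ?thesis by simp
    qed
    define I where "I = (\<integral>\<^sup>+x\<in>{0..}. ennreal (\<bar>0 - f x\<bar> powr p) \<partial>lborel)"
    have "I \<le> (\<integral>\<^sup>+(x::real). ennreal (L powr p) * indicator {0..1} x \<partial>lborel)"
      unfolding I_def
    proof (rule nn_integral_mono_AE)
      have "AE x in lborel. x \<noteq> (0::real)" by (rule AE_lborel_singleton)
      then show "AE x in lborel. ennreal (\<bar>0 - f x\<bar> powr p) * indicator {0..} x
          \<le> ennreal (L powr p) * indicator {0..1} x"
      proof eventually_elim
        case (elim x)
        consider "x < 0" | "x > 1" | "0 < x" "x \<le> 1" using elim by linarith
        then show ?case
        proof cases
          case 3
          then have "\<bar>0 - f x\<bar> powr p \<le> L powr p"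
            using bnd[of x] nn[of x] p by (intro powr_mono2) auto
          then show ?thesis using 3 by (simp add: ennreal_leI)
        qed (use out[of x] in auto)
      qed
    qed
    also have "\<dots> = ennreal (L powr p)"
      by (subst nn_integral_cmult_indicator) auto
    finally have I: "I \<le> ennreal (L powr p)" .
    then have Ifin: "I \<noteq> \<top>" by (auto simp: top_unique)
    have Ir: "enn2real I \<le> L powr p" using I by (intro enn2real_leI) auto
    have Lp: "Lp_norm p (\<lambda>x. 0 - f x) = ennreal (enn2real I powr (1 / p))"
      using Ifin unfolding Lp_norm_def I_def[symmetric] by (simp add: ennreal_powr_def)
    interpret D: prob_space "density lborel (\<lambda>t. ennreal (f t))"
      by (rule prob_spaceI) (use int meas in \<open>simp add: emeasure_density\<close>)
    interpret P: prob_space "sample_law n f"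
      unfolding sample_law_def by (rule prob_space_PiM) (rule D.prob_space_axioms)
    have "ennreal_powr (Lp_norm p (\<lambda>x. 0 - f x)) p = ennreal (enn2real I)"
      using p unfolding Lp by (simp add: ennreal_powr_def powr_powr)
    then have "risk p n ?T f = ennreal (enn2real I powr (1 / p))"
      unfolding risk_def by (simp add: P.emeasure_space_1 ennreal_powr_def)
    also have "\<dots> \<le> ennreal ((L powr p) powr (1 / p))"
      using Ir p by (intro ennreal_leI powr_mono2) auto
    also have "\<dots> = ennreal L" using p L by (simp add: powr_powr)
    finally show ?thesis .
  qed
  then have "max_risk p n ?T (holder_class \<beta> L) \<le> ennreal L"
    unfolding max_risk_def by (rule SUP_least)
  then have "minimax_risk p n (holder_class \<beta> L) \<le> ennreal L"
    unfolding minimax_risk_def using T by (rule INF_lower2[rotated])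
  then show ?thesis by (rule le_less_trans) simp
qed

end

theory Submission
  imports Defs
begin

text \<open>
  The theorem compares two rates: the maximal risk of the gamma kernel estimator is at most a
  constant times \<open>n powr (- \<beta> / (2 * \<beta> + 1))\<close>, and no estimator has a maximal risk of smaller order.

  \<^emph>\<open>Lower bound.\<close> On \<open>M\<close> cells of width \<open>h = 1 / (2 * M)\<close> inside \<open>[0, 1/2]\<close>, a bump of height
  \<open>h powr \<beta>\<close> and integral \<open>0\<close> is added, or not, to a fixed smooth density. All \<open>2 ^ M\<close> sums lie in
  the Hoelder class. Switching one bump changes the density by about \<open>h powr (\<beta> + 1)\<close> in \<open>L\<^sup>1\<close>, and
  its \<open>\<chi>\<^sup>2\<close> effect on one observation is of order \<open>h powr (2 * \<beta> + 1)\<close>. With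
  \<open>h \<approx> n powr (- 1 / (2 * \<beta> + 1))\<close> it therefore stays undetectable from \<open>n\<close> observations
  (\<open>two_point_lower_bound\<close>). Averaging over all subsets of bumps, every estimator errs on a fixed
  fraction of the cells, so its \<open>L\<^sup>1\<close> loss is of order \<open>h powr \<beta>\<close> (\<open>hypercube_lower_bound\<close>). The
  passage from \<open>L\<^sup>1\<close> to \<open>L\<^sup>p\<close> uses the pointwise bound \<open>t \<le> \<tau> + \<tau> powr (1 - p) * t powr p\<close>.

  \<^emph>\<open>Upper bound.\<close> The function \<open>gamma_kernel b x\<close> is the density of a gamma law whose mean \<open>x + b\<close>
  and mean square deviation \<open>b * x + 2 * b\<^sup>2\<close> from \<open>x\<close> give a bias of order \<open>b powr (\<beta> / 2)\<close> on
  \<open>(0, 2]\<close> for \<open>\<beta> \<le> 2\<close> (\<open>bias_bound\<close>). It is bounded by a multiple of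
  \<open>min (1 / b) (1 / sqrt (b * x))\<close> (\<open>gamma_kernel_le\<close>), so \<open>v = L * kernel_sup b x / n\<close> bounds the
  variance of the estimator. An interpolation between second and fourth moments bounds its \<open>p\<close>-th
  central moment by a multiple of \<open>v powr (p / 2)\<close>, plus \<open>v powr (p - 1)\<close> if \<open>p > 2\<close>
  (\<open>stochastic_error\<close>). Near \<open>x = 0\<close> the first term behaves like \<open>x powr (- p / 4)\<close>, which is
  integrable because \<open>p < 4\<close>, and contributes exactly the rate. The second one is controlled by
  \<open>x powr (- q)\<close> with \<open>q < 1\<close>, and it is of the right order if
  \<open>p - 1 - \<beta> * (p - 2) \<le> 2 * q\<close>. Such a \<open>q\<close> exists if and only if \<open>p - 3 < \<beta> * (p - 2)\<close>: for
  \<open>2 < p < 3\<close> this always holds, and for \<open>3 \<le> p < 4\<close> it is the inequality that defines the region.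
  For \<open>x > 2\<close> the kernel at points of \<open>[0, 1]\<close> is so small that the estimator itself is
  negligible (\<open>pointwise_risk_tail\<close>).

  The two bounds hold with the threshold \<open>L\<^sub>0 = 12\<close>: this makes the Hoelder ball large enough to
  contain the perturbed densities for every \<open>\<beta> \<le> 2\<close>.
\<close>

section \<open>Risks as double integrals\<close>

lemma ennreal_powr_mono:
  assumes "x \<le> y" "0 < a"
  shows "ennreal_powr x a \<le> ennreal_powr y a"
proof (cases "y = \<top>")
  case False
  then have "x \<noteq> \<top>" using assms by (auto simp: top_unique)
  with False assms show ?thesis
    by (auto simp: ennreal_powr_def less_top intro!: ennreal_leI powr_mono2 enn2real_mono)
qed (simp add: ennreal_powr_def)

lemma ennreal_powr_ennreal: "0 \<le> r \<Longrightarrow> ennreal_powr (ennreal r) a = ennreal (r powr a)"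
  by (simp add: ennreal_powr_def)

lemma ennreal_powr_inverse:
  assumes "p > 0"
  shows "ennreal_powr (ennreal_powr x (1 / p)) p = x"
  using assms by (cases x) (auto simp: ennreal_powr_def powr_powr)

lemma risk_eq:
  assumes "p \<ge> 1"
  shows "risk p n T f = ennreal_powr
    (\<integral>\<^sup>+X. (\<integral>\<^sup>+x. ennreal (\<bar>T X x - f x\<bar> powr p) * indicator {0..} x \<partial>lborel) \<partial>sample_law n f) (1 / p)"
  using assms unfolding risk_def Lp_norm_def by (subst ennreal_powr_inverse) auto

lemma risk_le:
  assumes "p \<ge> 1" "M \<ge> 0"
    and "(\<integral>\<^sup>+X. (\<integral>\<^sup>+x. ennreal (\<bar>T X x - f x\<bar> powr p) * indicator {0..} x \<partial>lborel) \<partial>sample_law n f)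
      \<le> ennreal (M powr p)"
  shows "risk p n T f \<le> ennreal M"
proof -
  have "risk p n T f \<le> ennreal_powr (ennreal (M powr p)) (1 / p)"
    unfolding risk_eq[OF assms(1)] using assms by (intro ennreal_powr_mono) auto
  also have "\<dots> = ennreal M"
    using assms by (simp add: ennreal_powr_ennreal powr_powr)
  finally show ?thesis .
qed

lemma loss_le_of_risk_le:
  assumes "p \<ge> 1" "M \<ge> 0" "risk p n T f \<le> ennreal M"
  shows "(\<integral>\<^sup>+X. (\<integral>\<^sup>+x. ennreal (\<bar>T X x - f x\<bar> powr p) * indicator {0..} x \<partial>lborel) \<partial>sample_law n f)
      \<le> ennreal (M powr p)" (is "?I \<le> _")
proof -
  have "?I = ennreal_powr (risk p n T f) p"
    unfolding risk_eq[OF assms(1)] using assms by (subst ennreal_powr_inverse) auto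
  also have "\<dots> \<le> ennreal_powr (ennreal M) p"
    using assms by (intro ennreal_powr_mono) auto
  finally show ?thesis using assms by (simp add: ennreal_powr_ennreal)
qed

section \<open>Product densities and the two-point bound\<close>

lemma prob_space_density:
  assumes "is_density f"
  shows "prob_space (density lborel (\<lambda>t. ennreal (f t)))"
  by (rule prob_spaceI) (use assms in \<open>simp add: emeasure_density is_density_def\<close>)

lemma prob_space_sample_law:
  assumes "is_density f"
  shows "prob_space (sample_law n f)"
  unfolding sample_law_def by (intro prob_space_PiM prob_space_density assms)

lemma sets_sample_law [measurable_cong]:
  "sets (sample_law n f) = sets (\<Pi>\<^sub>M i\<in>{1..n}. borel)"
  unfolding sample_law_def by (intro sets_PiM_cong) auto

text \<open>
  A common dominating measure for all sampling laws: expectations under different densities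
  become integrals of likelihoods against the same product of Lebesgue measures.
\<close>

lemma sample_law_eq_density:
  assumes f: "is_density f"
  shows "sample_law n f =
    density (\<Pi>\<^sub>M i\<in>{1..n}. lborel) (\<lambda>X. ennreal (\<Prod>i\<in>{1..n}. f (X i)))"
proof -
  have [measurable]: "f \<in> borel_measurable borel" and nn: "\<And>x. 0 \<le> f x"
    using f by (auto simp: is_density_def)
  let ?M = "\<lambda>i::nat. density lborel (\<lambda>t. ennreal (f t))"
  let ?L = "\<lambda>i::nat. lborel :: real measure"
  interpret D: prob_space "density lborel (\<lambda>t. ennreal (f t))"
    by (rule prob_space_density[OF f])
  interpret D: product_sigma_finite ?M by standard
  interpret L: product_sigma_finite ?L by standard
  have "density (PiM {1..n} ?L) (\<lambda>X. ennreal (\<Prod>i\<in>{1..n}. f (X i))) = PiM {1..n} ?M"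
  proof (rule D.PiM_eqI)
    show "sets (density (PiM {1..n} ?L) (\<lambda>X. ennreal (\<Prod>i\<in>{1..n}. f (X i)))) = sets (PiM {1..n} ?M)"
      by (simp, intro sets_PiM_cong) auto
    fix A assume A: "\<And>i. i \<in> {1..n} \<Longrightarrow> A i \<in> sets (?M i)"
    then have [measurable]: "\<And>i. i \<in> {1..n} \<Longrightarrow> A i \<in> sets borel" by simp
    have "emeasure (density (PiM {1..n} ?L) (\<lambda>X. ennreal (\<Prod>i\<in>{1..n}. f (X i)))) (Pi\<^sub>E {1..n} A)
        = (\<integral>\<^sup>+X. ennreal (\<Prod>i\<in>{1..n}. f (X i)) * indicator (Pi\<^sub>E {1..n} A) X \<partial>PiM {1..n} ?L)"
      using A by (subst emeasure_density) (auto intro!: sets_PiM_I_finite)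
    also have "\<dots> = (\<integral>\<^sup>+X. (\<Prod>i\<in>{1..n}. ennreal (f (X i)) * indicator (A i) (X i)) \<partial>PiM {1..n} ?L)"
    proof (rule nn_integral_cong)
      fix X assume "X \<in> space (PiM {1..n} ?L)"
      then have "indicator (Pi\<^sub>E {1..n} A) X = (\<Prod>i\<in>{1..n}. indicator (A i) (X i) :: ennreal)"
        by (auto simp: indicator_def space_PiM PiE_def Pi_def prod_zero_iff)
      then show "ennreal (\<Prod>i\<in>{1..n}. f (X i)) * indicator (Pi\<^sub>E {1..n} A) X
          = (\<Prod>i\<in>{1..n}. ennreal (f (X i)) * indicator (A i) (X i))"
        by (simp add: prod.distrib prod_ennreal nn)
    qed
    also have "\<dots> = (\<Prod>i\<in>{1..n}. \<integral>\<^sup>+x. ennreal (f x) * indicator (A i) x \<partial>lborel)"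
      by (subst L.product_nn_integral_prod) auto
    also have "\<dots> = (\<Prod>i\<in>{1..n}. emeasure (?M i) (A i))"
      by (intro prod.cong refl) (subst emeasure_density, auto)
    finally show "emeasure (density (PiM {1..n} ?L) (\<lambda>X. ennreal (\<Prod>i\<in>{1..n}. f (X i)))) (Pi\<^sub>E {1..n} A)
        = (\<Prod>i\<in>{1..n}. emeasure (?M i) (A i))" .
  qed simp
  then show ?thesis by (simp add: sample_law_def)
qed

text \<open>
  Le Cam's bound in \<open>\<chi>\<^sup>2\<close> form. If the losses \<open>A\<close> and \<open>B\<close> cannot both be small, then their expectations
  under likelihoods \<open>p\<close> and \<open>q\<close> add up to at least \<open>D\<close> times the integral of \<open>min p q\<close>. The elementary
  inequality \<open>min p q \<ge> q - q\<^sup>2 / (4 * p)\<close> bounds that overlap from below, and the integral of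
  \<open>q\<^sup>2 / p\<close> factorises over the observations.
\<close>

lemma two_point_lower_bound:
  fixes A B :: "(nat \<Rightarrow> real) \<Rightarrow> ennreal"
  assumes f: "is_density f" and g: "is_density g"
    and ac: "\<And>x. f x = 0 \<Longrightarrow> g x = 0"
    and A[measurable]: "A \<in> borel_measurable (\<Pi>\<^sub>M i\<in>{1..n}. borel)"
    and B[measurable]: "B \<in> borel_measurable (\<Pi>\<^sub>M i\<in>{1..n}. borel)"
    and D: "D \<ge> 0" "\<And>X. X \<in> space (\<Pi>\<^sub>M i\<in>{1..n}. borel) \<Longrightarrow> ennreal D \<le> A X + B X"
    and chi: "(\<integral>\<^sup>+x. ennreal ((g x)\<^sup>2 / f x) \<partial>lborel) \<le> ennreal \<rho>" "\<rho> \<ge> 0"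
  shows "ennreal (D * (1 - \<rho> ^ n / 4))
    \<le> (\<integral>\<^sup>+X. A X \<partial>sample_law n f) + (\<integral>\<^sup>+X. B X \<partial>sample_law n g)"
proof -
  have [measurable]: "f \<in> borel_measurable borel" "g \<in> borel_measurable borel"
    and nn: "\<And>x. 0 \<le> f x" "\<And>x. 0 \<le> g x"
    using f g by (auto simp: is_density_def)
  let ?P = "\<Pi>\<^sub>M i\<in>{1..n}. lborel :: real measure"
  interpret L: product_sigma_finite "\<lambda>i::nat. lborel :: real measure" by standard
  have sP[measurable_cong]: "sets ?P = sets (\<Pi>\<^sub>M i\<in>{1..n}. borel)"
    by (intro sets_PiM_cong) auto
  define pf where "pf X = (\<Prod>i\<in>{1..n}. f (X i))" for X :: "nat \<Rightarrow> real"
  define pg where "pg X = (\<Prod>i\<in>{1..n}. g (X i))" for X :: "nat \<Rightarrow> real"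
  define r where "r X = (\<Prod>i\<in>{1..n}. (g (X i))\<^sup>2 / f (X i))" for X :: "nat \<Rightarrow> real"
  have [measurable]: "pf \<in> borel_measurable ?P" "pg \<in> borel_measurable ?P" "r \<in> borel_measurable ?P"
    unfolding pf_def pg_def r_def by measurable
  have pnn: "0 \<le> pf X" "0 \<le> pg X" "0 \<le> r X" for X
    unfolding pf_def pg_def r_def using nn by (auto intro!: prod_nonneg)
  define S where "S = (\<integral>\<^sup>+X. A X \<partial>sample_law n f) + (\<integral>\<^sup>+X. B X \<partial>sample_law n g)"
  have S: "S = (\<integral>\<^sup>+X. ennreal (pf X) * A X + ennreal (pg X) * B X \<partial>?P)"
    unfolding S_def sample_law_eq_density[OF f] sample_law_eq_density[OF g] pf_def[symmetric] pg_def[symmetric]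
    by (simp add: nn_integral_density nn_integral_add del: One_nat_def)
  have pw: "ennreal D * ennreal (pg X)
      \<le> (ennreal (pf X) * A X + ennreal (pg X) * B X) + ennreal (D / 4) * ennreal (r X)"
    if X: "X \<in> space ?P" for X
  proof -
    have X: "X \<in> space (\<Pi>\<^sub>M i\<in>{1..n}. borel)" using X by (simp add: space_PiM)
    define m where "m = min (pf X) (pg X)"
    have r: "r X = (pg X)\<^sup>2 / pf X"
      unfolding r_def pg_def pf_def by (simp add: prod_dividef prod_power_distrib)
    have "pg X \<le> m + r X / 4"
    proof (cases "pf X = 0")
      case True
      then obtain i where "i \<in> {1..n}" "f (X i) = 0" unfolding pf_def by auto
      then have "pg X = 0" unfolding pg_def using ac[of "X i"] by (intro prod_zero) auto
      then show ?thesis using True by (simp add: m_def r)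
    next
      case False
      then have pos: "pf X > 0" using pnn(1)[of X] by linarith
      have "0 \<le> (pf X - pg X / 2)\<^sup>2" by simp
      then have "pg X * pf X \<le> pf X * pf X + (pg X)\<^sup>2 / 4"
        by (simp add: power2_eq_square algebra_simps)
      then have "pg X \<le> pf X + (pg X)\<^sup>2 / pf X / 4"
        using pos by (simp add: field_simps)
      then show ?thesis using pnn(3)[of X] by (auto simp: m_def r min_def)
    qed
    then have "ennreal D * ennreal (pg X) \<le> ennreal (D * (m + r X / 4))"
      using D(1) pnn by (subst ennreal_mult[symmetric]) (auto intro!: ennreal_leI mult_left_mono)
    also have "\<dots> = ennreal m * ennreal D + ennreal (D / 4) * ennreal (r X)"
      using D(1) pnn[of X] unfolding m_def
      by (simp add: ennreal_mult[symmetric] ennreal_plus[symmetric] algebra_simps del: ennreal_plus)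
    also have "ennreal m * ennreal D \<le> ennreal m * (A X + B X)"
      using D(2)[OF X] by (intro mult_left_mono) auto
    also have "\<dots> \<le> ennreal (pf X) * A X + ennreal (pg X) * B X"
      unfolding distrib_left by (intro add_mono mult_right_mono ennreal_leI) (auto simp: m_def)
    finally show ?thesis by (simp add: add_mono)
  qed
  have pg1: "(\<integral>\<^sup>+X. ennreal (pg X) \<partial>?P) = 1"
  proof -
    have "(\<integral>\<^sup>+X. ennreal (pg X) \<partial>?P) = (\<integral>\<^sup>+X. (\<Prod>i\<in>{1..n}. ennreal (g (X i))) \<partial>?P)"
      by (simp add: pg_def prod_ennreal nn)
    also have "\<dots> = (\<Prod>i\<in>{1..n}. \<integral>\<^sup>+x. ennreal (g x) \<partial>lborel)"
      by (subst L.product_nn_integral_prod) auto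
    finally show ?thesis using g by (simp add: is_density_def)
  qed
  have r1: "(\<integral>\<^sup>+X. ennreal (r X) \<partial>?P) \<le> ennreal (\<rho> ^ n)"
  proof -
    have "(\<integral>\<^sup>+X. ennreal (r X) \<partial>?P) = (\<integral>\<^sup>+X. (\<Prod>i\<in>{1..n}. ennreal ((g (X i))\<^sup>2 / f (X i))) \<partial>?P)"
      by (simp add: r_def prod_ennreal nn)
    also have "\<dots> = (\<Prod>i\<in>{1..n}. \<integral>\<^sup>+x. ennreal ((g x)\<^sup>2 / f x) \<partial>lborel)"
      by (subst L.product_nn_integral_prod) auto
    also have "\<dots> \<le> ennreal \<rho> ^ n"
      using chi by (simp add: power_mono)
    finally show ?thesis using chi by (simp add: ennreal_power)
  qed
  have "ennreal D = (\<integral>\<^sup>+X. ennreal D * ennreal (pg X) \<partial>?P)"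
    by (simp add: nn_integral_cmult pg1 del: One_nat_def)
  also have "\<dots> \<le> (\<integral>\<^sup>+X. (ennreal (pf X) * A X + ennreal (pg X) * B X) + ennreal (D / 4) * ennreal (r X) \<partial>?P)"
    by (intro nn_integral_mono pw)
  also have "\<dots> = S + ennreal (D / 4) * (\<integral>\<^sup>+X. ennreal (r X) \<partial>?P)"
    unfolding S by (simp add: nn_integral_add nn_integral_cmult del: One_nat_def)
  also have "\<dots> \<le> S + ennreal (D / 4) * ennreal (\<rho> ^ n)"
    by (intro add_left_mono mult_left_mono r1) auto
  also have "\<dots> = S + ennreal (D / 4 * \<rho> ^ n)"
    using D(1) chi by (subst ennreal_mult) auto
  finally have *: "ennreal D \<le> S + ennreal (D / 4 * \<rho> ^ n)" .
  show ?thesis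
  proof (cases S)
    case (real s)
    with * have "D \<le> s + D / 4 * \<rho> ^ n"
      using D(1) chi by (simp add: ennreal_plus[symmetric] del: ennreal_plus)
    with real show ?thesis
      unfolding S_def[symmetric] by (auto intro!: ennreal_leI simp: algebra_simps)
  qed (simp add: S_def[symmetric])
qed

section \<open>A smooth bump with zero integral\<close>

text \<open>
  Functions of compact support that are continuously differentiable without any case distinction
  at the end points are obtained from the square of a positive part.
\<close>

lemma DERIV_pos_part_square:
  "((\<lambda>y::real. (max 0 y)\<^sup>2) has_real_derivative 2 * max 0 y) (at y)"
proof (cases "y = 0")
  case False
  then consider "y > 0" | "y < 0" by linarith
  then show ?thesis
  proof cases
    case 1
    have "((\<lambda>y::real. y\<^sup>2) has_real_derivative 2 * y) (at y)"
      by (auto intro!: derivative_eq_intros)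
    then have "((\<lambda>y::real. (max 0 y)\<^sup>2) has_real_derivative 2 * y) (at y)"
      by (rule has_field_derivative_transform_within_open[where S = "{0<..}"]) (use 1 in auto)
    then show ?thesis using 1 by simp
  next
    case 2
    have "((\<lambda>y::real. 0) has_real_derivative 0) (at y)" by simp
    then have "((\<lambda>y::real. (max 0 y)\<^sup>2) has_real_derivative 0) (at y)"
      by (rule has_field_derivative_transform_within_open[where S = "{..<0}"]) (use 2 in auto)
    then show ?thesis using 2 by simp
  qed
next
  case True
  have "((\<lambda>h::real. (max 0 h)\<^sup>2 / h) \<longlongrightarrow> 0) (at 0)"
  proof (rule Lim_null_comparison)
    show "\<forall>\<^sub>F h in at 0. norm ((max 0 h)\<^sup>2 / h) \<le> \<bar>h::real\<bar>"
      by (rule always_eventually) (auto simp: max_def power2_eq_square)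
    show "((\<lambda>h::real. \<bar>h\<bar>) \<longlongrightarrow> 0) (at 0)"
      by (auto intro!: tendsto_eq_intros)
  qed
  then show ?thesis using True by (simp add: has_field_derivative_iff)
qed

text \<open>
  The density on \<open>[0, 1]\<close> that is perturbed. It jumps at \<open>0\<close>, which the class allows; at \<open>1\<close>, where no jump
  is allowed, it vanishes together with its derivative. It is at least \<open>3 / 4\<close> on \<open>[0, 1/2]\<close>, which leaves
  room for perturbations of either sign.
\<close>

definition base_density :: "real \<Rightarrow> real" where
  "base_density x = (if x < 0 then 0 else 3 * (max 0 (1 - x))\<^sup>2)"

definition posparab :: "real \<Rightarrow> real" where
  "posparab t = max 0 (t * (1 - t))"

text \<open>
  The factor \<open>1 - 2 * t\<close>, which is odd about \<open>1 / 2\<close>, makes the integral vanish. It is also the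
  derivative of \<open>t * (1 - t)\<close>, so a primitive on \<open>[0, 1]\<close> is \<open>(t * (1 - t)) ^ 3 / 3\<close>.
\<close>

definition bump :: "real \<Rightarrow> real" where
  "bump t = (posparab t)\<^sup>2 * (1 - 2 * t)"

definition bump_deriv :: "real \<Rightarrow> real" where
  "bump_deriv t = 2 * posparab t - 10 * (posparab t)\<^sup>2"

lemma posparab_eq_0: "t \<notin> {0<..<1} \<Longrightarrow> posparab t = 0"
  unfolding posparab_def using mult_nonpos_nonneg[of t "1 - t"] mult_nonneg_nonpos[of t "1 - t"]
  by (cases "t \<le> 0") (auto simp: max_def)

lemma posparab_eq: "0 \<le> t \<Longrightarrow> t \<le> 1 \<Longrightarrow> posparab t = t * (1 - t)"
  by (simp add: posparab_def)

lemma posparab_bounds: "0 \<le> posparab t" "posparab t \<le> 1 / 4"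
proof -
  have "0 \<le> (t - 1 / 2)\<^sup>2" by simp
  then have "t * (1 - t) \<le> 1 / 4" by (simp add: power2_eq_square algebra_simps)
  then show "posparab t \<le> 1 / 4" by (simp add: posparab_def)
qed (simp add: posparab_def)

text \<open>
  On the unit interval the difference is \<open>(s - t) * (1 - s - t)\<close>; if one of the points lies outside,
  the value at the other one is at most its distance to the end point between them.
\<close>

lemma posparab_lipschitz: "\<bar>posparab s - posparab t\<bar> \<le> \<bar>s - t\<bar>"
proof -
  have *: "\<bar>posparab s - posparab t\<bar> \<le> \<bar>s - t\<bar>" if "s \<in> {0<..<1}" for s t
  proof (cases "t \<in> {0<..<1}")
    case True
    have "\<bar>posparab s - posparab t\<bar> = \<bar>s - t\<bar> * \<bar>1 - s - t\<bar>"
      using that True by (simp add: posparab_eq abs_mult[symmetric] algebra_simps)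
    also have "\<dots> \<le> \<bar>s - t\<bar> * 1" using that True by (intro mult_left_mono) auto
    finally show ?thesis by simp
  next
    case False
    have "s * (1 - s) \<le> s * 1" "s * (1 - s) \<le> 1 * (1 - s)"
      using that by (auto intro!: mult_left_mono mult_right_mono)
    moreover have "0 \<le> s * (1 - s)" using that by simp
    moreover have "s \<le> \<bar>s - t\<bar> \<or> 1 - s \<le> \<bar>s - t\<bar>" using that False by auto
    ultimately have "s * (1 - s) \<le> \<bar>s - t\<bar>" by (metis mult_1 mult.right_neutral order_trans)
    then show ?thesis using that False by (simp add: posparab_eq_0 posparab_eq)
  qed
  show ?thesis
  proof (cases "s \<in> {0<..<1} \<or> t \<in> {0<..<1}")
    case True
    then show ?thesis using *[of s t] *[of t s] by auto
  qed (simp add: posparab_eq_0)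
qed

lemma bump_eq_0: "t \<notin> {0<..<1} \<Longrightarrow> bump t = 0"
  and bump_deriv_eq_0: "t \<notin> {0<..<1} \<Longrightarrow> bump_deriv t = 0"
  by (auto simp: bump_def bump_deriv_def posparab_eq_0)

lemma DERIV_bump: "(bump has_real_derivative bump_deriv t) (at t)"
proof -
  have "((\<lambda>t. (max 0 (t * (1 - t)))\<^sup>2 * (1 - 2 * t)) has_real_derivative
      (2 * posparab t * (1 - 2 * t)) * (1 - 2 * t) + (posparab t)\<^sup>2 * (- 2)) (at t)"
    unfolding posparab_def
    by (rule derivative_eq_intros DERIV_chain'[OF _ DERIV_pos_part_square] refl)+ (simp add: algebra_simps)
  moreover have "(2 * posparab t * (1 - 2 * t)) * (1 - 2 * t) + (posparab t)\<^sup>2 * (- 2) = bump_deriv t"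
    by (cases "t \<in> {0<..<1}") (auto simp: posparab_eq_0 posparab_eq bump_deriv_def power2_eq_square algebra_simps)
  ultimately show ?thesis by (simp add: bump_def[abs_def] posparab_def)
qed

lemma abs_bump_le: "\<bar>bump t\<bar> \<le> 1 / 16"
proof (cases "t \<in> {0<..<1}")
  case True
  have "\<bar>bump t\<bar> = (posparab t)\<^sup>2 * \<bar>1 - 2 * t\<bar>" by (simp add: bump_def abs_mult)
  also have "\<dots> \<le> (1 / 4)\<^sup>2 * 1"
    using True posparab_bounds by (intro mult_mono power_mono) auto
  finally show ?thesis by (simp add: power2_eq_square)
qed (simp add: bump_eq_0)

lemma abs_bump_deriv_le: "\<bar>bump_deriv t\<bar> \<le> 1 / 8"
proof -
  have "0 \<le> (posparab t - 1 / 10)\<^sup>2" by simp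
  moreover have "(posparab t) * (posparab t) \<le> (1 / 4) * posparab t"
    using posparab_bounds by (intro mult_right_mono) auto
  ultimately have "bump_deriv t \<le> 1 / 8" "- (1 / 8) \<le> bump_deriv t"
    using posparab_bounds[of t] by (simp_all add: bump_deriv_def power2_eq_square algebra_simps)
  then show ?thesis by linarith
qed

lemma bump_deriv_lipschitz: "\<bar>bump_deriv s - bump_deriv t\<bar> \<le> 3 * \<bar>s - t\<bar>"
proof -
  have "\<bar>bump_deriv s - bump_deriv t\<bar> = \<bar>posparab s - posparab t\<bar> * \<bar>2 - 10 * (posparab s + posparab t)\<bar>"
    by (simp add: bump_deriv_def abs_mult[symmetric] algebra_simps power2_eq_square)
  also have "\<dots> \<le> \<bar>s - t\<bar> * 3"
    using posparab_bounds[of s] posparab_bounds[of t] by (intro mult_mono posparab_lipschitz) auto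
  finally show ?thesis by simp
qed

lemma lipschitz_if_bounded_derivative:
  fixes f :: "real \<Rightarrow> real"
  assumes "\<And>x. (f has_real_derivative f' x) (at x)" "\<And>x. \<bar>f' x\<bar> \<le> B"
  shows "\<bar>f s - f t\<bar> \<le> B * \<bar>s - t\<bar>"
  using field_differentiable_bound[of UNIV f f' B s t] assms
  by (auto intro: has_field_derivative_at_within simp: abs_minus_commute)

lemma bump_lipschitz: "\<bar>bump s - bump t\<bar> \<le> 1 / 8 * \<bar>s - t\<bar>"
  by (rule lipschitz_if_bounded_derivative[OF DERIV_bump abs_bump_deriv_le])

lemma measurable_bump [measurable]: "bump \<in> borel_measurable borel"
  unfolding bump_def posparab_def by measurable

lemma integral_bump: "(bump has_integral 0) {0..1}"
  and integral_bump_half: "(bump has_integral 1 / 192) {0..1 / 2}"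
proof -
  have *: "(bump has_integral (c * (1 - c)) ^ 3 / 3) {0..c}" if "0 \<le> c" "c \<le> 1" for c
  proof -
    have "(bump has_integral (c * (1 - c)) ^ 3 / 3 - (0 * (1 - 0)) ^ 3 / 3) {0..c}"
    proof (rule fundamental_theorem_of_calculus)
      fix x assume x: "x \<in> {0..c}"
      have "((\<lambda>t. (t * (1 - t)) ^ 3 / 3) has_real_derivative (x * (1 - x))\<^sup>2 * (1 - 2 * x)) (at x within {0..c})"
        by (rule derivative_eq_intros refl | simp)+
      moreover have "bump x = (x * (1 - x))\<^sup>2 * (1 - 2 * x)"
        using x that by (simp add: bump_def posparab_eq)
      ultimately have "((\<lambda>t. (t * (1 - t)) ^ 3 / 3) has_real_derivative bump x) (at x within {0..c})"
        by simp
      then show "((\<lambda>t. (t * (1 - t)) ^ 3 / 3) has_vector_derivative bump x) (at x within {0..c})"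
        by (simp add: has_real_derivative_iff_has_vector_derivative)
    qed (use that in auto)
    then show ?thesis by simp
  qed
  show "(bump has_integral 0) {0..1}" using *[of 1] by simp
  show "(bump has_integral 1 / 192) {0..1 / 2}" using *[of "1 / 2"] by (simp add: power3_eq_cube)
qed

lemma nn_integral_abs_bump_ge: "(\<integral>\<^sup>+t. ennreal \<bar>bump t\<bar> * indicator {0<..<1} t \<partial>lborel) \<ge> ennreal (1 / 192)"
proof -
  have nn: "0 \<le> bump t" if "t \<in> {0..1 / 2}" for t
    using that by (simp add: bump_def)
  have "ennreal (1 / 192) = (\<integral>\<^sup>+t. ennreal (bump t) * indicator {0..1 / 2} t \<partial>lborel)"
    by (rule nn_integral_has_integral_lebesgue'[OF nn integral_bump_half, symmetric]) auto
  also have "\<dots> \<le> (\<integral>\<^sup>+t. ennreal \<bar>bump t\<bar> * indicator {0<..<1} t \<partial>lborel)"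
    by (intro nn_integral_mono) (auto simp: indicator_def bump_eq_0 intro!: ennreal_leI)
  finally show ?thesis .
qed

lemma lborel_integral_bump: "has_bochner_integral lborel bump 0"
proof -
  have "set_integrable lborel {0..1} bump"
    by (rule borel_integrable_atLeastAtMost')
      (intro continuous_at_imp_continuous_on ballI DERIV_isCont[OF DERIV_bump])
  moreover have eq: "indicator {0..1} t *\<^sub>R bump t = bump t" for t
    using bump_eq_0[of t] by (cases "t \<in> {0<..<1}") auto
  ultimately have int: "integrable lborel bump" unfolding set_integrable_def by (simp only: eq)
  have "(LINT t|lborel. bump t) = (LINT t:{0..1}|lborel. bump t)"
    unfolding set_lebesgue_integral_def by (simp only: eq)
  also have "\<dots> = integral {0..1} bump"
    using int by (intro set_borel_integral_eq_integral) (simp only: set_integrable_def eq)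
  finally show ?thesis
    using int integral_bump by (simp add: has_bochner_integral_iff integral_unique)
qed

section \<open>Superposition of bumps with disjoint supports\<close>

lemma floor_eq_cell_index:
  fixes t :: real assumes "t - real j \<in> {0<..<1}" shows "nat \<lfloor>t\<rfloor> = j"
  using assms by (auto simp: floor_eq_iff nat_eq_iff)

text \<open>
  At each point at most one shifted copy of \<open>g\<close> is nonzero, so the difference at two points involves
  at most two copies, each of which is Lipschitz; this handles distances up to \<open>1\<close>. For larger
  distances the sup bound suffices because \<open>B \<le> K\<close>. The constants do not depend on how many copies
  are added, which is what keeps the whole hypercube in one Hoelder ball.
\<close>

lemma superposition_bounds:
  fixes g :: "real \<Rightarrow> real"
  assumes W: "finite W" and supp: "\<And>t. t \<notin> {0<..<1} \<Longrightarrow> g t = 0"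
    and B: "\<And>t. \<bar>g t\<bar> \<le> B" and Lip: "\<And>s t. \<bar>g s - g t\<bar> \<le> K * \<bar>s - t\<bar>"
    and "B \<le> K"
    and th: "0 < \<theta>" "\<theta> \<le> 1"
  shows "\<bar>\<Sum>j\<in>W. g (t - real j)\<bar> \<le> B"
    and "\<bar>(\<Sum>j\<in>W. g (s - real j)) - (\<Sum>j\<in>W. g (t - real j))\<bar> \<le> 2 * K * \<bar>s - t\<bar> powr \<theta>"
proof -
  let ?c = "\<lambda>t::real. nat \<lfloor>t\<rfloor>"
  have out: "g (t - real j) = 0" if "?c t \<noteq> j" for t j
    using floor_eq_cell_index[of t j] that supp by blast
  have B0: "0 \<le> B" using B[of 0] by linarith
  have bound: "\<bar>\<Sum>j\<in>W. g (t - real j)\<bar> \<le> B" for t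
  proof -
    have "(\<Sum>j\<in>W. g (t - real j)) = (\<Sum>j\<in>W \<inter> {?c t}. g (t - real j))"
      using W by (intro sum.mono_neutral_right) (auto intro!: out)
    also have "\<bar>\<dots>\<bar> \<le> B"
      using B[of "t - real (?c t)"] B0 by (cases "?c t \<in> W") auto
    finally show ?thesis .
  qed
  then show "\<bar>\<Sum>j\<in>W. g (t - real j)\<bar> \<le> B" .
  show "\<bar>(\<Sum>j\<in>W. g (s - real j)) - (\<Sum>j\<in>W. g (t - real j))\<bar> \<le> 2 * K * \<bar>s - t\<bar> powr \<theta>"
  proof (cases "\<bar>s - t\<bar> \<le> 1")
    case True
    let ?J = "W \<inter> {?c s, ?c t}"
    have K0: "0 \<le> K" using B0 assms by linarith
    have "(\<Sum>j\<in>W. g (s - real j)) - (\<Sum>j\<in>W. g (t - real j)) = (\<Sum>j\<in>W. g (s - real j) - g (t - real j))"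
      by (simp add: sum_subtractf)
    also have "\<dots> = (\<Sum>j\<in>?J. g (s - real j) - g (t - real j))"
      using W by (intro sum.mono_neutral_right) (auto simp: out, metis out)
    also have "\<bar>\<dots>\<bar> \<le> (\<Sum>j\<in>?J. K * \<bar>s - t\<bar>)"
      by (rule order_trans[OF sum_abs]) (intro sum_mono order_trans[OF Lip], simp)
    also have "\<dots> = real (card ?J) * (K * \<bar>s - t\<bar>)" by simp
    also have "\<dots> \<le> 2 * (K * \<bar>s - t\<bar>)"
    proof (intro mult_right_mono)
      have "card ?J \<le> card {?c s, ?c t}" by (intro card_mono) auto
      also have "\<dots> \<le> 2" by (simp add: card_insert_if)
      finally show "real (card ?J) \<le> 2" by simp
    qed (use K0 in auto)
    also have "\<bar>s - t\<bar> \<le> \<bar>s - t\<bar> powr \<theta>"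
      using powr_mono'[of \<theta> 1 "\<bar>s - t\<bar>"] th True by (cases "s = t") auto
    finally show ?thesis using K0 by (simp add: mult_left_mono mult.assoc)
  next
    case False
    have "\<bar>(\<Sum>j\<in>W. g (s - real j)) - (\<Sum>j\<in>W. g (t - real j))\<bar> \<le> 2 * B"
      using bound[of s] bound[of t] by linarith
    also have "\<dots> \<le> 2 * K * 1" using assms by simp
    also have "\<dots> \<le> 2 * K * \<bar>s - t\<bar> powr \<theta>"
      using False th B0 assms(5) by (intro mult_left_mono ge_one_powr_ge_zero) auto
    finally show ?thesis .
  qed
qed

section \<open>The hypercube of perturbed densities\<close>

lemma holder_order_eq:
  shows "0 < \<beta> \<Longrightarrow> \<beta> \<le> 1 \<Longrightarrow> holder_order \<beta> = 0"
    and "1 < \<beta> \<Longrightarrow> \<beta> \<le> 2 \<Longrightarrow> holder_order \<beta> = 1"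
proof -
  assume "0 < \<beta>" "\<beta> \<le> 1"
  then have "{l. real l < \<beta>} = {0}" by auto
  then show "holder_order \<beta> = 0" by (simp add: holder_order_def)
next
  assume "1 < \<beta>" "\<beta> \<le> 2"
  then have "{l. real l < \<beta>} = {..1}" by auto
  then show "holder_order \<beta> = 1"
    unfolding holder_order_def by (simp only: cSup_atMost)
qed

text \<open>
  A bounded Lipschitz function is Hoelder of every order up to \<open>1\<close>.
\<close>

lemma min_one_le_powr: "0 \<le> t \<Longrightarrow> 0 < \<theta> \<Longrightarrow> \<theta> \<le> 1 \<Longrightarrow> a \<le> 1 \<Longrightarrow> a \<le> t \<Longrightarrow> a \<le> t powr \<theta>"
  for t :: real
proof (cases "t \<le> 1")
  case True
  assume "0 \<le> t" "0 < \<theta>" "\<theta> \<le> 1" "a \<le> t"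
  with True show ?thesis using powr_mono'[of \<theta> 1 t] by (cases "t = 0") auto
next
  case False
  assume "0 < \<theta>" "a \<le> 1"
  with False show ?thesis using ge_one_powr_ge_zero[of t \<theta>] by linarith
qed

lemma measurable_base_density [measurable]: "base_density \<in> borel_measurable borel"
  unfolding base_density_def by measurable

lemma base_density_nonneg: "0 \<le> base_density x" and base_density_le: "base_density x \<le> 3" and base_density_ge: "0 \<le> x \<Longrightarrow> x \<le> 1 / 2 \<Longrightarrow> 3 / 4 \<le> base_density x"
proof -
  show "0 \<le> base_density x" by (simp add: base_density_def)
  have "(max 0 (1 - x))\<^sup>2 \<le> 1" if "0 \<le> x" using that by (intro power_le_one) auto
  then show "base_density x \<le> 3" by (auto simp: base_density_def)
  assume "0 \<le> x" "x \<le> 1 / 2"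
  moreover have "(1 / 2)\<^sup>2 \<le> (max 0 (1 - x))\<^sup>2" using \<open>x \<le> 1 / 2\<close> by (intro power_mono) auto
  ultimately show "3 / 4 \<le> base_density x" by (auto simp: base_density_def power2_eq_square)
qed

lemma DERIV_base_density: "x > 0 \<Longrightarrow> (base_density has_real_derivative - 6 * max 0 (1 - x)) (at x)"
proof (rule has_field_derivative_transform_within_open[where S = "{0<..}"])
  show "((\<lambda>x. 3 * (max 0 (1 - x))\<^sup>2) has_real_derivative - 6 * max 0 (1 - x)) (at x)"
    by (rule derivative_eq_intros DERIV_chain'[OF _ DERIV_pos_part_square] refl | simp)+
qed (auto simp: base_density_def)

lemma base_density_holder:
  assumes "u > 0" "v > 0" "0 < \<theta>" "\<theta> \<le> 1"
  shows "\<bar>base_density u - base_density v\<bar> \<le> 6 * \<bar>u - v\<bar> powr \<theta>"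
    and "\<bar>- 6 * max 0 (1 - u) - (- 6 * max 0 (1 - v))\<bar> \<le> 6 * \<bar>u - v\<bar> powr \<theta>"
proof -
  have aux: "\<bar>a - b\<bar> \<le> t \<Longrightarrow> \<bar>- 6 * a - (- 6 * b)\<bar> \<le> 6 * t" for a b t :: real
    by linarith
  have *: "\<bar>max 0 (1 - u) - max 0 (1 - v)\<bar> \<le> \<bar>u - v\<bar> powr \<theta>"
    using assms by (intro min_one_le_powr) auto
  then show "\<bar>- 6 * max 0 (1 - u) - (- 6 * max 0 (1 - v))\<bar> \<le> 6 * \<bar>u - v\<bar> powr \<theta>" by (rule aux)
  have sq: "\<bar>3 * a\<^sup>2 - 3 * b\<^sup>2\<bar> = 3 * \<bar>a - b\<bar> * \<bar>a + b\<bar>" for a b :: real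
  proof -
    have "3 * a\<^sup>2 - 3 * b\<^sup>2 = 3 * (a - b) * (a + b)" by algebra
    then show ?thesis by (simp only: abs_mult abs_numeral)
  qed
  have "\<bar>base_density u - base_density v\<bar> = 3 * \<bar>max 0 (1 - u) - max 0 (1 - v)\<bar> * \<bar>max 0 (1 - u) + max 0 (1 - v)\<bar>"
    using assms sq by (simp add: base_density_def)
  also have "\<dots> \<le> 3 * \<bar>u - v\<bar> powr \<theta> * 2"
    using assms * by (intro mult_mono) auto
  finally show "\<bar>base_density u - base_density v\<bar> \<le> 6 * \<bar>u - v\<bar> powr \<theta>" by simp
qed

lemma lborel_integral_base_density: "has_bochner_integral lborel base_density 1"
proof (rule has_bochner_integral_nn_integral)
  have "(base_density has_integral 0 - (- ((1 - 0) ^ 3))) {0..1::real}"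
  proof (rule fundamental_theorem_of_calculus[where f = "\<lambda>x. - ((1 - x) ^ 3)", THEN has_integral_eq_rhs])
    fix x :: real assume x: "x \<in> {0..1}"
    have "((\<lambda>x. - ((1 - x) ^ 3)) has_real_derivative 3 * (1 - x)\<^sup>2) (at x within {0..1})"
      by (rule derivative_eq_intros refl | simp)+
    then show "((\<lambda>x. - ((1 - x) ^ 3)) has_vector_derivative base_density x) (at x within {0..1})"
      using x by (simp add: base_density_def has_real_derivative_iff_has_vector_derivative)
  qed auto
  then have "(base_density has_integral 1) {0..1}" by simp
  from nn_integral_has_integral_lebesgue'[OF _ this] 
  have "(\<integral>\<^sup>+x. ennreal (base_density x) * indicator {0..1} x \<partial>lborel) = ennreal 1"
    by (simp add: base_density_nonneg)
  also have "(\<lambda>x. ennreal (base_density x) * indicator {0..1} x) = (\<lambda>x. ennreal (base_density x))"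
    by (auto simp: indicator_def base_density_def fun_eq_iff)
  finally show "(\<integral>\<^sup>+x. ennreal (base_density x) \<partial>lborel) = ennreal 1" .
qed (auto simp: base_density_nonneg)

text \<open>
  The vertex of the hypercube indexed by the set \<open>W\<close> of cells whose bump is switched on.
\<close>

definition cube_density :: "real \<Rightarrow> real \<Rightarrow> nat set \<Rightarrow> real \<Rightarrow> real" where
  "cube_density \<beta> h W x = base_density x + h powr \<beta> * (\<Sum>j\<in>W. bump (x / h - real j))"

lemma cube_density_insert:
  assumes "finite W" "j \<notin> W"
  shows "cube_density \<beta> h (insert j W) x = cube_density \<beta> h W x + h powr \<beta> * bump (x / h - real j)"
  using assms by (simp add: cube_density_def algebra_simps)

lemma measurable_cube_density [measurable]: "cube_density \<beta> h W \<in> borel_measurable borel"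
  unfolding cube_density_def by measurable

lemma lborel_integral_scaled_bump:
  assumes "h > 0"
  shows "has_bochner_integral lborel (\<lambda>x. bump (x / h - real j)) 0"
proof -
  have "has_bochner_integral lborel (\<lambda>x. bump (- real j + (1 / h) * x)) (0 /\<^sub>R \<bar>1 / h\<bar>)"
    using assms lborel_integral_bump by (subst lborel_has_bochner_integral_real_affine_iff[symmetric]) auto
  then show ?thesis by (simp add: algebra_simps)
qed

context
  fixes M :: nat and h \<beta> :: real and W :: "nat set"
  assumes M: "M \<ge> 1" and h: "h = 1 / (2 * real M)" and beta: "0 < \<beta>" "\<beta> \<le> 2"
    and W: "W \<subseteq> {..<M}"
begin

lemma cell_width_pos: "0 < h" and cell_width_le: "h \<le> 1 / 2"
  using M by (auto simp: h field_simps)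

lemma finite_cells: "finite W" using W finite_subset by blast

lemma cell_width_powr_bounds: "a \<ge> 0 \<Longrightarrow> 0 \<le> h powr a \<and> h powr a \<le> 1"
  using cell_width_pos cell_width_le by (auto intro: powr_le1)

lemma support_in_left_half:
  assumes "j < M" "x / h - real j \<in> {0<..<1}"
  shows "0 < x" "x < 1 / 2"
proof -
  have "0 < x / h" using assms by auto
  then show "0 < x" using cell_width_pos by (simp add: zero_less_divide_iff)
  have "x / h < real j + 1" using assms by auto
  also have "\<dots> \<le> real M" using assms by linarith
  finally show "x < 1 / 2" using cell_width_pos M by (simp add: h field_simps)
qed

lemma perturbation_bound: "\<bar>h powr \<beta> * (\<Sum>j\<in>W. bump (x / h - real j))\<bar> \<le> 1 / 16"
proof -
  have "\<bar>\<Sum>j\<in>W. bump (x / h - real j)\<bar> \<le> 1 / 16"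
    by (rule superposition_bounds(1)[where K = "1/8" and \<theta> = 1])
      (use finite_cells bump_eq_0 abs_bump_le bump_lipschitz in auto)
  then have "\<bar>h powr \<beta> * (\<Sum>j\<in>W. bump (x / h - real j))\<bar> \<le> 1 * (1 / 16)"
    unfolding abs_mult using cell_width_powr_bounds[of \<beta>] beta by (intro mult_mono) auto
  then show ?thesis by simp
qed

lemma perturbation_eq_0:
  assumes "x \<notin> {0<..<1 / 2}"
  shows "(\<Sum>j\<in>W. bump (x / h - real j)) = 0"
proof (intro sum.neutral ballI)
  fix j assume "j \<in> W"
  then show "bump (x / h - real j) = 0"
    using support_in_left_half[of j x] W assms bump_eq_0 by (metis greaterThanLessThan_iff lessThan_iff subsetD)
qed

lemma cube_density_ge: "0 \<le> x \<Longrightarrow> x \<le> 1 / 2 \<Longrightarrow> 1 / 2 \<le> cube_density \<beta> h W x"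
  using perturbation_bound[of x] base_density_ge[of x] unfolding cube_density_def by linarith

lemma cube_density_nonneg: "0 \<le> cube_density \<beta> h W x"
proof (cases "x \<in> {0<..<1 / 2}")
  case True
  then show ?thesis using cube_density_ge[of x] by auto
next
  case False
  then show ?thesis using perturbation_eq_0[of x] base_density_nonneg[of x] by (simp add: cube_density_def)
qed

lemma integral_cube_density: "has_bochner_integral lborel (cube_density \<beta> h W) 1"
proof -
  have "has_bochner_integral lborel (cube_density \<beta> h W) (1 + h powr \<beta> * (\<Sum>j\<in>W. 0))"
    unfolding cube_density_def
    by (intro has_bochner_integral_add has_bochner_integral_mult_right has_bochner_integral_sum
        lborel_integral_base_density lborel_integral_scaled_bump cell_width_pos)
  then show ?thesis by simp
qed

lemma is_density_cube: "is_density (cube_density \<beta> h W)"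
  unfolding is_density_def
proof (intro conjI allI impI)
  fix x :: real assume "x < 0"
  then show "cube_density \<beta> h W x = 0"
    using perturbation_eq_0[of x] by (simp add: cube_density_def base_density_def)
next
  show "(\<integral>\<^sup>+x. ennreal (cube_density \<beta> h W x) \<partial>lborel) = 1"
    using integral_cube_density cube_density_nonneg
    by (subst nn_integral_eq_integral) (auto simp: has_bochner_integral_iff)
qed (auto simp: cube_density_nonneg)

lemma DERIV_cube:
  assumes "x > 0"
  shows "(cube_density \<beta> h W has_real_derivative
    - 6 * max 0 (1 - x) + h powr (\<beta> - 1) * (\<Sum>j\<in>W. bump_deriv (x / h - real j))) (at x)"
proof -
  have b: "((\<lambda>x. bump (x / h - real j)) has_real_derivative bump_deriv (x / h - real j) * (1 / h)) (at x)" for j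
    by (rule DERIV_chain'[OF _ DERIV_bump]) (use cell_width_pos in \<open>auto intro!: derivative_eq_intros\<close>)
  have "(cube_density \<beta> h W has_real_derivative
    - 6 * max 0 (1 - x) + h powr \<beta> * (\<Sum>j\<in>W. bump_deriv (x / h - real j) * (1 / h))) (at x)"
    unfolding cube_density_def[abs_def]
    by (intro DERIV_add DERIV_base_density assms DERIV_cmult DERIV_sum b)
  moreover have "h powr \<beta> * (\<Sum>j\<in>W. bump_deriv (x / h - real j) * (1 / h))
      = h powr (\<beta> - 1) * (\<Sum>j\<in>W. bump_deriv (x / h - real j))"
    using cell_width_pos by (simp add: powr_diff sum_divide_distrib[symmetric])
  ultimately show ?thesis by simp
qed

lemma powr_scaled_dist: "h powr \<theta> * \<bar>u / h - v / h\<bar> powr \<theta> = \<bar>u - v\<bar> powr \<theta>"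
  using cell_width_pos by (simp add: powr_mult[symmetric] diff_divide_distrib[symmetric])

text \<open>
  Rescaling a bump to width \<open>h\<close> and height \<open>h powr \<beta>\<close> leaves its Hoelder constant of order \<open>\<beta>\<close>
  unchanged; the sums of rescaled bumps are then controlled by the superposition bounds,
  applied to the bump itself if \<open>\<beta> \<le> 1\<close> and to its derivative if \<open>\<beta> > 1\<close>.
\<close>

lemma cube_in_holder_class:
  assumes L: "L \<ge> 12"
  shows "cube_density \<beta> h W \<in> holder_class \<beta> L"
proof -
  let ?f = "cube_density \<beta> h W"
  let ?f' = "\<lambda>x. - 6 * max 0 (1 - x) + h powr (\<beta> - 1) * (\<Sum>j\<in>W. bump_deriv (x / h - real j))"
  have out: "?f x = 0" if "x \<notin> {0..1}" for x
    using that perturbation_eq_0[of x] by (auto simp: cube_density_def base_density_def)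
  have bnd: "\<bar>?f u\<bar> \<le> L" for u
    using perturbation_bound[of u] base_density_le[of u] base_density_nonneg[of u] L unfolding cube_density_def by linarith
  show ?thesis
  proof (cases "\<beta> \<le> 1")
    case True
    have "\<bar>?f u - ?f v\<bar> / \<bar>u - v\<bar> powr (\<beta> - real 0) \<le> L" if "u > 0" "v > 0" "u \<noteq> v" for u v
    proof -
      have "\<bar>(\<Sum>j\<in>W. bump (u / h - real j)) - (\<Sum>j\<in>W. bump (v / h - real j))\<bar>
          \<le> 2 * (1 / 8) * \<bar>u / h - v / h\<bar> powr \<beta>"
        by (rule superposition_bounds(2)[where B = "1/16"])
          (use finite_cells bump_eq_0 abs_bump_le bump_lipschitz beta True in auto)
      then have "h powr \<beta> * \<bar>(\<Sum>j\<in>W. bump (u / h - real j)) - (\<Sum>j\<in>W. bump (v / h - real j))\<bar>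
          \<le> h powr \<beta> * (1 / 4 * \<bar>u / h - v / h\<bar> powr \<beta>)"
        by (intro mult_left_mono) auto
      also have "\<dots> = 1 / 4 * \<bar>u - v\<bar> powr \<beta>"
        using powr_scaled_dist[of \<beta> u v] beta by simp
      finally have "\<bar>h powr \<beta> * (\<Sum>j\<in>W. bump (u / h - real j)) - h powr \<beta> * (\<Sum>j\<in>W. bump (v / h - real j))\<bar>
          \<le> 1 / 4 * \<bar>u - v\<bar> powr \<beta>"
        by (simp add: abs_mult right_diff_distrib[symmetric])
      moreover have "\<bar>base_density u - base_density v\<bar> \<le> 6 * \<bar>u - v\<bar> powr \<beta>"
        using base_density_holder(1)[of u v \<beta>] that beta True by simp
      ultimately have "\<bar>?f u - ?f v\<bar> \<le> 7 * \<bar>u - v\<bar> powr \<beta>"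
        unfolding cube_density_def using powr_ge_zero[of "\<bar>u - v\<bar>" \<beta>] by linarith
      also have "\<dots> \<le> L * \<bar>u - v\<bar> powr \<beta>" using L by (intro mult_right_mono) auto
      finally show ?thesis using that by (simp add: divide_le_eq)
    qed
    then show ?thesis
      using holder_order_eq(1)[OF beta(1) True] is_density_cube out bnd
      by (auto simp: holder_class_def Let_def)
  next
    case False
    then have th: "0 < \<beta> - 1" "\<beta> - 1 \<le> 1" using beta by auto
    have d: "deriv ?f u = ?f' u" if "u > 0" for u by (rule DERIV_imp_deriv[OF DERIV_cube[OF that]])
    have sup': "\<bar>\<Sum>j\<in>W. bump_deriv (u / h - real j)\<bar> \<le> 1 / 8"
      "\<bar>(\<Sum>j\<in>W. bump_deriv (u / h - real j)) - (\<Sum>j\<in>W. bump_deriv (v / h - real j))\<bar>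
        \<le> 2 * 3 * \<bar>u / h - v / h\<bar> powr (\<beta> - 1)" for u v
      by (rule superposition_bounds[where g = bump_deriv and B = "1/8" and K = 3 and \<theta> = "\<beta> - 1"];
          use finite_cells bump_deriv_eq_0 abs_bump_deriv_le bump_deriv_lipschitz th in auto)+
    have bnd': "\<bar>?f' u\<bar> \<le> L" if "u > 0" for u
    proof -
      have "\<bar>h powr (\<beta> - 1) * (\<Sum>j\<in>W. bump_deriv (u / h - real j))\<bar> \<le> 1 * (1 / 8)"
        unfolding abs_mult using sup'(1)[of u] cell_width_powr_bounds[of "\<beta> - 1"] th by (intro mult_mono) auto
      then show ?thesis using that L by (auto simp: max_def abs_le_iff)
    qed
    have "\<bar>?f' u - ?f' v\<bar> / \<bar>u - v\<bar> powr (\<beta> - real 1) \<le> L" if "u > 0" "v > 0" "u \<noteq> v" for u v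
    proof -
      have "h powr (\<beta> - 1) * \<bar>(\<Sum>j\<in>W. bump_deriv (u / h - real j)) - (\<Sum>j\<in>W. bump_deriv (v / h - real j))\<bar>
          \<le> h powr (\<beta> - 1) * (6 * \<bar>u / h - v / h\<bar> powr (\<beta> - 1))"
        using sup'(2)[of u v] by (intro mult_left_mono) auto
      also have "\<dots> = 6 * \<bar>u - v\<bar> powr (\<beta> - 1)"
        using powr_scaled_dist[of "\<beta> - 1" u v] th by simp
      finally have "\<bar>h powr (\<beta> - 1) * (\<Sum>j\<in>W. bump_deriv (u / h - real j)) - h powr (\<beta> - 1) * (\<Sum>j\<in>W. bump_deriv (v / h - real j))\<bar>
          \<le> 6 * \<bar>u - v\<bar> powr (\<beta> - 1)"
        by (simp add: abs_mult right_diff_distrib[symmetric])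
      with base_density_holder(2)[OF that(1,2) th] have "\<bar>?f' u - ?f' v\<bar> \<le> 12 * \<bar>u - v\<bar> powr (\<beta> - 1)"
        by linarith
      also have "\<dots> \<le> L * \<bar>u - v\<bar> powr (\<beta> - 1)" using L by (intro mult_right_mono) auto
      finally show ?thesis using that by (simp add: divide_le_eq)
    qed
    moreover have "?f field_differentiable at u" if "u > 0" for u
      using DERIV_cube[OF that] by (auto simp: field_differentiable_def)
    moreover have "\<bar>(deriv ^^ k) ?f u\<bar> \<le> L" if "k \<le> 1" "u > 0" for k u
    proof -
      from that have "k = 0 \<or> k = 1" by auto
      then show ?thesis using bnd bnd' d that by auto
    qed
    moreover have "holder_order \<beta> = 1" using holder_order_eq(2) False beta by simp
    ultimately show ?thesis
      using is_density_cube out by (simp add: holder_class_def d)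
  qed
qed

text \<open>
  With \<open>f\<close> the density without the bump and \<open>d\<close> the bump, the integrand is \<open>f + 2 * d + d\<^sup>2 / f\<close>. The
  first term integrates to \<open>1\<close> and the second to \<open>0\<close>, so only the quadratic term, supported
  on one cell of width \<open>h\<close>, contributes.
\<close>

lemma chi_square_cube:
  assumes j: "j < M" "j \<notin> W"
  shows "(\<integral>\<^sup>+x. ennreal ((cube_density \<beta> h (insert j W) x)\<^sup>2 / cube_density \<beta> h W x) \<partial>lborel)
    \<le> ennreal (1 + h powr (2 * \<beta> + 1) / 128)"
proof -
  let ?f = "cube_density \<beta> h W"
  let ?d = "\<lambda>x. h powr \<beta> * bump (x / h - real j)"
  let ?I = "{real j * h..(real j + 1) * h}"
  let ?u = "\<lambda>x. ?f x + 2 * ?d x + h powr (2 * \<beta>) / 128 * indicator ?I x"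
  have hb: "has_bochner_integral lborel ?u (1 + 2 * (h powr \<beta> * 0) + h powr (2 * \<beta>) / 128 * h)"
  proof (intro has_bochner_integral_add has_bochner_integral_mult_right integral_cube_density
      lborel_integral_scaled_bump cell_width_pos)
    have "has_bochner_integral lborel (indicator ?I :: real \<Rightarrow> real) (measure lborel ?I)"
      using cell_width_pos by (intro has_bochner_integral_real_indicator) auto
    also have "measure lborel ?I = h" using cell_width_pos by (simp add: algebra_simps)
    finally show "has_bochner_integral lborel (indicator ?I :: real \<Rightarrow> real) h" .
  qed
  have le: "(cube_density \<beta> h (insert j W) x)\<^sup>2 / ?f x \<le> ?u x" for x
  proof (cases "x / h - real j \<in> {0<..<1}")
    case True
    then have I: "x \<in> ?I" using cell_width_pos by (auto simp: field_simps)
    have f: "1 / 2 \<le> ?f x" using support_in_left_half[OF j(1) True] by (intro cube_density_ge) auto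
    have d2: "(?d x)\<^sup>2 \<le> h powr (2 * \<beta>) / 256"
    proof -
      have "(?d x)\<^sup>2 = h powr (2 * \<beta>) * \<bar>bump (x / h - real j)\<bar>\<^sup>2"
        by (simp add: power_mult_distrib powr_add[symmetric] power2_eq_square)
      also have "\<dots> \<le> h powr (2 * \<beta>) * (1 / 16)\<^sup>2"
        by (intro mult_left_mono power_mono abs_bump_le) auto
      finally show ?thesis by (simp add: power2_eq_square)
    qed
    have "(cube_density \<beta> h (insert j W) x)\<^sup>2 / ?f x = ?f x + 2 * ?d x + (?d x)\<^sup>2 / ?f x"
      using f unfolding cube_density_insert[OF finite_cells j(2)] by (simp add: field_simps power2_eq_square)
    also have "(?d x)\<^sup>2 / ?f x \<le> (h powr (2 * \<beta>) / 256) / (1 / 2)"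
      using f d2 by (intro frac_le) auto
    finally show ?thesis using I by simp
  next
    case False
    then have "bump (x / h - real j) = 0" by (rule bump_eq_0)
    then show ?thesis
      using cube_density_nonneg[of x] by (cases "?f x = 0") (simp_all add: cube_density_insert[OF finite_cells j(2)] power2_eq_square)
  qed
  have nn: "0 \<le> ?u x" for x
    using cube_density_nonneg[of x] by (intro order_trans[OF _ le]) auto
  have "(\<integral>\<^sup>+x. ennreal ((cube_density \<beta> h (insert j W) x)\<^sup>2 / ?f x) \<partial>lborel) \<le> (\<integral>\<^sup>+x. ennreal (?u x) \<partial>lborel)"
    by (intro nn_integral_mono ennreal_leI le)
  also have "\<dots> = ennreal (1 + h powr (2 * \<beta>) / 128 * h)"
    using hb nn by (subst nn_integral_eq_integral) (auto simp: has_bochner_integral_iff)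
  also have "h powr (2 * \<beta>) / 128 * h = h powr (2 * \<beta> + 1) / 128"
    using cell_width_pos by (simp add: powr_add)
  finally show ?thesis .
qed

lemma cube_separation:
  assumes j: "j < M" "j \<notin> W"
  shows "ennreal (h powr (\<beta> + 1) / 192)
    \<le> (\<integral>\<^sup>+x. ennreal \<bar>cube_density \<beta> h (insert j W) x - cube_density \<beta> h W x\<bar>
        * indicator {real j * h<..<(real j + 1) * h} x \<partial>lborel)"
proof -
  have "ennreal (h powr (\<beta> + 1) / 192) = ennreal (h powr (\<beta> + 1)) * ennreal (1 / 192)"
    by (subst ennreal_mult[symmetric]) auto
  also have "\<dots> \<le> ennreal (h powr (\<beta> + 1)) * (\<integral>\<^sup>+t. ennreal \<bar>bump t\<bar> * indicator {0<..<1} t \<partial>lborel)"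
    by (intro mult_left_mono nn_integral_abs_bump_ge) auto
  also have "\<dots> = ennreal h * (\<integral>\<^sup>+t. ennreal (h powr \<beta>) * (ennreal \<bar>bump t\<bar> * indicator {0<..<1} t) \<partial>lborel)"
    using cell_width_pos by (subst nn_integral_cmult) (auto simp: powr_add ennreal_mult mult_ac)
  also have "\<dots> = ennreal h * (\<integral>\<^sup>+t. ennreal \<bar>h powr \<beta> * bump ((real j * h + h * t) / h - real j)\<bar>
      * indicator {real j * h<..<(real j + 1) * h} (real j * h + h * t) \<partial>lborel)"
  proof -
    have "ennreal (h powr \<beta>) * (ennreal \<bar>bump t\<bar> * indicator {0<..<1} t)
      = ennreal \<bar>h powr \<beta> * bump ((real j * h + h * t) / h - real j)\<bar>
      * indicator {real j * h<..<(real j + 1) * h} (real j * h + h * t)" for t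
    proof -
      have "(real j * h + h * t) / h - real j = t" using cell_width_pos by (simp add: field_simps)
      moreover have "real j * h + h * t \<in> {real j * h<..<(real j + 1) * h} \<longleftrightarrow> t \<in> {0<..<1}"
        using cell_width_pos by (auto simp: algebra_simps zero_less_mult_iff)
      ultimately show ?thesis by (simp add: indicator_def abs_mult ennreal_mult)
    qed
    then show ?thesis by simp
  qed
  also have "\<dots> = (\<integral>\<^sup>+x. ennreal \<bar>h powr \<beta> * bump (x / h - real j)\<bar>
      * indicator {real j * h<..<(real j + 1) * h} x \<partial>lborel)"
    using cell_width_pos by (subst nn_integral_real_affine[where c = h and t = "real j * h"]) auto
  finally show ?thesis by (simp add: cube_density_insert[OF finite_cells j(2)])
qed

end

section \<open>The minimax lower bound\<close>

text \<open>
  A replacement for Jensen's inequality that works under any integral.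
\<close>

lemma le_threshold_plus_powr:
  fixes t \<tau> p :: real
  assumes "0 \<le> t" "0 < \<tau>" "1 \<le> p"
  shows "t \<le> \<tau> + \<tau> powr (1 - p) * t powr p"
proof (cases "t \<le> \<tau>")
  case False
  then have "t = \<tau> powr (1 - p) * (\<tau> powr (p - 1) * t)"
    using assms by (simp add: mult.assoc[symmetric] powr_add[symmetric])
  also have "\<tau> powr (p - 1) \<le> t powr (p - 1)"
    using False assms by (intro powr_mono2) auto
  finally have "t \<le> \<tau> powr (1 - p) * (t powr (p - 1) * t)"
    using assms by (simp add: mult_left_mono mult_right_mono)
  also have "t powr (p - 1) * t = t powr p"
    using False assms by (simp add: powr_diff)
  finally show ?thesis using assms by simp
qed (auto intro!: add_increasing2)

text \<open>
  The averaging step of Assouad's lemma: the subsets of \<open>S\<close> fall into pairs that differ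
  only in the element \<open>j\<close>.
\<close>

lemma sum_Pow_insert_ge:
  fixes F :: "'a set \<Rightarrow> ennreal"
  assumes S: "finite S" "j \<in> S"
    and F: "\<And>W. W \<subseteq> S \<Longrightarrow> j \<notin> W \<Longrightarrow> D \<le> F W + F (insert j W)"
  shows "of_nat (2 ^ (card S - 1)) * D \<le> (\<Sum>W\<in>Pow S. F W)"
proof -
  let ?R = "S - {j}"
  have S': "Pow S = Pow ?R \<union> insert j ` Pow ?R"
    using Pow_insert[of j ?R] S by (simp add: insert_absorb)
  have "of_nat (2 ^ (card S - 1)) * D = (\<Sum>W\<in>Pow ?R. D)"
    using S by (simp add: card_Pow)
  also have "\<dots> \<le> (\<Sum>W\<in>Pow ?R. F W + F (insert j W))"
    using F by (intro sum_mono) auto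
  also have "\<dots> = (\<Sum>W\<in>Pow ?R. F W) + (\<Sum>W\<in>insert j ` Pow ?R. F W)"
    by (subst sum.reindex) (auto simp: inj_on_def sum.distrib)
  also have "\<dots> = (\<Sum>W\<in>Pow S. F W)"
    unfolding S' using S by (intro sum.union_disjoint[symmetric]) auto
  finally show ?thesis .
qed

text \<open>
  Estimators are measurable on the half-line only; composing with \<open>max 0\<close> gives a function on the
  whole line to which Tonelli's theorem for Lebesgue measure applies.
\<close>

lemma estimator_measurable_extension:
  assumes "T \<in> estimators n"
  shows "(\<lambda>(X, x). T X (max 0 x)) \<in> borel_measurable ((\<Pi>\<^sub>M i\<in>{1..n}. borel) \<Otimes>\<^sub>M lborel)"
proof -
  let ?P = "\<Pi>\<^sub>M i\<in>{1..n}. borel :: real measure"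
  have T: "(\<lambda>(X, x). T X x) \<in> borel_measurable (?P \<Otimes>\<^sub>M restrict_space borel {0..})"
    using assms by (simp add: estimators_def)
  have "(\<lambda>(X, x). (X, max 0 x)) \<in> ?P \<Otimes>\<^sub>M lborel \<rightarrow>\<^sub>M ?P \<Otimes>\<^sub>M restrict_space borel {0::real..}"
    unfolding case_prod_beta
    by (intro measurable_Pair measurable_fst measurable_restrict_space2) auto
  from measurable_comp[OF this T] show ?thesis
    by (simp add: comp_def case_prod_beta)
qed

text \<open>
  Assouad's argument. For each cell the two-point bound applies to every pair of vertices that
  differ in that cell. Summing over cells and averaging over vertices bounds the average \<open>L\<^sup>1\<close> loss
  from below by \<open>M\<close> times the separation on a cell, up to a constant; since \<open>M * h = 1 / 2\<close>, this is of
  order \<open>h powr \<beta>\<close>. The maximal risk dominates the average.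
\<close>

lemma hypercube_lower_bound:
  fixes \<beta> p L :: real and n M :: nat
  assumes beta: "0 < \<beta>" "\<beta> \<le> 2" and L: "L \<ge> 12" and p: "p \<ge> 1" and M: "M \<ge> 1"
    and h: "h = 1 / (2 * real M)" and nh: "real n * h powr (2 * \<beta> + 1) \<le> 1"
    and T: "T \<in> estimators n"
  shows "ennreal (h powr \<beta> / 6144) \<le> max_risk p n T (holder_class \<beta> L)"
proof (cases "max_risk p n T (holder_class \<beta> L)")
  case (real \<rho>)
  have cell_width_pos: "h > 0" using M by (simp add: h)
  let ?P = "\<Pi>\<^sub>M i\<in>{1..n}. borel :: real measure"
  define f where "f W = cube_density \<beta> h W" for W
  define C where "C j = {real j * h<..<(real j + 1) * h}" for j :: nat
  define A where "A W j X = (\<integral>\<^sup>+x. ennreal \<bar>T X (max 0 x) - f W x\<bar> * indicator (C j) x \<partial>lborel)" for W j X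
  \<comment> \<open>Half of the lower bound for the average \<open>L\<^sup>1\<close> loss, so that the other half is left for
    the \<open>p\<close>-th power term.\<close>
  define \<tau> where "\<tau> = h powr \<beta> / 6144"
  have tau: "\<tau> > 0" using cell_width_pos by (simp add: \<tau>_def)
  note Tm[measurable] = estimator_measurable_extension[OF T, unfolded case_prod_beta]
  have [measurable]: "f W \<in> borel_measurable borel" for W unfolding f_def by measurable
  have [measurable]: "C j \<in> sets borel" for j unfolding C_def by simp
  have joint: "(\<lambda>z. ennreal \<bar>T (fst z) (max 0 (snd z)) - f W (snd z)\<bar> * indicator (C j) (snd z))
      \<in> borel_measurable (?P \<Otimes>\<^sub>M lborel)" for W j
    by measurable
  have Am[measurable]: "A W j \<in> borel_measurable ?P" for W j
    unfolding A_def using lborel.borel_measurable_nn_integral_fst[OF joint[of W j]] by simp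
  have ex: "exp 1 \<le> (3::real)" by (rule exp_le)
  have dens: "is_density (f W)" if "W \<subseteq> {..<M}" for W
    unfolding f_def by (rule is_density_cube[OF M h beta that])
  \<comment> \<open>A quarter of the separation on a cell: the likelihood overlap is at least \<open>1 - 3 / 4\<close>.\<close>
  define D where "D = h powr (\<beta> + 1) / 768"
  have pair: "ennreal D \<le> (\<integral>\<^sup>+X. A W j X \<partial>sample_law n (f W)) + (\<integral>\<^sup>+X. A (insert j W) j X \<partial>sample_law n (f (insert j W)))"
    if W: "W \<subseteq> {..<M}" and j: "j < M" "j \<notin> W" for W j
  proof -
    define \<rho> where "\<rho> = 1 + h powr (2 * \<beta> + 1) / 128"
    have ins: "insert j W \<subseteq> {..<M}" using W j by auto
    have "\<rho> ^ n \<le> exp (h powr (2 * \<beta> + 1) / 128) ^ n"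
      unfolding \<rho>_def by (intro power_mono exp_ge_add_one_self) auto
    also have "\<dots> = exp (real n * h powr (2 * \<beta> + 1) / 128)" by (simp add: exp_of_nat_mult[symmetric])
    also have "\<dots> \<le> exp 1" using nh by simp
    finally have rho: "\<rho> ^ n \<le> 3" using ex by linarith
    have "D \<le> h powr (\<beta> + 1) / 192 * (1 - \<rho> ^ n / 4)"
    proof -
      have "h powr (\<beta> + 1) / 192 * (1 / 4) \<le> h powr (\<beta> + 1) / 192 * (1 - \<rho> ^ n / 4)"
        using rho by (intro mult_left_mono) auto
      then show ?thesis by (simp add: D_def)
    qed
    then have "ennreal D \<le> ennreal (h powr (\<beta> + 1) / 192 * (1 - \<rho> ^ n / 4))" by (rule ennreal_leI)
    also have "\<dots> \<le> (\<integral>\<^sup>+X. A W j X \<partial>sample_law n (f W)) + (\<integral>\<^sup>+X. A (insert j W) j X \<partial>sample_law n (f (insert j W)))"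
    proof (rule two_point_lower_bound[OF dens[OF W] dens[OF ins] _ Am Am])
      show "(\<integral>\<^sup>+x. ennreal ((f (insert j W) x)\<^sup>2 / f W x) \<partial>lborel) \<le> ennreal \<rho>"
        unfolding f_def \<rho>_def by (rule chi_square_cube[OF M h beta W j])
      show "f (insert j W) x = 0" if "f W x = 0" for x
      proof -
        have "\<not> x / h - real j \<in> {0<..<1}"
        proof
          assume "x / h - real j \<in> {0<..<1}"
          from support_in_left_half[OF M h beta W j(1) this] cube_density_ge[OF M h beta W, of x] that
          show False by (simp add: f_def)
        qed
        then show ?thesis
          using that cube_density_insert[OF finite_cells[OF M h beta W] j(2), of \<beta> h x] by (simp add: f_def bump_eq_0)
      qed
      fix X assume X: "X \<in> space ?P"
      have "ennreal (h powr (\<beta> + 1) / 192) \<le> (\<integral>\<^sup>+x. ennreal \<bar>f (insert j W) x - f W x\<bar> * indicator (C j) x \<partial>lborel)"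
        unfolding f_def C_def by (rule cube_separation[OF M h beta W j])
      also have "\<dots> \<le> (\<integral>\<^sup>+x. ennreal \<bar>T X (max 0 x) - f W x\<bar> * indicator (C j) x
          + ennreal \<bar>T X (max 0 x) - f (insert j W) x\<bar> * indicator (C j) x \<partial>lborel)"
        by (intro nn_integral_mono) (auto simp: indicator_def ennreal_plus[symmetric] simp del: ennreal_plus intro!: ennreal_leI)
      also have "\<dots> = A W j X + A (insert j W) j X"
      proof -
        have "(\<lambda>x. ennreal \<bar>T X (max 0 x) - f V x\<bar> * indicator (C j) x) \<in> borel_measurable lborel" for V
        proof -
          have [measurable]: "(\<lambda>x. T X (max 0 x)) \<in> borel_measurable borel"
            using measurable_Pair2[OF Tm X] by simp
          show ?thesis by measurable
        qed
        then show ?thesis unfolding A_def by (intro nn_integral_add) auto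
      qed
      finally show "ennreal (h powr (\<beta> + 1) / 192) \<le> A W j X + A (insert j W) j X" .
    qed (auto simp: \<rho>_def)
    finally show ?thesis .
  qed
  have upper: "(\<Sum>j<M. \<integral>\<^sup>+X. A W j X \<partial>sample_law n (f W)) \<le> ennreal (\<tau> + \<tau> powr (1 - p) * \<rho> powr p)"
    if W: "W \<subseteq> {..<M}" for W
  proof -
    interpret S: prob_space "sample_law n (f W)" by (rule prob_space_sample_law[OF dens[OF W]])
    let ?J = "\<lambda>X. \<integral>\<^sup>+x. ennreal (\<bar>T X x - f W x\<bar> powr p) * indicator {0..} x \<partial>lborel"
    have fH: "f W \<in> holder_class \<beta> L"
      unfolding f_def by (rule cube_in_holder_class[OF M h beta W L])
    have "risk p n T (f W) \<le> ennreal \<rho>"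
      using fH real unfolding max_risk_def by (metis SUP_upper)
    then have J: "(\<integral>\<^sup>+X. ?J X \<partial>sample_law n (f W)) \<le> ennreal (\<rho> powr p)"
      using p real by (intro loss_le_of_risk_le) auto
    have Jeq: "?J X = (\<integral>\<^sup>+x. ennreal (\<bar>T X (max 0 x) - f W x\<bar> powr p) * indicator {0..} x \<partial>lborel)" for X
      by (intro nn_integral_cong) (auto simp: indicator_def max_def)
    have Jm[measurable]: "?J \<in> borel_measurable ?P"
    proof -
      have "(\<lambda>z. ennreal (\<bar>T (fst z) (max 0 (snd z)) - f W (snd z)\<bar> powr p) * indicator {0..} (snd z))
          \<in> borel_measurable (?P \<Otimes>\<^sub>M lborel)" by measurable
      from lborel.borel_measurable_nn_integral_fst[OF this] show ?thesis unfolding Jeq by simp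
    qed
    have pointwise: "(\<Sum>j<M. A W j X) \<le> ennreal \<tau> + ennreal (\<tau> powr (1 - p)) * ?J X" if X: "X \<in> space ?P" for X
    proof -
      have TX[measurable]: "(\<lambda>x. T X (max 0 x)) \<in> borel_measurable lborel"
        using measurable_Pair2[OF Tm X] by simp
      have "(\<Sum>j<M. A W j X) = (\<integral>\<^sup>+x. (\<Sum>j<M. ennreal \<bar>T X (max 0 x) - f W x\<bar> * indicator (C j) x) \<partial>lborel)"
        unfolding A_def by (subst nn_integral_sum) auto
      also have "\<dots> \<le> (\<integral>\<^sup>+x. ennreal \<tau> * indicator {0..1} x
          + ennreal (\<tau> powr (1 - p)) * (ennreal (\<bar>T X (max 0 x) - f W x\<bar> powr p) * indicator {0..} x) \<partial>lborel)"
      proof (intro nn_integral_mono)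
        fix x :: real
        have eq: "(\<Sum>j<M. indicator (C j) x :: ennreal) = (\<Sum>j\<in>{..<M} \<inter> {nat \<lfloor>x / h\<rfloor>}. indicator (C j) x)"
        proof (intro sum.mono_neutral_right ballI)
          fix j assume "j \<in> {..<M} - {..<M} \<inter> {nat \<lfloor>x / h\<rfloor>}"
          then have "\<not> x / h - real j \<in> {0<..<1}" using floor_eq_cell_index[of "x / h" j] by auto
          then have "x \<notin> C j" using cell_width_pos by (auto simp: C_def field_simps)
          then show "indicator (C j) x = (0 :: ennreal)" by simp
        qed auto
        have sub: "C j \<subseteq> {0..1}" if "j < M" for j
        proof
          fix x assume x: "x \<in> C j"
          then have "x / h - real j \<in> {0<..<1}" using cell_width_pos by (auto simp: C_def field_simps)
          from support_in_left_half[OF M h beta W that this] show "x \<in> {0..1}" by simp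
        qed
        have ind: "(\<Sum>j<M. indicator (C j) x :: ennreal) \<le> indicator {0..1} x"
        proof (cases "nat \<lfloor>x / h\<rfloor> < M")
          case True
          then have "{..<M} \<inter> {nat \<lfloor>x / h\<rfloor>} = {nat \<lfloor>x / h\<rfloor>}" by auto
          then have "(\<Sum>j<M. indicator (C j) x :: ennreal) = indicator (C (nat \<lfloor>x / h\<rfloor>)) x"
            unfolding eq by (simp del: Int_insert_right_if1)
          also have "\<dots> \<le> indicator {0..1} x" using sub[OF True] by (auto simp: indicator_def)
          finally show ?thesis .
        qed (simp add: eq)
        have "(\<Sum>j<M. ennreal \<bar>T X (max 0 x) - f W x\<bar> * indicator (C j) x)
            = ennreal \<bar>T X (max 0 x) - f W x\<bar> * (\<Sum>j<M. indicator (C j) x)"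
          by (simp add: sum_distrib_left)
        also have "\<dots> \<le> ennreal \<bar>T X (max 0 x) - f W x\<bar> * indicator {0..1} x"
          by (intro mult_left_mono ind) simp
        also have "\<dots> \<le> ennreal (\<tau> + \<tau> powr (1 - p) * \<bar>T X (max 0 x) - f W x\<bar> powr p) * indicator {0..1} x"
          using tau p by (intro mult_right_mono ennreal_leI le_threshold_plus_powr) auto
        also have "\<dots> \<le> ennreal \<tau> * indicator {0..1} x
            + ennreal (\<tau> powr (1 - p)) * (ennreal (\<bar>T X (max 0 x) - f W x\<bar> powr p) * indicator {0..} x)"
          using tau by (auto simp: indicator_def ennreal_mult)
        finally show "(\<Sum>j<M. ennreal \<bar>T X (max 0 x) - f W x\<bar> * indicator (C j) x) \<le> \<dots>" .
      qed
      also have "\<dots> = ennreal \<tau> + ennreal (\<tau> powr (1 - p)) * ?J X"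
        unfolding Jeq by (simp add: nn_integral_add nn_integral_cmult nn_integral_cmult_indicator)
      finally show ?thesis .
    qed
    have "(\<Sum>j<M. \<integral>\<^sup>+X. A W j X \<partial>sample_law n (f W)) = (\<integral>\<^sup>+X. (\<Sum>j<M. A W j X) \<partial>sample_law n (f W))"
      by (subst nn_integral_sum) auto
    also have "\<dots> \<le> (\<integral>\<^sup>+X. ennreal \<tau> + ennreal (\<tau> powr (1 - p)) * ?J X \<partial>sample_law n (f W))"
      using pointwise sets_eq_imp_space_eq[OF sets_sample_law[of n "f W"]] by (intro nn_integral_mono) auto
    also have "\<dots> = ennreal \<tau> + ennreal (\<tau> powr (1 - p)) * (\<integral>\<^sup>+X. ?J X \<partial>sample_law n (f W))"
      by (subst nn_integral_add) (auto simp: nn_integral_cmult S.emeasure_space_1)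
    also have "\<dots> \<le> ennreal \<tau> + ennreal (\<tau> powr (1 - p)) * ennreal (\<rho> powr p)"
      by (intro add_left_mono mult_left_mono J) auto
    also have "\<dots> = ennreal (\<tau> + \<tau> powr (1 - p) * \<rho> powr p)"
      using tau by (simp add: ennreal_mult)
    finally show ?thesis .
  qed
  define R where "R = \<tau> + \<tau> powr (1 - p) * \<rho> powr p"
  have R: "R \<ge> 0" using tau by (simp add: R_def)
  let ?E = "\<lambda>W j. \<integral>\<^sup>+X. A W j X \<partial>sample_law n (f W)"
  have "ennreal (real M * 2 ^ (M - 1) * D) = (\<Sum>j<M. of_nat (2 ^ (card {..<M} - 1)) * ennreal D)"
  proof -
    have "0 \<le> D" by (simp add: D_def)
    then have "ennreal (real M * 2 ^ (M - 1) * D) = ennreal (real M) * (ennreal (real (2 ^ (M - 1))) * ennreal D)"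
      by (simp add: ennreal_mult mult.assoc)
    then show ?thesis by (simp add: ennreal_of_nat_eq_real_of_nat)
  qed
  also have "\<dots> \<le> (\<Sum>j<M. \<Sum>W\<in>Pow {..<M}. ?E W j)"
    using pair by (intro sum_mono sum_Pow_insert_ge) auto
  also have "\<dots> = (\<Sum>W\<in>Pow {..<M}. \<Sum>j<M. ?E W j)" by (rule sum.swap)
  also have "\<dots> \<le> (\<Sum>W\<in>Pow {..<M}. ennreal R)"
    unfolding R_def using upper by (intro sum_mono) auto
  also have "\<dots> = ennreal (2 ^ M * R)"
    using R by (simp add: card_Pow ennreal_mult ennreal_power[symmetric])
  finally have "real M * 2 ^ (M - 1) * D \<le> 2 ^ M * R"
    using R by (subst (asm) ennreal_le_iff) auto
  also have "(2::real) ^ M = 2 ^ (M - 1) * 2" using M by (cases M) auto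
  \<comment> \<open>All \<open>2 ^ M\<close> vertices were summed, but each cell has only \<open>2 ^ (M - 1)\<close> pairs of them.\<close>
  finally have "real M * D \<le> 2 * R" by (simp add: mult.assoc mult.left_commute)
  moreover have "real M * D = 4 * \<tau>"
  proof -
    have Mh: "real M * h = 1 / 2" using M by (simp add: h)
    have "real M * (h powr \<beta> * h) = h powr \<beta> * (real M * h)" by (simp only: mult_ac)
    then have "real M * (h powr \<beta> * h) = h powr \<beta> / 2" unfolding Mh by simp
    moreover have "D = h powr \<beta> * h / 768" using cell_width_pos by (simp add: D_def powr_add)
    ultimately have "real M * D = h powr \<beta> / 2 / 768" by (metis times_divide_eq_right)
    then show ?thesis by (simp add: \<tau>_def)
  qed
  ultimately have tr: "\<tau> \<le> \<tau> powr (1 - p) * \<rho> powr p" by (simp add: R_def)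
  have "\<tau> \<le> \<rho>"
  proof (rule ccontr)
    assume "\<not> \<tau> \<le> \<rho>"
    then have "\<rho> powr p < \<tau> powr p" using real p by (intro powr_less_mono2) auto
    then have "\<tau> powr (1 - p) * \<rho> powr p < \<tau> powr (1 - p) * \<tau> powr p"
      using tau by (intro mult_strict_left_mono) auto
    also have "\<dots> = \<tau>" using tau by (simp add: powr_add[symmetric])
    finally show False using tr by simp
  qed
  then show ?thesis using real by (auto simp: \<tau>_def intro!: ennreal_leI)
qed (simp)


text \<open>
  With \<open>n powr (1 / (2 * \<beta> + 1))\<close> cells, up to rounding, the \<open>\<chi>\<^sup>2\<close> effect of one bump on the whole
  sample stays bounded, and \<open>h powr \<beta>\<close> is of the order of the rate.
\<close>

lemma minimax_risk_lower:
  assumes beta: "0 < \<beta>" "\<beta> \<le> 2" and L: "L \<ge> 12" and p: "p \<ge> 1" and n: "n \<ge> 1"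
  shows "ennreal (real n powr (- \<beta> / (2 * \<beta> + 1)) / 98304) \<le> minimax_risk p n (holder_class \<beta> L)"
proof -
  define s where "s = real n powr (1 / (2 * \<beta> + 1))"
  define M where "M = nat \<lceil>s\<rceil>"
  define h where "h = 1 / (2 * real M)"
  have s1: "s \<ge> 1" using n beta by (auto simp: s_def intro!: ge_one_powr_ge_zero)
  then have M: "M \<ge> 1" "s \<le> real M" "real M \<le> 2 * s" unfolding M_def by linarith+
  have h0: "h > 0" using M by (simp add: h_def)
  have hs: "h \<le> 1 / s" "1 / (4 * s) \<le> h"
    unfolding h_def using M s1 by (intro frac_le; simp)+
  have "h powr (2 * \<beta> + 1) \<le> (1 / s) powr (2 * \<beta> + 1)"
    using hs h0 beta by (intro powr_mono2) auto
  also have "\<dots> = 1 / real n"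
    using s1 n beta by (simp add: s_def powr_divide powr_powr)
  finally have nh: "real n * h powr (2 * \<beta> + 1) \<le> 1" using n by (simp add: field_simps)
  have "ennreal (h powr \<beta> / 6144) \<le> max_risk p n T (holder_class \<beta> L)" if "T \<in> estimators n" for T
    by (rule hypercube_lower_bound[OF beta L p M(1) h_def nh that])
  then have "ennreal (h powr \<beta> / 6144) \<le> minimax_risk p n (holder_class \<beta> L)"
    unfolding minimax_risk_def by (rule INF_greatest)
  moreover have "real n powr (- \<beta> / (2 * \<beta> + 1)) / 98304 \<le> h powr \<beta> / 6144"
  proof -
    have "4 powr \<beta> \<le> (4::real) powr 2" using beta by (intro powr_mono) auto
    then have "(4::real) powr \<beta> \<le> 16" by simp
    then have "real n powr (- \<beta> / (2 * \<beta> + 1)) / 16 \<le> real n powr (- \<beta> / (2 * \<beta> + 1)) / 4 powr \<beta>"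
      by (intro divide_left_mono) auto
    also have "\<dots> = (1 / (4 * s)) powr \<beta>"
      using s1 n by (simp add: powr_divide powr_mult s_def powr_powr powr_minus field_simps)
    also have "\<dots> \<le> h powr \<beta>"
      using hs s1 beta by (intro powr_mono2) auto
    finally show ?thesis by simp
  qed
  ultimately show ?thesis by (meson ennreal_leI order_trans)
qed

section \<open>Size and moments of the gamma kernel\<close>

text \<open>
  The Gamma function has poles on the real line, but its reciprocal is continuous everywhere.
\<close>

lemma measurable_Gamma [measurable]: "(Gamma :: real \<Rightarrow> real) \<in> borel_measurable borel"
proof -
  have "(rGamma :: real \<Rightarrow> real) \<in> borel_measurable borel"
    by (intro borel_measurable_continuous_onI continuous_intros)
  then have "(\<lambda>x::real. inverse (rGamma x)) \<in> borel_measurable borel" by measurable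
  then show ?thesis by (simp add: rGamma_inverse_Gamma)
qed

lemma measurable_gamma_kernel [measurable]:
  "(\<lambda>(x, t). gamma_kernel b x t) \<in> borel_measurable (borel \<Otimes>\<^sub>M borel)"
  unfolding gamma_kernel_def by measurable

lemma gamma_kernel_nonneg: "b > 0 \<Longrightarrow> x \<ge> 0 \<Longrightarrow> 0 \<le> gamma_kernel b x t"
  unfolding gamma_kernel_def
  by (intro mult_nonneg_nonneg divide_nonneg_nonneg Gamma_real_nonneg) (auto simp: add_nonneg_pos)

lemma powr_times_exp_le_max:
  fixes a y :: real
  assumes "a > 0" "y \<ge> 0"
  shows "y powr a * exp (- y) \<le> a powr a * exp (- a)"
proof (cases "y = 0")
  case False
  then have y: "y > 0" using assms by simp
  have "ln (y / a) \<le> y / a - 1" using y assms by (intro ln_le_minus_one) auto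
  then have "a * ln (y / a) \<le> a * (y / a - 1)" using assms by (intro mult_left_mono) auto
  then have "a * ln y - y \<le> a * ln a - a" using y assms by (simp add: ln_div algebra_simps)
  then show ?thesis using y assms by (simp add: powr_def exp_add[symmetric])
qed (use assms in simp)

text \<open>
  A one-sided Stirling bound. In Euler's integral the integrand \<open>t powr a * exp (- t)\<close> has its
  maximum at \<open>t = a\<close>. For the first bound, \<open>t powr a\<close> is replaced by \<open>a powr a\<close> on \<open>[a, \<infinity>)\<close>; for the
  second, the integrand stays above a third of its maximum on an interval of length \<open>sqrt a\<close>.
\<close>

lemma Gamma_ge:
  fixes a :: real
  assumes a: "a > 0"
  shows "a powr a * exp (- a) \<le> Gamma (a + 1)"
    and "a powr a * exp (- a) * sqrt a / 3 \<le> Gamma (a + 1)"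
proof -
  let ?m = "a powr a * exp (- a)"
  have G: "ennreal (Gamma (a + 1)) = (\<integral>\<^sup>+t. ennreal (indicator {0..} t * t powr a / exp t) \<partial>lborel)"
    using Gamma_conv_nn_integral_real[of "a + 1"] a by simp
  have G0: "Gamma (a + 1) > 0" using a by (intro Gamma_real_pos) auto
  have "ennreal ?m = ennreal (a powr a) * ennreal (exp (- a))" by (simp add: ennreal_mult)
  also have "ennreal (exp (- a)) = (\<integral>\<^sup>+t. ennreal (exp (- t)) * indicator {a..} t \<partial>lborel)"
    using nn_integral_has_integral_lebesgue'[OF _ has_integral_exp_minus_to_infinity[of 1 a]] by simp
  also have "ennreal (a powr a) * \<dots> = (\<integral>\<^sup>+t. ennreal (a powr a) * (ennreal (exp (- t)) * indicator {a..} t) \<partial>lborel)"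
    by (simp add: nn_integral_cmult)
  also have "\<dots> \<le> (\<integral>\<^sup>+t. ennreal (indicator {0..} t * t powr a / exp t) \<partial>lborel)"
  proof (intro nn_integral_mono)
    fix t :: real
    have "a powr a \<le> t powr a" if "a \<le> t" using that a by (intro powr_mono2) auto
    then show "ennreal (a powr a) * (ennreal (exp (- t)) * indicator {a..} t)
        \<le> ennreal (indicator {0..} t * t powr a / exp t)"
      using a by (auto simp: indicator_def ennreal_mult[symmetric] exp_minus field_simps intro!: ennreal_leI)
  qed
  finally show first: "?m \<le> Gamma (a + 1)"
    unfolding G[symmetric] using G0 by (simp add: ennreal_le_iff)
  show "?m * sqrt a / 3 \<le> Gamma (a + 1)"
  proof (cases "a \<ge> 1")
    case False
    then have "sqrt a \<le> 1" by simp
    then have "sqrt a / 3 \<le> 1" by linarith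
    then have "?m * (sqrt a / 3) \<le> ?m * 1" by (intro mult_left_mono) auto
    then show ?thesis using first by simp
  next
    case True
    have "ennreal (?m * sqrt a / 3) = ennreal (?m / 3) * ennreal (sqrt a)"
      using a by (subst ennreal_mult[symmetric]) auto
    also have "\<dots> = (\<integral>\<^sup>+t. ennreal (?m / 3) * indicator {a..a + sqrt a} t \<partial>lborel)"
      using a by (subst nn_integral_cmult_indicator) auto
    also have "\<dots> \<le> (\<integral>\<^sup>+t. ennreal (indicator {0..} t * t powr a / exp t) \<partial>lborel)"
    proof (intro nn_integral_mono)
      fix t :: real
      have "?m / 3 \<le> t powr a / exp t" if t: "a \<le> t" "t \<le> a + sqrt a"
      proof -
        define z where "z = (t - a) / a"
        have sa: "sqrt a \<le> a" using True real_sqrt_le_mono[of a "a * a"] by simp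
        have z: "0 \<le> z" "z \<le> 1" using t a sa by (auto simp: z_def)
        have tz: "t = a * (1 + z)" using a by (simp add: z_def field_simps)
        have "a * z \<le> sqrt a" using t a by (simp add: z_def)
        then have "(a * z)\<^sup>2 \<le> (sqrt a)\<^sup>2" using a z by (intro power_mono) auto
        then have "a * z\<^sup>2 \<le> 1" using a by (simp add: power2_eq_square mult_ac)
        moreover have "z - z\<^sup>2 \<le> ln (1 + z)" using z by (intro ln_one_plus_pos_lower_bound)
        then have "a * (z - z\<^sup>2) \<le> a * ln (1 + z)" using a by (intro mult_left_mono) auto
        moreover have "ln t = ln a + ln (1 + z)" using a z unfolding tz by (intro ln_mult_pos) auto
        ultimately have "a * ln a - a - 1 \<le> a * ln t - t"
          using tz by (simp add: algebra_simps)
        then have "exp (a * ln a - a) / exp 1 \<le> exp (a * ln t - t)"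
          by (simp add: exp_diff[symmetric])
        moreover have "exp (a * ln a - a) / 3 \<le> exp (a * ln a - a) / exp 1"
          using exp_le by (intro divide_left_mono) auto
        ultimately have "exp (a * ln a - a) / 3 \<le> exp (a * ln t - t)" by linarith
        then show ?thesis
          using a t by (simp add: powr_def exp_diff exp_minus field_simps)
      qed
      then show "ennreal (?m / 3) * indicator {a..a + sqrt a} t
          \<le> ennreal (indicator {0..} t * t powr a / exp t)"
        using a by (auto simp: indicator_def intro!: ennreal_leI)
    qed
    finally show ?thesis
      unfolding G[symmetric] using G0 by (simp add: ennreal_le_iff)
  qed
qed

lemma gamma_kernel_eq:
  assumes "b > 0" "x > 0" "t \<ge> 0"
  shows "gamma_kernel b x t = (t / b) powr (x / b) * exp (- (t / b)) / Gamma (x / b + 1) / b"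
  using assms by (simp add: gamma_kernel_def powr_divide powr_add)

text \<open>
  Up to a constant, \<open>min (1 / b) (1 / sqrt (b * x))\<close>: the kernel has standard deviation of order
  \<open>sqrt (b * x)\<close> in the interior and width of order \<open>b\<close> near the boundary.
\<close>

definition kernel_sup :: "real \<Rightarrow> real \<Rightarrow> real" where
  "kernel_sup b x = min 1 (3 * sqrt (b / x)) / b"

text \<open>
  The kernel is largest at \<open>t = x\<close>, where its value is the maximum of \<open>y powr a * exp (- y)\<close> divided by
  \<open>b * Gamma (a + 1)\<close> with \<open>a = x / b\<close>; the Stirling bounds apply to this quotient.
\<close>

lemma gamma_kernel_le:
  assumes b: "b > 0" and x: "x > 0"
  shows "gamma_kernel b x t \<le> kernel_sup b x"
proof (cases "t \<ge> 0")
  case True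
  define a where "a = x / b"
  define m where "m = a powr a * exp (- a)"
  have a: "a > 0" using b x by (simp add: a_def)
  have m: "m > 0" using a by (simp add: m_def)
  have G: "Gamma (a + 1) > 0" using a by (intro Gamma_real_pos) auto
  have le: "(t / b) powr a * exp (- (t / b)) \<le> m"
    unfolding m_def using a b True by (intro powr_times_exp_le_max) auto
  have "(t / b) powr a * exp (- (t / b)) / Gamma (a + 1) \<le> 1"
    using order_trans[OF le Gamma_ge(1)[OF a, folded m_def]] G by simp
  moreover have "(t / b) powr a * exp (- (t / b)) / Gamma (a + 1) \<le> 3 * sqrt (b / x)"
  proof -
    have "(t / b) powr a * exp (- (t / b)) / Gamma (a + 1) \<le> m / (m * sqrt a / 3)"
      using le m a Gamma_ge(2)[OF a, folded m_def] by (intro frac_le) auto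
    also have "\<dots> = 3 * sqrt (b / x)"
      using m a by (simp add: a_def real_sqrt_divide)
    finally show ?thesis .
  qed
  ultimately show ?thesis
    unfolding kernel_sup_def gamma_kernel_eq[OF b x True] a_def
    using b by (intro divide_right_mono) auto
next
  case False
  then show ?thesis using b x by (simp add: gamma_kernel_def kernel_sup_def)
qed

text \<open>
  For \<open>t \<le> 1\<close> the factor \<open>exp (- t / b)\<close> is at most \<open>exp (1 / b) * exp (- 2 * t / b)\<close>. Maximising with the
  faster exponential gains a factor \<open>2 powr (- x / b)\<close>, and \<open>x * ln 2 - 1\<close> is at least \<open>x / 6\<close> for
  \<open>x \<ge> 2\<close>, so the kernel is exponentially small in \<open>x / b\<close>. Polynomial decay is all that the
  integration over \<open>x\<close> needs.
\<close>

lemma gamma_kernel_tail: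
  assumes b: "b > 0" and x: "x \<ge> 2" and t: "0 \<le> t" "t \<le> 1"
  shows "gamma_kernel b x t \<le> 72 * b / x\<^sup>2"
proof -
  define a y where "a = x / b" and "y = t / b"
  have a: "a > 0" using b x by (simp add: a_def)
  have y: "0 \<le> y" "y \<le> 1 / b" using b t by (auto simp: y_def divide_right_mono)
  have G: "Gamma (a + 1) > 0" using a by (intro Gamma_real_pos) auto
  have "2 powr a * (y powr a * exp (- y)) = exp y * ((2 * y) powr a * exp (- (2 * y)))"
    using y by (simp add: powr_mult exp_add[symmetric])
  also have "\<dots> \<le> exp (1 / b) * (a powr a * exp (- a))"
    using y a by (intro mult_mono powr_times_exp_le_max) auto
  also have "\<dots> \<le> exp (1 / b) * Gamma (a + 1)"
    by (intro mult_left_mono Gamma_ge a) auto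
  finally have "y powr a * exp (- y) / Gamma (a + 1) \<le> exp (1 / b) / 2 powr a"
    using G by (simp add: field_simps)
  also have "exp (1 / b) / 2 powr a = exp (- ((x * ln 2 - 1) / b))"
    by (simp add: powr_def a_def exp_diff[symmetric] diff_divide_distrib)
  also have "\<dots> \<le> exp (- (x / (6 * b)))"
  proof -
    have "x * (2 / 3) \<le> x * ln 2" using x ln2_ge_two_thirds by (intro mult_left_mono) auto
    then have "x / 6 \<le> x * ln 2 - 1" using x by linarith
    then have "x / 6 / b \<le> (x * ln 2 - 1) / b" using b by (intro divide_right_mono) auto
    then show ?thesis by simp
  qed
  also have "\<dots> \<le> 72 * b\<^sup>2 / x\<^sup>2"
  proof -
    define z where "z = x / (6 * b)"
    have z: "z > 0" using x b by (simp add: z_def)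
    have "z\<^sup>2 / 2 \<le> exp z" using exp_lower_Taylor_quadratic[of z] z by linarith
    then have "exp (- z) \<le> 2 / z\<^sup>2" using z by (simp add: exp_minus field_simps)
    also have "2 / z\<^sup>2 = 72 * b\<^sup>2 / x\<^sup>2" using b x by (simp add: z_def field_simps power2_eq_square)
    finally show ?thesis by (simp add: z_def)
  qed
  finally have "y powr a * exp (- y) / Gamma (a + 1) / b \<le> 72 * b\<^sup>2 / x\<^sup>2 / b"
    using b by (intro divide_right_mono) auto
  then show ?thesis
    using gamma_kernel_eq[OF b _ t(1), of x] x b by (simp add: a_def y_def power2_eq_square)
qed

text \<open>
  Multiplying by \<open>t ^ k\<close> raises the parameter of Euler's integral by \<open>k\<close>; the product is
  \<open>Gamma (x / b + 1 + k) / Gamma (x / b + 1)\<close>.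
\<close>

lemma gamma_kernel_moment:
  assumes b: "b > 0" and x: "x > 0"
  shows "has_bochner_integral lborel (\<lambda>t. t ^ k * gamma_kernel b x t) (b ^ k * (\<Prod>i<k. x / b + 1 + real i))"
proof (rule has_bochner_integral_nn_integral)
  define a where "a = x / b"
  define Z where "Z = b powr (a + 1) * Gamma (a + 1)"
  have a: "a > 0" using b x by (simp add: a_def)
  have Z: "Z > 0" unfolding Z_def using a b by (intro mult_pos_pos Gamma_real_pos) auto
  have [measurable]: "gamma_kernel b x \<in> borel_measurable borel"
    unfolding gamma_kernel_def by measurable
  show "(\<lambda>t. t ^ k * gamma_kernel b x t) \<in> borel_measurable lborel" by measurable
  show "AE t in lborel. 0 \<le> t ^ k * gamma_kernel b x t"
  proof (intro AE_I2)
    fix t :: real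
    show "0 \<le> t ^ k * gamma_kernel b x t"
    proof (cases "t \<ge> 0")
      case True
      then show ?thesis using gamma_kernel_nonneg[of b x t] b x by (intro mult_nonneg_nonneg) auto
    qed (simp add: gamma_kernel_def)
  qed
  have Gk: "Gamma (a + 1 + real k) = (\<Prod>i<k. a + 1 + real i) * Gamma (a + 1)"
  proof (induction k)
    case (Suc k)
    have "Gamma (a + 1 + real (Suc k)) = (a + 1 + real k) * Gamma (a + 1 + real k)"
      using Gamma_plus1[of "a + 1 + real k"] a by (simp add: add_ac nonpos_Ints_def) 
    then show ?case using Suc by simp
  qed simp
  have "(\<integral>\<^sup>+t. ennreal (t ^ k * gamma_kernel b x t) \<partial>lborel)
      = ennreal b * (\<integral>\<^sup>+u. ennreal ((b * u) ^ k * gamma_kernel b x (b * u)) \<partial>lborel)"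
    using b by (subst nn_integral_real_affine[where c = b and t = 0]) auto
  also have "\<dots> = ennreal b * (\<integral>\<^sup>+u. ennreal (b ^ k / (b * Gamma (a + 1)))
      * ennreal (indicator {0..} u * u powr (a + real k) / exp u) \<partial>lborel)"
  proof -
    have "(b * u) ^ k * gamma_kernel b x (b * u)
        = b ^ k / (b * Gamma (a + 1)) * (indicator {0..} u * u powr (a + real k) / exp u)" for u
    proof (cases "u > 0")
      case True
      then have "u powr (a + real k) = u powr a * u ^ k" by (simp add: powr_add powr_realpow)
      moreover have "gamma_kernel b x (b * u) = u powr a * exp (- u) / Gamma (a + 1) / b"
        using gamma_kernel_eq[of b x "b * u"] b x True by (simp add: a_def)
      ultimately show ?thesis using True
        by (simp add: exp_minus power_mult_distrib divide_inverse mult_ac)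
    next
      case False
      then have "u = 0 \<or> u < 0" by auto
      then show ?thesis using b x a by (auto simp: gamma_kernel_def mult_less_0_iff a_def mult_le_0_iff not_le)
    qed
    moreover have "0 \<le> b ^ k / (b * Gamma (a + 1))"
      using b a by (intro divide_nonneg_nonneg mult_nonneg_nonneg Gamma_real_nonneg) auto
    ultimately show ?thesis by (simp only: ennreal_mult')
  qed
  also have "\<dots> = ennreal b * (ennreal (b ^ k / (b * Gamma (a + 1))) * ennreal (Gamma (a + 1 + real k)))"
    using Gamma_conv_nn_integral_real[of "a + 1 + real k"] a
    by (subst nn_integral_cmult) (auto simp: add_ac)
  also have "\<dots> = ennreal (b * (b ^ k / (b * Gamma (a + 1)) * Gamma (a + 1 + real k)))"
  proof -
    have "0 \<le> Gamma (a + 1)" "0 \<le> Gamma (a + 1 + real k)" using a by (auto intro!: Gamma_real_nonneg)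
    moreover from this have "0 \<le> b ^ k / (b * Gamma (a + 1))" using b by simp
    ultimately show ?thesis using b by (simp only: ennreal_mult' less_imp_le)
  qed
  also have "b * (b ^ k / (b * Gamma (a + 1)) * Gamma (a + 1 + real k)) = b ^ k * (\<Prod>i<k. x / b + 1 + real i)"
  proof -
    have "Gamma (a + 1) \<noteq> 0" using Gamma_real_pos[of "a + 1"] a by linarith
    then show ?thesis unfolding Gk using b by (simp add: a_def)
  qed
  finally show "(\<integral>\<^sup>+t. ennreal (t ^ k * gamma_kernel b x t) \<partial>lborel)
      = ennreal (b ^ k * (\<Prod>i<k. x / b + 1 + real i))" .
qed (use assms in \<open>auto intro!: mult_nonneg_nonneg prod_nonneg\<close>)

lemma gamma_kernel_integral:
  assumes b: "b > 0" and x: "x > 0"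
  shows "has_bochner_integral lborel (gamma_kernel b x) 1"
    and "has_bochner_integral lborel (\<lambda>t. (t - x) * gamma_kernel b x t) b"
    and "has_bochner_integral lborel (\<lambda>t. (t - x)\<^sup>2 * gamma_kernel b x t) (b * x + 2 * b\<^sup>2)"
proof -
  note m0 = gamma_kernel_moment[OF assms, of 0, simplified]
  note m1 = gamma_kernel_moment[OF assms, of 1, simplified]
  note m2 = gamma_kernel_moment[OF assms, of 2]
  show "has_bochner_integral lborel (gamma_kernel b x) 1" using m0 by simp
  have "has_bochner_integral lborel (\<lambda>t. t * gamma_kernel b x t - x * gamma_kernel b x t) (b * (x / b + 1) - x * 1)"
    by (intro has_bochner_integral_diff has_bochner_integral_mult_right m0 m1)
  then show "has_bochner_integral lborel (\<lambda>t. (t - x) * gamma_kernel b x t) b"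
    using b by (simp add: algebra_simps)
  have "has_bochner_integral lborel (\<lambda>t. t ^ 2 * gamma_kernel b x t - 2 * x * (t * gamma_kernel b x t)
      + x\<^sup>2 * gamma_kernel b x t)
      (b ^ 2 * (\<Prod>i<2. x / b + 1 + real i) - 2 * x * (b * (x / b + 1)) + x\<^sup>2 * 1)"
    by (intro has_bochner_integral_diff has_bochner_integral_add has_bochner_integral_mult_right m0 m1 m2)
  also have "(\<lambda>t. t ^ 2 * gamma_kernel b x t - 2 * x * (t * gamma_kernel b x t) + x\<^sup>2 * gamma_kernel b x t)
      = (\<lambda>t. (t - x)\<^sup>2 * gamma_kernel b x t)"
    by (simp add: power2_eq_square algebra_simps)
  also have "b ^ 2 * (\<Prod>i<2. x / b + 1 + real i) - 2 * x * (b * (x / b + 1)) + x\<^sup>2 * 1 = b * x + 2 * b\<^sup>2"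
    using b by (simp add: numeral_2_eq_2 field_simps)
  finally show "has_bochner_integral lborel (\<lambda>t. (t - x)\<^sup>2 * gamma_kernel b x t) (b * x + 2 * b\<^sup>2)" .
qed

section \<open>Central moments of the estimator\<close>

text \<open>
  Adding one more centred summand \<open>g t\<close> to a partial sum \<open>s\<close> and integrating it out turns \<open>s ^ 4\<close> into
  \<open>s ^ 4 + 6 * s2 * s\<^sup>2 + 4 * m3 * s + m4\<close>. The linear term vanishes in the mean, and
  \<open>6 * k * s2\<^sup>2 \<le> 3 * ((k + 1)\<^sup>2 - k\<^sup>2) * s2\<^sup>2\<close> closes the induction.
\<close>

lemma iid_sum_moments:
  fixes g :: "real \<Rightarrow> real" and I :: "'i set"
  assumes "prob_space M" and [measurable]: "g \<in> borel_measurable M" and bnd: "\<And>t. \<bar>g t\<bar> \<le> B"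
    and mean: "(LINT t|M. g t) = 0" and I: "finite I"
  defines "S \<equiv> \<lambda>X. \<Sum>i\<in>I. g (X i)" and "s2 \<equiv> LINT t|M. g t ^ 2" and "m4 \<equiv> LINT t|M. g t ^ 4"
  shows "(LINT X|PiM I (\<lambda>_. M). S X ^ 2) = real (card I) * s2"
    and "(LINT X|PiM I (\<lambda>_. M). S X ^ 4) \<le> real (card I) * m4 + 3 * real (card I) ^ 2 * s2 ^ 2"
    and "integrable (PiM I (\<lambda>_. M)) (\<lambda>X. S X ^ k)"
proof -
  interpret M: prob_space M by fact
  interpret MP: product_sigma_finite "\<lambda>i. M" by standard
  have B: "B \<ge> 0" using bnd[of 0] by linarith
  define m3 where "m3 = (LINT t|M. g t ^ 3)"
  have gi: "integrable M (\<lambda>t. g t ^ k)" for k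
  proof (rule M.integrable_const_bound[where B = "B ^ k"])
    show "AE t in M. norm (g t ^ k) \<le> B ^ k"
      using bnd by (auto simp: power_abs intro!: power_mono AE_I2)
  qed measurable
  have Si: "integrable (PiM J (\<lambda>_. M)) (\<lambda>X. (\<Sum>i\<in>J. g (X i)) ^ k)" if "finite J" for J :: "'i set" and k
  proof -
    interpret P: prob_space "PiM J (\<lambda>_. M)" by (intro prob_space_PiM \<open>prob_space M\<close>)
    show ?thesis
    proof (rule P.integrable_const_bound[where B = "(real (card J) * B) ^ k"])
      have "\<bar>\<Sum>i\<in>J. g (X i)\<bar> \<le> real (card J) * B" for X
        by (rule order_trans[OF sum_abs]) (use bnd in \<open>auto intro: sum_bounded_above\<close>)
      then show "AE X in PiM J (\<lambda>_. M). norm ((\<Sum>i\<in>J. g (X i)) ^ k) \<le> (real (card J) * B) ^ k"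
        by (auto simp: power_abs intro!: power_mono AE_I2)
    qed measurable
  qed
  then show "integrable (PiM I (\<lambda>_. M)) (\<lambda>X. S X ^ k)" using I unfolding S_def by blast
  let ?hb = "has_bochner_integral M"
  have g1: "?hb g 0" using gi[of 1] mean by (simp add: has_bochner_integral_iff)
  have g2: "?hb (\<lambda>t. g t ^ 2) s2" and g3: "?hb (\<lambda>t. g t ^ 3) m3" and g4: "?hb (\<lambda>t. g t ^ 4) m4"
    using gi by (simp_all add: has_bochner_integral_iff s2_def m3_def m4_def)
  have const: "?hb (\<lambda>t. c) c" for c :: real
    by (simp add: has_bochner_integral_iff M.prob_space)
  have e1: "(LINT t|M. s + g t) = s" for s
  proof -
    have "?hb (\<lambda>t. s + g t) (s + 0)" by (intro has_bochner_integral_add const g1)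
    then show ?thesis by (simp add: has_bochner_integral_iff)
  qed
  have e2: "(LINT t|M. (s + g t) ^ 2) = s ^ 2 + s2" for s
  proof -
    have "?hb (\<lambda>t. s ^ 2 + 2 * s * g t + g t ^ 2) (s ^ 2 + 2 * s * 0 + s2)"
      by (intro has_bochner_integral_add has_bochner_integral_mult_right const g1 g2)
    also have "(\<lambda>t. s ^ 2 + 2 * s * g t + g t ^ 2) = (\<lambda>t. (s + g t) ^ 2)"
      by (simp add: power2_eq_square algebra_simps)
    finally show ?thesis by (simp add: has_bochner_integral_iff)
  qed
  have e4: "(LINT t|M. (s + g t) ^ 4) = s ^ 4 + 6 * s2 * s ^ 2 + 4 * m3 * s + m4" for s
  proof -
    have "?hb (\<lambda>t. s ^ 4 + 4 * s ^ 3 * g t + 6 * s ^ 2 * g t ^ 2 + 4 * s * g t ^ 3 + g t ^ 4)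
       (s ^ 4 + 4 * s ^ 3 * 0 + 6 * s ^ 2 * s2 + 4 * s * m3 + m4)"
      by (intro has_bochner_integral_add has_bochner_integral_mult_right const g1 g2 g3 g4)
    also have "(\<lambda>t. s ^ 4 + 4 * s ^ 3 * g t + 6 * s ^ 2 * g t ^ 2 + 4 * s * g t ^ 3 + g t ^ 4) = (\<lambda>t. (s + g t) ^ 4)"
      by (intro ext) algebra
    finally show ?thesis by (simp add: has_bochner_integral_iff mult_ac)
  qed
  define E where "E J k = (LINT X|PiM J (\<lambda>_. M). (\<Sum>i\<in>J. g (X i)) ^ k)" for J :: "'i set" and k
  have "E I 1 = 0 \<and> E I 2 = real (card I) * s2 \<and> E I 4 \<le> real (card I) * m4 + 3 * real (card I) ^ 2 * s2 ^ 2"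
    using I
  proof (induction I rule: finite_induct)
    case empty
    interpret P: prob_space "PiM {} (\<lambda>_::'i. M)" by (intro prob_space_PiM \<open>prob_space M\<close>)
    show ?case by (simp add: E_def)
  next
    case (insert i J)
    interpret P: prob_space "PiM J (\<lambda>_. M)" by (intro prob_space_PiM \<open>prob_space M\<close>)
    let ?S = "\<lambda>X. \<Sum>i\<in>J. g (X i)"
    have E: "E (insert i J) k = (LINT X|PiM J (\<lambda>_. M). LINT t|M. (?S X + g t) ^ k)" for k
    proof -
      have "E (insert i J) k = (LINT X|PiM J (\<lambda>_. M). LINT t|M. (\<Sum>l\<in>insert i J. g ((X(i := t)) l)) ^ k)"
        unfolding E_def using insert by (intro MP.product_integral_insert Si) auto
      also have "\<dots> = (LINT X|PiM J (\<lambda>_. M). LINT t|M. (?S X + g t) ^ k)"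
      proof -
        have "(\<Sum>l\<in>J. g ((X(i := t)) l)) = ?S X" for X t using insert by (intro sum.cong) auto
        then have "(\<Sum>l\<in>insert i J. g ((X(i := t)) l)) = ?S X + g t" for X t
          using insert by (simp add: add.commute)
        then show ?thesis by simp
      qed
      finally show ?thesis .
    qed
    note int = Si[OF insert(1)]
    have i1: "integrable (PiM J (\<lambda>_. M)) ?S" using int[of 1] by simp
    have "E (insert i J) 1 = E J 1" unfolding E by (simp add: e1 E_def)
    moreover have "E (insert i J) 2 = E J 2 + s2"
      unfolding E e2 using int by (simp add: E_def P.prob_space)
    moreover have "E (insert i J) 4 = E J 4 + 6 * s2 * E J 2 + 4 * m3 * E J 1 + m4"
      unfolding E e4 using int i1 by (simp add: E_def P.prob_space)
    moreover have "m4 * 1 + (real (card J) * m4 + 3 * real (card J) ^ 2 * s2 ^ 2) + 6 * s2 * (real (card J) * s2)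
        \<le> (1 + real (card J)) * m4 + 3 * (1 + real (card J)) ^ 2 * s2 ^ 2"
    proof -
      have "(1 + real (card J)) * m4 + 3 * (1 + real (card J)) ^ 2 * s2 ^ 2
          = m4 * 1 + (real (card J) * m4 + 3 * real (card J) ^ 2 * s2 ^ 2) + 6 * s2 * (real (card J) * s2) + 3 * s2 ^ 2"
        by algebra
      then show ?thesis by simp
    qed
    ultimately show ?case using insert by (simp add: distrib_right)
  qed
  then show "(LINT X|PiM I (\<lambda>_. M). S X ^ 2) = real (card I) * s2"
    and "(LINT X|PiM I (\<lambda>_. M). S X ^ 4) \<le> real (card I) * m4 + 3 * real (card I) ^ 2 * s2 ^ 2"
    by (simp_all add: E_def S_def)
qed

lemma powr_le_square:
  fixes s \<tau> p :: real
  assumes "\<tau> > 0" "0 < p" "p \<le> 2"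
  shows "\<bar>s\<bar> powr p \<le> \<tau> powr p + \<tau> powr (p - 2) * s\<^sup>2"
proof (cases "\<bar>s\<bar> \<le> \<tau>")
  case True
  then have "\<bar>s\<bar> powr p \<le> \<tau> powr p" using assms by (intro powr_mono2) auto
  then show ?thesis by (simp add: add_increasing2)
next
  case False
  then have s: "\<bar>s\<bar> > 0" using assms by linarith
  have "\<bar>s\<bar> powr p = \<bar>s\<bar> powr (p - 2) * \<bar>s\<bar> powr 2"
    using powr_add[of "\<bar>s\<bar>" "p - 2" 2] by simp
  also have "\<dots> \<le> \<tau> powr (p - 2) * \<bar>s\<bar> powr 2"
    using False assms by (intro mult_right_mono powr_mono2') auto
  also have "\<bar>s\<bar> powr 2 = s\<^sup>2" using s by (simp add: powr_numeral)
  finally show ?thesis by (simp add: add_increasing)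
qed

lemma powr_le_square_fourth:
  fixes s \<tau> p :: real
  assumes "\<tau> > 0" "2 \<le> p" "p \<le> 4"
  shows "\<bar>s\<bar> powr p \<le> \<tau> powr (p - 2) * s ^ 2 + \<tau> powr (p - 4) * s ^ 4"
proof (cases "\<bar>s\<bar> \<le> \<tau>")
  case True
  have "\<bar>s\<bar> powr p = \<bar>s\<bar> powr (p - 2) * \<bar>s\<bar> powr 2"
    using powr_add[of "\<bar>s\<bar>" "p - 2" 2] by simp
  also have "\<dots> \<le> \<tau> powr (p - 2) * \<bar>s\<bar> powr 2"
    using True assms by (intro mult_right_mono powr_mono2) auto
  also have "\<bar>s\<bar> powr 2 = s\<^sup>2" by (cases "s = 0") (auto simp: powr_numeral)
  finally show ?thesis by (simp add: add_increasing2)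
next
  case False
  then have s: "\<bar>s\<bar> > 0" using assms by linarith
  have "\<bar>s\<bar> powr p = \<bar>s\<bar> powr (p - 4) * \<bar>s\<bar> powr 4"
    using powr_add[of "\<bar>s\<bar>" "p - 4" 4] by simp
  also have "\<dots> \<le> \<tau> powr (p - 4) * \<bar>s\<bar> powr 4"
    using False assms by (intro mult_right_mono powr_mono2') auto
  also have "\<bar>s\<bar> powr 4 = s ^ 4" using s by (simp add: powr_numeral)
  finally show ?thesis by (simp add: add_increasing)
qed

text \<open>
  A Rosenthal-type inequality for \<open>p \<le> 4\<close> from the second and fourth moments alone. The pointwise
  bounds \<open>powr_le_square\<close> and \<open>powr_le_square_fourth\<close> hold for every \<open>\<tau>\<close>, and \<open>\<tau>\<close> is chosen to balance
  the terms: \<open>sqrt v\<close> if \<open>p \<le> 2\<close> or \<open>v \<le> 1\<close>, and \<open>v\<close> otherwise.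
\<close>

lemma moment_interpolation:
  assumes v: "v > 0" and p: "1 \<le> p" "p \<le> 4"
    and int: "integrable M (\<lambda>X. Z X ^ 2)" "integrable M (\<lambda>X. Z X ^ 4)"
    and "prob_space M" and [measurable]: "Z \<in> borel_measurable M"
    and Z2: "(LINT X|M. Z X ^ 2) \<le> v" and Z4: "(LINT X|M. Z X ^ 4) \<le> 3 * v\<^sup>2 + v ^ 3"
  shows "(\<integral>\<^sup>+X. ennreal (\<bar>Z X\<bar> powr p) \<partial>M) \<le> ennreal (5 * (v powr (p / 2) + (if p > 2 then v powr (p - 1) else 0)))"
proof -
  interpret prob_space M by fact
  have *: "(\<integral>\<^sup>+X. ennreal (\<bar>Z X\<bar> powr p) \<partial>M) \<le> ennreal (a * 1 + b * v + c * (3 * v\<^sup>2 + v ^ 3))"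
    if nn: "a \<ge> 0" "b \<ge> 0" "c \<ge> 0" and le: "\<And>X. \<bar>Z X\<bar> powr p \<le> a * 1 + b * Z X ^ 2 + c * Z X ^ 4" for a b c
  proof -
    have "(\<integral>\<^sup>+X. ennreal (\<bar>Z X\<bar> powr p) \<partial>M) \<le> (\<integral>\<^sup>+X. ennreal (a * 1 + b * Z X ^ 2 + c * Z X ^ 4) \<partial>M)"
      by (intro nn_integral_mono ennreal_leI le)
    also have "\<dots> = ennreal (LINT X|M. a * 1 + b * Z X ^ 2 + c * Z X ^ 4)"
      using int nn by (intro nn_integral_eq_integral) auto
    also have "(LINT X|M. a * 1 + b * Z X ^ 2 + c * Z X ^ 4) = a * 1 + b * (LINT X|M. Z X ^ 2) + c * (LINT X|M. Z X ^ 4)"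
      using int by (simp add: prob_space)
    also have "ennreal \<dots> \<le> ennreal (a * 1 + b * v + c * (3 * v\<^sup>2 + v ^ 3))"
      using nn Z2 Z4 by (intro ennreal_leI add_mono mult_left_mono) auto
    finally show ?thesis .
  qed
  have v3: "3 * v\<^sup>2 + v ^ 3 \<ge> 0" using v by simp
  show ?thesis
  proof (cases "p > 2")
    case False
    define \<tau> where "\<tau> = sqrt v"
    have tau: "\<tau> > 0" using v by (simp add: \<tau>_def)
    have "(\<integral>\<^sup>+X. ennreal (\<bar>Z X\<bar> powr p) \<partial>M) \<le> ennreal (\<tau> powr p * 1 + \<tau> powr (p - 2) * v + 0 * (3 * v\<^sup>2 + v ^ 3))"
      using powr_le_square[OF tau, of p] p False by (intro *) auto
    also have "\<tau> powr (p - 2) * v = \<tau> powr (p - 2) * \<tau> powr 2"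
      using v tau by (simp add: \<tau>_def powr_numeral)
    also have "\<tau> powr (p - 2) * \<tau> powr 2 = \<tau> powr p"
      by (simp only: powr_add[symmetric]) simp
    also have "\<tau> powr p = v powr (p / 2)"
      using v by (simp add: \<tau>_def powr_half_sqrt[symmetric] powr_powr)
    finally show ?thesis using False by (auto elim!: order_trans intro!: ennreal_leI)
  next
    case p2: True
    show ?thesis
    proof (cases "v \<le> 1")
      case True
      define \<tau> where "\<tau> = v powr (1 / 2)"
      have tau: "\<tau> > 0" using v by (simp add: \<tau>_def)
      have "(\<integral>\<^sup>+X. ennreal (\<bar>Z X\<bar> powr p) \<partial>M) \<le> ennreal (0 * 1 + \<tau> powr (p - 2) * v + \<tau> powr (p - 4) * (3 * v\<^sup>2 + v ^ 3))"
        using powr_le_square_fourth[OF tau, of p] p p2 by (intro *) auto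
      also have "\<dots> \<le> ennreal (0 * 1 + \<tau> powr (p - 2) * v + \<tau> powr (p - 4) * (4 * v\<^sup>2))"
        using True v power_decreasing[of 2 3 v] by (intro ennreal_leI add_mono mult_left_mono) auto
      also have "\<tau> powr (p - 2) * v = v powr (p / 2)"
      proof -
        have "\<tau> powr (p - 2) * v = v powr ((p - 2) / 2) * v powr 1"
          using v by (simp add: \<tau>_def powr_powr)
        also have "\<dots> = v powr ((p - 2) / 2 + 1)" by (simp only: powr_add)
        also have "(p - 2) / 2 + 1 = p / 2" by (simp add: field_simps)
        finally show ?thesis .
      qed
      also have "\<tau> powr (p - 4) * (4 * v\<^sup>2) = 4 * (v powr ((p - 4) / 2) * v powr 2)"
        using v by (simp add: \<tau>_def powr_powr powr_numeral)
      also have "v powr ((p - 4) / 2) * v powr 2 = v powr (p / 2)"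
        by (simp add: powr_add[symmetric] field_simps)
      finally show ?thesis by (auto elim!: order_trans intro!: ennreal_leI)
    next
      case False
      have "(\<integral>\<^sup>+X. ennreal (\<bar>Z X\<bar> powr p) \<partial>M) \<le> ennreal (0 * 1 + v powr (p - 2) * v + v powr (p - 4) * (3 * v\<^sup>2 + v ^ 3))"
        using powr_le_square_fourth[OF v, of p] p p2 by (intro *) auto
      also have "\<dots> \<le> ennreal (0 * 1 + v powr (p - 2) * v + v powr (p - 4) * (4 * v ^ 3))"
        using False v power_increasing[of 2 3 v] by (intro ennreal_leI add_mono mult_left_mono) auto
      also have "v powr (p - 2) * v = v powr (p - 1)"
        using v by (simp add: powr_mult_base mult.commute[of _ v])
      also have "v powr (p - 4) * (4 * v ^ 3) = 4 * (v powr (p - 4) * v powr 3)"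
        using v by (simp add: powr_numeral)
      also have "v powr (p - 4) * v powr 3 = v powr (p - 1)"
        by (simp add: powr_add[symmetric])
      finally show ?thesis using p2 by (auto elim!: order_trans intro!: ennreal_leI)
    qed
  qed
qed

definition mean_kde :: "real \<Rightarrow> (real \<Rightarrow> real) \<Rightarrow> real \<Rightarrow> real" where
  "mean_kde b f x = (LINT t|lborel. gamma_kernel b x t * f t)"

lemma kernel_sup_pos: "b > 0 \<Longrightarrow> x > 0 \<Longrightarrow> kernel_sup b x > 0"
  by (simp add: kernel_sup_def)

lemma gamma_kernel_measurable_section [measurable]: "gamma_kernel b x \<in> borel_measurable borel"
  unfolding gamma_kernel_def by measurable

text \<open>
  With \<open>\<kappa>\<close> a bound for the kernel, the second and fourth central moments of one summand are at most
  \<open>L * \<kappa>\<close> and \<open>L * \<kappa> ^ 3\<close>: the kernel integrates to \<open>1\<close> and the density is bounded by \<open>L\<close>. Hence those of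
  the average are at most \<open>v\<close> and \<open>3 * v\<^sup>2 + v ^ 3\<close>.
\<close>

lemma stochastic_error:
  fixes b x L p :: real and n :: nat
  assumes f: "is_density f" and fL: "\<And>t. t > 0 \<Longrightarrow> f t \<le> L" and L: "L \<ge> 1"
    and b: "b > 0" and x: "x > 0" and n: "n \<ge> 1" and p: "1 \<le> p" "p \<le> 4"
  defines "v \<equiv> L * kernel_sup b x / real n"
  shows "(\<integral>\<^sup>+X. ennreal (\<bar>gamma_kde n b X x - mean_kde b f x\<bar> powr p) \<partial>sample_law n f)
    \<le> ennreal (5 * (v powr (p / 2) + (if p > 2 then v powr (p - 1) else 0)))"
proof -
  let ?K = "gamma_kernel b x"
  define \<kappa> where "\<kappa> = kernel_sup b x"
  have kappa: "\<kappa> > 0" unfolding \<kappa>_def by (rule kernel_sup_pos[OF b x])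
  have [measurable]: "f \<in> borel_measurable borel" and nn: "\<And>x. 0 \<le> f x"
    using f by (auto simp: is_density_def)
  have K: "0 \<le> ?K t" "?K t \<le> \<kappa>" for t
    using gamma_kernel_nonneg[of b x t] gamma_kernel_le[OF b x, of t] b x by (auto simp: \<kappa>_def)
  define M where "M = density lborel (\<lambda>t. ennreal (f t))"
  have M: "prob_space M" unfolding M_def by (rule prob_space_density[OF f])
  interpret M: prob_space M by fact
  have sM[measurable_cong]: "sets M = sets borel" by (simp add: M_def)
  define \<mu> where "\<mu> = mean_kde b f x"
  have Ki: "integrable M ?K"
    using K by (intro M.integrable_const_bound[where B = \<kappa>]) (auto simp: abs_le_iff intro!: AE_I2)
  have mu: "(LINT t|M. ?K t) = \<mu>"
    unfolding M_def \<mu>_def mean_kde_def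
    by (subst integral_density) (auto simp: nn mult.commute)
  have muL: "\<mu> \<le> L"
  proof -
    have "integrable lborel (\<lambda>t. ?K t * f t)"
      using Ki unfolding M_def by (subst (asm) integrable_density) (auto simp: nn mult.commute)
    moreover have "has_bochner_integral lborel (\<lambda>t. L * ?K t) (L * 1)"
      by (intro has_bochner_integral_mult_right gamma_kernel_integral b x)
    moreover have "AE t in lborel. ?K t * f t \<le> L * ?K t"
    proof -
      have "AE t in lborel. t \<noteq> (0::real)" by (rule AE_lborel_singleton)
      then show ?thesis
      proof eventually_elim
        case (elim t)
        show ?case
        proof (cases "t > 0")
          case True
          have "?K t * f t \<le> ?K t * L" using K fL[OF True] by (intro mult_left_mono) auto
          then show ?thesis by (simp add: mult.commute)
        next
          case False
          then have "?K t = 0" using elim by (simp add: gamma_kernel_def)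
          then show ?thesis by simp
        qed
      qed
    qed
    ultimately have "(LINT t|lborel. ?K t * f t) \<le> (LINT t|lborel. L * ?K t)"
      by (intro integral_mono_AE) (auto simp: has_bochner_integral_iff)
    also have "\<dots> = L" using \<open>has_bochner_integral lborel (\<lambda>t. L * ?K t) (L * 1)\<close>
      by (simp add: has_bochner_integral_iff)
    finally show ?thesis by (simp add: \<mu>_def mean_kde_def)
  qed
  have mu_kappa: "0 \<le> \<mu>" "\<mu> \<le> \<kappa>"
  proof -
    show "0 \<le> \<mu>" unfolding mu[symmetric] using K by (intro integral_nonneg_AE AE_I2) auto
    show "\<mu> \<le> \<kappa>" unfolding mu[symmetric] using K by (intro M.integral_le_const Ki AE_I2) auto
  qed
  define g where "g t = ?K t - \<mu>" for t
  have [measurable]: "g \<in> borel_measurable borel" unfolding g_def by measurable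
  have gk: "\<bar>g t\<bar> \<le> \<kappa>" for t using K[of t] mu_kappa by (auto simp: g_def abs_le_iff)
  have gi: "integrable M (\<lambda>t. g t ^ k)" for k
    using gk by (intro M.integrable_const_bound[where B = "\<kappa> ^ k"]) (auto simp: power_abs intro!: AE_I2 power_mono)
  have g0: "(LINT t|M. g t) = 0" using Ki mu by (simp add: g_def M.prob_space)
  define s2 m4 where "s2 = (LINT t|M. g t ^ 2)" and "m4 = (LINT t|M. g t ^ 4)"
  have s2: "s2 \<le> L * \<kappa>" "0 \<le> s2"
  proof -
    have K2i: "integrable M (\<lambda>t. ?K t ^ 2)"
      using K by (intro M.integrable_const_bound[where B = "\<kappa> ^ 2"]) (auto intro!: AE_I2 power_mono)
    have "s2 = (LINT t|M. ?K t ^ 2 - 2 * \<mu> * ?K t + \<mu>\<^sup>2)"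
      unfolding s2_def g_def by (intro Bochner_Integration.integral_cong refl) (simp add: power2_eq_square algebra_simps)
    also have "\<dots> = (LINT t|M. ?K t ^ 2) - \<mu>\<^sup>2"
      using K2i Ki mu by (simp add: M.prob_space power2_eq_square)
    also have "\<dots> \<le> (LINT t|M. ?K t ^ 2)" by simp
    also have "\<dots> \<le> (LINT t|M. \<kappa> * ?K t)"
      using K by (intro integral_mono K2i integrable_mult_right Ki) (auto simp: power2_eq_square intro!: mult_right_mono)
    also have "\<dots> \<le> \<kappa> * L" using mu muL kappa by simp
    finally show "s2 \<le> L * \<kappa>" by (simp add: mult.commute)
    show "0 \<le> s2" unfolding s2_def by (intro integral_nonneg_AE AE_I2) auto
  qed
  have m4: "m4 \<le> L * \<kappa> ^ 3"
  proof -
    have "m4 \<le> (LINT t|M. \<kappa>\<^sup>2 * g t ^ 2)"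
      unfolding m4_def
    proof (intro integral_mono gi integrable_mult_right)
      fix t
      have "g t ^ 4 = \<bar>g t\<bar>\<^sup>2 * g t ^ 2" by (simp add: power_add[symmetric])
      also have "\<dots> \<le> \<kappa>\<^sup>2 * g t ^ 2" using gk by (intro mult_right_mono power_mono) auto
      finally show "g t ^ 4 \<le> \<kappa>\<^sup>2 * g t ^ 2" .
    qed
    also have "\<dots> = \<kappa>\<^sup>2 * s2" by (simp add: s2_def)
    also have "\<dots> \<le> \<kappa>\<^sup>2 * (L * \<kappa>)" using s2 by (intro mult_left_mono) auto
    finally show ?thesis by (simp add: power2_eq_square power3_eq_cube mult_ac)
  qed
  define S where "S X = (\<Sum>i\<in>{1..n}. g (X i))" for X :: "nat \<Rightarrow> real"
  have gM: "g \<in> borel_measurable M" by measurable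
  note mom = iid_sum_moments[OF M gM gk g0, of "{1..n}", folded s2_def m4_def S_def, simplified]
  have law: "sample_law n f = PiM {1..n} (\<lambda>_. M)" by (simp add: sample_law_def M_def)
  define Z where "Z X = gamma_kde n b X x - \<mu>" for X
  have ZS: "Z X = S X / real n" for X
    using n by (simp add: Z_def S_def g_def gamma_kde_def sum_subtractf field_simps)
  have Zk: "integrable (sample_law n f) (\<lambda>X. Z X ^ k)" for k
    using mom(3)[of k] unfolding ZS power_divide law by simp
  have v: "v > 0" using L kappa n by (simp add: v_def \<kappa>_def[symmetric])
  have "(\<integral>\<^sup>+X. ennreal (\<bar>Z X\<bar> powr p) \<partial>sample_law n f) \<le> ennreal (5 * (v powr (p / 2) + (if p > 2 then v powr (p - 1) else 0)))"
  proof (rule moment_interpolation[OF v p Zk Zk prob_space_sample_law[OF f]])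
    show "Z \<in> borel_measurable (sample_law n f)" using Zk[of 1] by simp
    have "(LINT X|sample_law n f. Z X ^ 2) = (real n * s2) / real n ^ 2"
      using mom(1) unfolding ZS power_divide law by simp
    also have "\<dots> = s2 / real n" using n by (simp add: power2_eq_square)
    also have "\<dots> \<le> v" unfolding v_def \<kappa>_def[symmetric] using s2 by (intro divide_right_mono) auto
    finally show "(LINT X|sample_law n f. Z X ^ 2) \<le> v" .
    have "(LINT X|sample_law n f. Z X ^ 4) \<le> (real n * m4 + 3 * real n ^ 2 * s2 ^ 2) / real n ^ 4"
      using mom(2) unfolding ZS power_divide law by (simp add: divide_right_mono)
    also have "\<dots> = 3 * (s2 / real n)\<^sup>2 + m4 / real n ^ 3"
      using n by (simp add: field_simps power2_eq_square power3_eq_cube power4_eq_xxxx)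
    also have "\<dots> \<le> 3 * v\<^sup>2 + L * \<kappa> ^ 3 / real n ^ 3"
      unfolding v_def \<kappa>_def[symmetric] using s2 m4
      by (intro add_mono mult_left_mono power_mono divide_right_mono) auto
    also have "L * \<kappa> ^ 3 / real n ^ 3 \<le> L ^ 3 * \<kappa> ^ 3 / real n ^ 3"
      using L kappa power_increasing[of 1 3 L] by (intro divide_right_mono mult_right_mono) auto
    also have "L ^ 3 * \<kappa> ^ 3 / real n ^ 3 = v ^ 3"
      by (simp add: v_def \<kappa>_def power_mult_distrib power_divide)
    finally show "(LINT X|sample_law n f. Z X ^ 4) \<le> 3 * v\<^sup>2 + v ^ 3" by simp
  qed
  then show ?thesis by (simp add: Z_def \<mu>_def)
qed

section \<open>Bias\<close>

lemma holder_class_bounded: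
  assumes "f \<in> holder_class \<beta> L" "u > 0"
  shows "\<bar>f u\<bar> \<le> L"
proof -
  have "\<forall>k\<le>holder_order \<beta>. \<forall>u>0. \<bar>(deriv ^^ k) f u\<bar> \<le> L"
    using assms unfolding holder_class_def Let_def by blast
  from this[rule_format, of 0 u] assms show ?thesis by simp
qed

text \<open>
  A form of the smoothness condition that covers both ranges of \<open>\<beta>\<close>: the slope \<open>d\<close> is \<open>0\<close> if \<open>\<beta> \<le> 1\<close>
  and the derivative of \<open>f\<close> otherwise.
\<close>

lemma holder_class_taylor:
  assumes f: "f \<in> holder_class \<beta> L" and beta: "0 < \<beta>" "\<beta> \<le> 2"
  obtains d where "\<And>x. x > 0 \<Longrightarrow> \<bar>d x\<bar> \<le> L"
    and "\<And>x t. x > 0 \<Longrightarrow> t > 0 \<Longrightarrow> \<bar>f t - f x - d x * (t - x)\<bar> \<le> L * \<bar>t - x\<bar> powr \<beta>"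
proof (cases "\<beta> \<le> 1")
  case True
  have m: "holder_order \<beta> = 0" by (rule holder_order_eq(1)[OF beta(1) True])
  have L: "0 \<le> L" using holder_class_bounded[OF f, of 1] by simp
  have h: "\<bar>f u - f v\<bar> / \<bar>u - v\<bar> powr (\<beta> - real 0) \<le> L" if "u > 0" "v > 0" "u \<noteq> v" for u v
    using f that unfolding holder_class_def Let_def m by simp
  show ?thesis
  proof (rule that[of "\<lambda>_. 0"])
    fix x t :: real assume "x > 0" "t > 0"
    then show "\<bar>f t - f x - 0 * (t - x)\<bar> \<le> L * \<bar>t - x\<bar> powr \<beta>"
      using h[of t x] L by (cases "t = x") (auto simp: divide_le_eq)
  qed (use L in auto)
next
  case False
  have m: "holder_order \<beta> = 1" using holder_order_eq(2) False beta by simp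
  have diff: "f field_differentiable at u" if "u > 0" for u
    using f that unfolding holder_class_def Let_def m by auto
  have bnd: "\<bar>deriv f u\<bar> \<le> L" if "u > 0" for u
  proof -
    have "\<forall>k\<le>1. \<forall>u>0. \<bar>(deriv ^^ k) f u\<bar> \<le> L"
      using f unfolding holder_class_def Let_def m by blast
    from this[rule_format, of 1 u] that show ?thesis by simp
  qed
  have L: "0 \<le> L" using bnd[of 1] by simp
  have "\<bar>deriv f u - deriv f v\<bar> / \<bar>u - v\<bar> powr (\<beta> - real 1) \<le> L" if "u > 0" "v > 0" "u \<noteq> v" for u v
    using f that unfolding holder_class_def Let_def m by simp
  then have h: "\<bar>deriv f u - deriv f v\<bar> \<le> L * \<bar>u - v\<bar> powr (\<beta> - 1)" if "u > 0" "v > 0" for u v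
    using that L by (cases "u = v") (auto simp: divide_le_eq)
  have D: "(f has_real_derivative deriv f u) (at u)" if "u > 0" for u
    using diff[OF that] by (simp add: field_differentiable_derivI)
  show ?thesis
  proof (rule that[of "deriv f", OF bnd])
    fix x t :: real assume x: "x > 0" and t: "t > 0"
    have "\<exists>z. z > 0 \<and> \<bar>z - x\<bar> \<le> \<bar>t - x\<bar> \<and> f t - f x = (t - x) * deriv f z"
    proof (cases t x rule: linorder_cases)
      case less
      obtain z where "t < z" "z < x" "f x - f t = (x - t) * deriv f z"
        using MVT2[OF less, of f "deriv f"] D t by force
      then show ?thesis using t by (intro exI[of _ z]) (auto simp: algebra_simps)
    next
      case greater
      obtain z where "x < z" "z < t" "f t - f x = (t - x) * deriv f z"
        using MVT2[OF greater, of f "deriv f"] D x by force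
      then show ?thesis using x by (intro exI[of _ z]) auto
    qed (use x in auto)
    then obtain z where z: "z > 0" "\<bar>z - x\<bar> \<le> \<bar>t - x\<bar>" "f t - f x = (t - x) * deriv f z" by blast
    have "\<bar>f t - f x - deriv f x * (t - x)\<bar> = \<bar>t - x\<bar> * \<bar>deriv f z - deriv f x\<bar>"
      unfolding z(3) by (simp add: abs_mult[symmetric] algebra_simps)
    also have "\<dots> \<le> \<bar>t - x\<bar> * (L * \<bar>t - x\<bar> powr (\<beta> - 1))"
      using z L False by (intro mult_left_mono order_trans[OF h[OF z(1) x]] powr_mono2) auto
    also have "\<dots> = L * \<bar>t - x\<bar> powr \<beta>"
      using powr_mult_base[of "\<bar>t - x\<bar>" "\<beta> - 1"] by (simp add: mult.left_commute)
    finally show "\<bar>f t - f x - deriv f x * (t - x)\<bar> \<le> L * \<bar>t - x\<bar> powr \<beta>" .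
  qed
qed

text \<open>
  The linear Taylor term integrates to \<open>d x * b\<close> because the mean of the kernel is \<open>x + b\<close>, and
  \<open>b\<close> is of order at most \<open>b powr (\<beta> / 2)\<close> as \<open>\<beta> \<le> 2\<close>. In the remainder, \<open>\<bar>t - x\<bar> powr \<beta>\<close> is bounded
  by \<open>\<tau> powr \<beta> + \<tau> powr (\<beta> - 2) * (t - x)\<^sup>2\<close> with \<open>\<tau> = sqrt b\<close>, and the mean square deviation from \<open>x\<close>
  is of order \<open>b\<close>.
\<close>

lemma bias_bound:
  assumes f: "f \<in> holder_class \<beta> L" and beta: "0 < \<beta>" "\<beta> \<le> 2"
    and b: "0 < b" "b \<le> c" and x: "0 < x" "x \<le> 2"
  shows "\<bar>mean_kde b f x - f x\<bar> \<le> L * (4 + 3 * c) * b powr (\<beta> / 2)"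
proof -
  let ?K = "gamma_kernel b x"
  obtain d where d: "\<And>x. x > 0 \<Longrightarrow> \<bar>d x\<bar> \<le> L"
    and taylor: "\<And>x t. x > 0 \<Longrightarrow> t > 0 \<Longrightarrow> \<bar>f t - f x - d x * (t - x)\<bar> \<le> L * \<bar>t - x\<bar> powr \<beta>"
    using holder_class_taylor[OF f beta] by blast
  have L: "0 \<le> L" using holder_class_bounded[OF f, of 1] by simp
  have [measurable]: "f \<in> borel_measurable borel" using f by (simp add: holder_class_def is_density_def)
  have K0: "0 \<le> ?K t" for t using gamma_kernel_nonneg[of b x t] b x by simp
  have Kneg: "?K t = 0" if "t \<le> 0" for t using that b x by (auto simp: gamma_kernel_def indicator_def)
  note k0 = gamma_kernel_integral(1)[OF b(1) x(1)]
  note k1 = gamma_kernel_integral(2)[OF b(1) x(1)]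
  note k2 = gamma_kernel_integral(3)[OF b(1) x(1)]
  have Kf: "integrable lborel (\<lambda>t. ?K t * f t)"
  proof (rule Bochner_Integration.integrable_bound)
    show "integrable lborel (\<lambda>t. L * ?K t)" using k0 by (simp add: has_bochner_integral_iff)
    show "AE t in lborel. norm (?K t * f t) \<le> norm (L * ?K t)"
    proof (intro AE_I2)
      fix t
      show "norm (?K t * f t) \<le> norm (L * ?K t)"
      proof (cases "t > 0")
        case True
        have "?K t * \<bar>f t\<bar> \<le> ?K t * L" using K0 holder_class_bounded[OF f True] by (intro mult_left_mono) auto
        then show ?thesis using K0[of t] L by (simp add: abs_mult mult.commute)
      qed (simp add: Kneg)
    qed
  qed measurable
  let ?r = "\<lambda>t. ?K t * f t - f x * ?K t - d x * ((t - x) * ?K t)"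
  have ri: "has_bochner_integral lborel ?r (mean_kde b f x - f x * 1 - d x * b)"
    using Kf unfolding mean_kde_def
    by (intro has_bochner_integral_diff has_bochner_integral_mult_right k0 k1) (simp_all add: has_bochner_integral_iff)
  define \<tau> where "\<tau> = sqrt b"
  have tau: "\<tau> > 0" using b by (simp add: \<tau>_def)
  let ?u = "\<lambda>t. L * (\<tau> powr \<beta> * ?K t + \<tau> powr (\<beta> - 2) * ((t - x)\<^sup>2 * ?K t))"
  have ui: "has_bochner_integral lborel ?u (L * (\<tau> powr \<beta> * 1 + \<tau> powr (\<beta> - 2) * (b * x + 2 * b\<^sup>2)))"
    by (intro has_bochner_integral_add has_bochner_integral_mult_right k0 k2)
  have le: "\<bar>?r t\<bar> \<le> ?u t" for t
  proof (cases "t > 0")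
    case True
    have "?r t = ?K t * (f t - f x - d x * (t - x))" by (simp add: algebra_simps)
    then have "\<bar>?r t\<bar> = ?K t * \<bar>f t - f x - d x * (t - x)\<bar>"
      using K0[of t] by (simp only: abs_mult abs_of_nonneg)
    also have "\<dots> \<le> ?K t * (L * (\<tau> powr \<beta> + \<tau> powr (\<beta> - 2) * (t - x)\<^sup>2))"
      using K0 L powr_le_square[OF tau beta, of "t - x"]
      by (intro mult_left_mono order_trans[OF taylor[OF x(1) True]]) auto
    finally show ?thesis by (simp add: algebra_simps)
  qed (simp add: Kneg)
  have "\<bar>LINT t|lborel. ?r t\<bar> \<le> (LINT t|lborel. \<bar>?r t\<bar>)"
    using integral_abs_bound[of lborel ?r] by simp
  also have "\<dots> \<le> (LINT t|lborel. ?u t)"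
    using ri ui le by (intro integral_mono integrable_abs) (simp_all only: has_bochner_integral_iff)
  finally have "\<bar>mean_kde b f x - f x - d x * b\<bar> \<le> L * (\<tau> powr \<beta> + \<tau> powr (\<beta> - 2) * (b * x + 2 * b\<^sup>2))"
    unfolding has_bochner_integral_integral_eq[OF ri] has_bochner_integral_integral_eq[OF ui] by simp
  also have "\<tau> powr (\<beta> - 2) * (b * x + 2 * b\<^sup>2) = \<tau> powr \<beta> * (x + 2 * b)"
  proof -
    have "\<tau> powr (\<beta> - 2) * \<tau> powr 2 = \<tau> powr \<beta>" by (simp only: powr_add[symmetric]) simp
    moreover have "\<tau> powr 2 = b" using b tau by (simp add: \<tau>_def)
    ultimately have "\<tau> powr (\<beta> - 2) * b = \<tau> powr \<beta>" by simp
    moreover have "b * x + 2 * b\<^sup>2 = b * (x + 2 * b)" by (simp add: power2_eq_square algebra_simps)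
    ultimately show ?thesis by (simp only: mult.assoc[symmetric])
  qed
  also have "L * (\<tau> powr \<beta> + \<tau> powr \<beta> * (x + 2 * b)) \<le> L * (\<tau> powr \<beta> + \<tau> powr \<beta> * (2 + 2 * c))"
    using L x b by (intro mult_left_mono add_mono) auto
  finally have main: "\<bar>mean_kde b f x - f x - d x * b\<bar> \<le> L * (3 + 2 * c) * \<tau> powr \<beta>"
    by (simp add: algebra_simps)
  have tb: "\<tau> powr \<beta> = b powr (\<beta> / 2)"
    using b by (simp add: \<tau>_def powr_half_sqrt[symmetric] powr_powr)
  have "b = b powr (\<beta> / 2) * b powr (1 - \<beta> / 2)" using b by (simp add: powr_add[symmetric])
  also have "\<dots> \<le> b powr (\<beta> / 2) * (1 + c)"
  proof (intro mult_left_mono)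
    have "b powr (1 - \<beta> / 2) \<le> (1 + c) powr (1 - \<beta> / 2)" using b beta by (intro powr_mono2) auto
    also have "\<dots> \<le> (1 + c) powr 1" using b beta by (intro powr_mono) auto
    finally show "b powr (1 - \<beta> / 2) \<le> 1 + c" using b by simp
  qed auto
  finally have bb: "b \<le> b powr (\<beta> / 2) * (1 + c)" .
  have "\<bar>d x * b\<bar> \<le> L * (b powr (\<beta> / 2) * (1 + c))"
    unfolding abs_mult using d[OF x(1)] bb b L by (intro mult_mono) auto
  with main[unfolded tb] show ?thesis by (simp add: algebra_simps)
qed

section \<open>Integrating the pointwise bounds\<close>

lemma nn_integral_powr_near_0:
  assumes "s < 1"
  shows "(\<integral>\<^sup>+x. ennreal (x powr (- s)) * indicator {0..2} x \<partial>lborel) = ennreal (2 powr (1 - s) / (1 - s))"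
  using nn_integral_has_integral_lebesgue'[OF _ has_integral_powr_from_0[of "- s" 2]] assms
  by (simp add: add.commute)

lemma nn_integral_powr_tail:
  assumes "1 \<le> p"
  shows "(\<integral>\<^sup>+x. ennreal (x powr (- (2 * p))) * indicator {2..} x \<partial>lborel) \<le> ennreal 1"
proof -
  have "(\<integral>\<^sup>+x. ennreal (x powr (- (2 * p))) * indicator {2..} x \<partial>lborel)
      = ennreal (- (2 powr (- (2 * p) + 1)) / (- (2 * p) + 1))"
    by (rule nn_integral_has_integral_lebesgue'[OF _ has_integral_powr_to_inf]) (use assms in auto)
  also have "\<dots> \<le> ennreal 1"
  proof (intro ennreal_leI)
    have "(2::real) powr (- (2 * p) + 1) \<le> 2 powr 0" using assms by (intro powr_mono) auto
    moreover have "- (2 powr (- (2 * p) + 1)) / (- (2 * p) + 1) = 2 powr (- (2 * p) + 1) / (2 * p - 1)"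
      using minus_divide_divide[of "2 powr (- (2 * p) + 1)" "2 * p - 1"] by simp
    ultimately show "- (2 powr (- (2 * p) + 1)) / (- (2 * p) + 1) \<le> 1"
      using assms by (simp add: divide_le_eq)
  qed
  finally show ?thesis .
qed

text \<open>
  Interpolation between the two arguments of the minimum. Large \<open>q\<close> gains powers of \<open>b\<close> at the price of a
  stronger singularity at \<open>x = 0\<close>.
\<close>

lemma kernel_sup_powr_le:
  assumes b: "b > 0" and x: "x > 0" and q: "0 \<le> q" "2 * q \<le> r"
  shows "kernel_sup b x powr r \<le> 9 powr q * b powr (q - r) * x powr (- q)"
proof -
  define w where "w = 3 * sqrt (b / x)"
  have w: "w > 0" using b x by (simp add: w_def)
  have "min 1 w powr r \<le> w powr (2 * q)"
  proof (cases "w \<le> 1")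
    case True
    then show ?thesis using powr_mono'[of "2 * q" r w] w q by simp
  next
    case False
    then show ?thesis using q by (simp add: ge_one_powr_ge_zero)
  qed
  also have "w powr (2 * q) = (w powr 2) powr q" by (simp add: powr_powr)
  also have "w powr 2 = 9 * (b / x)"
    using w b x by (simp add: powr_numeral) (simp add: w_def power_mult_distrib)
  also have "(9 * (b / x)) powr q = 9 powr q * b powr q * x powr (- q)"
    using b x by (simp add: powr_mult powr_divide powr_minus_divide)
  finally have "min 1 w powr r / b powr r \<le> 9 powr q * b powr q * x powr (- q) / b powr r"
    by (intro divide_right_mono) auto
  then show ?thesis
    using b w by (simp add: kernel_sup_def w_def powr_divide powr_diff)
qed

lemma abs_add_powr_le:
  fixes x y p :: real
  assumes "p \<ge> 0"
  shows "\<bar>x + y\<bar> powr p \<le> 2 powr p * (\<bar>x\<bar> powr p + \<bar>y\<bar> powr p)"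
proof -
  have "\<bar>x + y\<bar> powr p \<le> (2 * max \<bar>x\<bar> \<bar>y\<bar>) powr p"
    using assms by (intro powr_mono2) auto
  also have "\<dots> = 2 powr p * max \<bar>x\<bar> \<bar>y\<bar> powr p" by (simp add: powr_mult)
  also have "\<dots> \<le> 2 powr p * (\<bar>x\<bar> powr p + \<bar>y\<bar> powr p)"
    by (intro mult_left_mono) (auto simp: max_def)
  finally show ?thesis .
qed

lemma gamma_kde_measurable [measurable]:
  "(\<lambda>z. gamma_kde n b (fst z) (snd z)) \<in> borel_measurable ((\<Pi>\<^sub>M i\<in>{1..n}. borel) \<Otimes>\<^sub>M lborel)"
proof -
  have "(\<lambda>z. gamma_kernel b (snd z) (fst z i))
      \<in> borel_measurable ((\<Pi>\<^sub>M i\<in>{1..n}. borel) \<Otimes>\<^sub>M (lborel :: real measure))" if "i \<in> {1..n}" for i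
  proof -
    have [measurable]: "(\<lambda>z. (snd z, fst z i)) \<in> ((\<Pi>\<^sub>M i\<in>{1..n}. borel) \<Otimes>\<^sub>M lborel) \<rightarrow>\<^sub>M borel \<Otimes>\<^sub>M (borel :: real measure)"
      using that by (intro measurable_Pair measurable_compose[OF measurable_fst measurable_component_singleton]) auto
    from measurable_comp[OF this measurable_gamma_kernel[of b]] show ?thesis
      by (simp add: comp_def case_prod_beta)
  qed
  then show ?thesis unfolding gamma_kde_def by (intro borel_measurable_times borel_measurable_sum) auto
qed

lemma gamma_kde_measurable_section [measurable]:
  "(\<lambda>X. gamma_kde n b X x) \<in> borel_measurable (\<Pi>\<^sub>M i\<in>{1..n}. borel)"
  unfolding gamma_kde_def by measurable

lemma AE_sample_in_support:
  assumes f: "is_density f" and supp: "\<And>x. x \<notin> {0..1} \<Longrightarrow> f x = 0"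
  shows "AE X in sample_law n f. \<forall>i\<in>{1..n}. 0 \<le> X i \<and> X i \<le> 1"
proof (rule AE_finite_allI)
  fix i assume i: "i \<in> {1..n}"
  have "f \<in> borel_measurable borel" using f by (simp add: is_density_def)
  then have "AE t in density lborel (\<lambda>t. ennreal (f t)). 0 \<le> t \<and> t \<le> 1"
  proof (subst AE_density)
    have "0 \<le> t \<and> t \<le> 1" if "0 < f t" for t using supp[of t] that by auto
    then show "AE t in lborel. 0 < ennreal (f t) \<longrightarrow> 0 \<le> t \<and> t \<le> 1" by auto
  qed measurable
  then show "AE X in sample_law n f. 0 \<le> X i \<and> X i \<le> 1"
    unfolding sample_law_def using i
    by (intro AE_PiM_component[where P = "\<lambda>t. 0 \<le> t \<and> t \<le> 1"] prob_space_density f) auto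
qed simp

text \<open>
  The part of \<open>(L * kernel_sup b x / n) powr r\<close> that remains once the singularity
  \<open>x powr (- q)\<close> is split off.
\<close>

definition stochastic_coeff :: "real \<Rightarrow> real \<Rightarrow> nat \<Rightarrow> real \<Rightarrow> real \<Rightarrow> real" where
  "stochastic_coeff L b n r q = (L / real n) powr r * 9 powr q * b powr (q - r)"

lemma stochastic_coeff_bound:
  assumes "b > 0" "x > 0" "L \<ge> 0" "0 \<le> q" "2 * q \<le> r"
  shows "(L * kernel_sup b x / real n) powr r \<le> stochastic_coeff L b n r q * x powr (- q)"
proof -
  have "(L * kernel_sup b x / real n) powr r = (L / real n) powr r * kernel_sup b x powr r"
    using assms kernel_sup_pos[of b x] by (simp add: powr_mult[symmetric])
  also have "\<dots> \<le> (L / real n) powr r * (9 powr q * b powr (q - r) * x powr (- q))"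
    using assms by (intro mult_left_mono kernel_sup_powr_le) auto
  finally show ?thesis by (simp add: stochastic_coeff_def mult.assoc)
qed

lemma pointwise_risk_inner:
  assumes f: "f \<in> holder_class \<beta> L" and L: "L \<ge> 1" and beta: "0 < \<beta>" "\<beta> \<le> 2"
    and b: "0 < b" "b \<le> c" and n: "n \<ge> 1" and p: "1 \<le> p" "p \<le> 4"
    and q: "p > 2 \<Longrightarrow> 0 \<le> q \<and> 2 * q \<le> p - 1"
    and x: "0 < x" "x \<le> 2"
  shows "(\<integral>\<^sup>+X. ennreal (\<bar>gamma_kde n b X x - f x\<bar> powr p) \<partial>sample_law n f)
    \<le> ennreal (2 powr p * (5 * (stochastic_coeff L b n (p / 2) (p / 4) * x powr (- (p / 4))
        + (if p > 2 then stochastic_coeff L b n (p - 1) q * x powr (- q) else 0))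
      + (L * (4 + 3 * c) * b powr (\<beta> / 2)) powr p))"
proof -
  have d: "is_density f" using f by (simp add: holder_class_def)
  interpret S: prob_space "sample_law n f" by (rule prob_space_sample_law[OF d])
  define v where "v = L * kernel_sup b x / real n"
  define B where "B = L * (4 + 3 * c) * b powr (\<beta> / 2)"
  have bias: "\<bar>mean_kde b f x - f x\<bar> \<le> B" unfolding B_def by (rule bias_bound[OF f beta b x])
  have "(\<integral>\<^sup>+X. ennreal (\<bar>gamma_kde n b X x - f x\<bar> powr p) \<partial>sample_law n f)
      \<le> (\<integral>\<^sup>+X. ennreal (2 powr p) * (ennreal (\<bar>gamma_kde n b X x - mean_kde b f x\<bar> powr p) + ennreal (B powr p)) \<partial>sample_law n f)"
  proof (intro nn_integral_mono)
    fix X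
    have "\<bar>gamma_kde n b X x - f x\<bar> powr p
        \<le> 2 powr p * (\<bar>gamma_kde n b X x - mean_kde b f x\<bar> powr p + \<bar>mean_kde b f x - f x\<bar> powr p)"
      using abs_add_powr_le[of p "gamma_kde n b X x - mean_kde b f x" "mean_kde b f x - f x"] p by simp
    also have "\<dots> \<le> 2 powr p * (\<bar>gamma_kde n b X x - mean_kde b f x\<bar> powr p + B powr p)"
      using bias p by (intro mult_left_mono add_left_mono powr_mono2) auto
    finally show "ennreal (\<bar>gamma_kde n b X x - f x\<bar> powr p)
      \<le> ennreal (2 powr p) * (ennreal (\<bar>gamma_kde n b X x - mean_kde b f x\<bar> powr p) + ennreal (B powr p))"
      by (simp add: ennreal_mult[symmetric] ennreal_plus[symmetric] ennreal_leI del: ennreal_plus)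
  qed
  also have "\<dots> = ennreal (2 powr p) * ((\<integral>\<^sup>+X. ennreal (\<bar>gamma_kde n b X x - mean_kde b f x\<bar> powr p) \<partial>sample_law n f) + ennreal (B powr p))"
    by (subst nn_integral_cmult, measurable)
      (subst nn_integral_add, auto simp: S.emeasure_space_1)
  also have "\<dots> \<le> ennreal (2 powr p) * (ennreal (5 * (v powr (p / 2) + (if p > 2 then v powr (p - 1) else 0))) + ennreal (B powr p))"
    unfolding v_def using holder_class_bounded[OF f] L b x n p
    by (intro mult_left_mono add_right_mono stochastic_error[OF d]) (auto simp: abs_le_iff)
  also have "\<dots> = ennreal (2 powr p * (5 * (v powr (p / 2) + (if p > 2 then v powr (p - 1) else 0)) + B powr p))"
    by (simp add: ennreal_mult[symmetric] ennreal_plus[symmetric] del: ennreal_plus)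
  also have "\<dots> \<le> ennreal (2 powr p * (5 * (stochastic_coeff L b n (p / 2) (p / 4) * x powr (- (p / 4))
        + (if p > 2 then stochastic_coeff L b n (p - 1) q * x powr (- q) else 0)) + B powr p))"
  proof -
    have "v powr (p / 2) \<le> stochastic_coeff L b n (p / 2) (p / 4) * x powr (- (p / 4))"
      unfolding v_def using b x L p by (intro stochastic_coeff_bound) auto
    moreover have "v powr (p - 1) \<le> stochastic_coeff L b n (p - 1) q * x powr (- q)" if "p > 2"
      unfolding v_def using b x L q[OF that] by (intro stochastic_coeff_bound) auto
    ultimately show ?thesis
      by (intro ennreal_leI mult_left_mono add_right_mono) auto
  qed
  finally show ?thesis by (simp add: B_def)
qed

lemma pointwise_risk_tail:
  assumes f: "f \<in> holder_class \<beta> L" and b: "0 < b" and n: "n \<ge> 1" and p: "1 \<le> p"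
    and x: "2 < x"
  shows "(\<integral>\<^sup>+X. ennreal (\<bar>gamma_kde n b X x - f x\<bar> powr p) \<partial>sample_law n f)
    \<le> ennreal ((72 * b) powr p * x powr (- (2 * p)))"
proof -
  have d: "is_density f" and supp: "\<And>x. x \<notin> {0..1} \<Longrightarrow> f x = 0"
    using f by (auto simp: holder_class_def)
  interpret S: prob_space "sample_law n f" by (rule prob_space_sample_law[OF d])
  have "AE X in sample_law n f. \<forall>i\<in>{1..n}. 0 \<le> X i \<and> X i \<le> 1"
    by (rule AE_sample_in_support[OF d]) (rule supp)
  then have tail: "AE X in sample_law n f. ennreal (\<bar>gamma_kde n b X x - f x\<bar> powr p)
        \<le> ennreal ((72 * b) powr p * x powr (- (2 * p)))"
  proof eventually_elim
    case (elim X)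
    have nn: "0 \<le> (\<Sum>i=1..n. gamma_kernel b x (X i))"
      using b x by (intro sum_nonneg gamma_kernel_nonneg) auto
    have "(\<Sum>i=1..n. gamma_kernel b x (X i)) \<le> (\<Sum>i=1..n. 72 * b / x\<^sup>2)"
      using elim b x by (intro sum_mono gamma_kernel_tail) auto
    then have "\<bar>gamma_kde n b X x - f x\<bar> \<le> 72 * b / x\<^sup>2"
      using nn n x supp[of x] by (simp add: gamma_kde_def field_simps)
    then have "\<bar>gamma_kde n b X x - f x\<bar> powr p \<le> (72 * b / x\<^sup>2) powr p"
      using p by (intro powr_mono2) auto
    also have "\<dots> = (72 * b) powr p * x powr (- (2 * p))"
      using b x by (simp add: powr_divide powr_minus_divide powr_powr flip: powr_numeral)
    finally show ?case by (rule ennreal_leI)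
  qed
  have "(\<integral>\<^sup>+X. ennreal (\<bar>gamma_kde n b X x - f x\<bar> powr p) \<partial>sample_law n f)
      \<le> (\<integral>\<^sup>+X. ennreal ((72 * b) powr p * x powr (- (2 * p))) \<partial>sample_law n f)"
    by (rule nn_integral_mono_AE[OF tail])
  also have "\<dots> = ennreal ((72 * b) powr p * x powr (- (2 * p)))"
    by (simp add: S.emeasure_space_1)
  finally show ?thesis .
qed

text \<open>
  Tonelli's theorem moves the expectation inside, and the pointwise bounds on \<open>(0, 2]\<close> and
  \<open>(2, \<infinity>)\<close> are integrated. Integrability at \<open>0\<close> is where \<open>p < 4\<close> and \<open>q < 1\<close> enter.
\<close>

lemma gamma_kde_loss_bound:
  assumes f: "f \<in> holder_class \<beta> L" and L: "L \<ge> 1" and beta: "0 < \<beta>" "\<beta> \<le> 2"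
    and b: "0 < b" "b \<le> c" and n: "n \<ge> 1" and p: "1 \<le> p" "p < 4"
    and q: "p > 2 \<Longrightarrow> 0 \<le> q \<and> 2 * q \<le> p - 1 \<and> q < 1"
  shows "(\<integral>\<^sup>+X. (\<integral>\<^sup>+x. ennreal (\<bar>gamma_kde n b X x - f x\<bar> powr p) * indicator {0..} x \<partial>lborel) \<partial>sample_law n f)
    \<le> ennreal (2 powr p * (5 * (stochastic_coeff L b n (p / 2) (p / 4) * (2 powr (1 - p / 4) / (1 - p / 4))
        + (if p > 2 then stochastic_coeff L b n (p - 1) q * (2 powr (1 - q) / (1 - q)) else 0))
      + 2 * (L * (4 + 3 * c) * b powr (\<beta> / 2)) powr p) + (72 * b) powr p)"
proof -
  have d: "is_density f" using f by (simp add: holder_class_def)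
  then have [measurable]: "f \<in> borel_measurable borel" by (simp add: is_density_def)
  interpret S: prob_space "sample_law n f" by (rule prob_space_sample_law[OF d])
  interpret P: pair_sigma_finite lborel "sample_law n f"
    by (intro pair_sigma_finite.intro S.sigma_finite_measure_axioms lborel.sigma_finite_measure_axioms)
  define G where "G x = (\<integral>\<^sup>+X. ennreal (\<bar>gamma_kde n b X x - f x\<bar> powr p) \<partial>sample_law n f)" for x
  define a1 a2 where "a1 = 2 powr p * 5 * stochastic_coeff L b n (p / 2) (p / 4)"
    and "a2 = (if p > 2 then 2 powr p * 5 * stochastic_coeff L b n (p - 1) q else 0)"
  define q' where "q' = (if p > 2 then q else 0)"
  define a3 where "a3 = 2 powr p * (L * (4 + 3 * c) * b powr (\<beta> / 2)) powr p"
  define a4 where "a4 = (72 * b) powr p"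
  have nn: "0 \<le> a1" "0 \<le> a2" "0 \<le> a3" "0 \<le> a4"
    by (simp_all add: a1_def a2_def a3_def a4_def stochastic_coeff_def)
  have "(\<integral>\<^sup>+X. (\<integral>\<^sup>+x. ennreal (\<bar>gamma_kde n b X x - f x\<bar> powr p) * indicator {0..} x \<partial>lborel) \<partial>sample_law n f)
      = (\<integral>\<^sup>+x. (\<integral>\<^sup>+X. ennreal (\<bar>gamma_kde n b X x - f x\<bar> powr p) * indicator {0..} x \<partial>sample_law n f) \<partial>lborel)"
  proof (rule P.Fubini'[of "\<lambda>x X. ennreal (\<bar>gamma_kde n b X x - f x\<bar> powr p) * indicator {0..} x"])
    have [measurable]: "(\<lambda>z. gamma_kde n b (snd z) (fst z)) \<in> borel_measurable (lborel \<Otimes>\<^sub>M (\<Pi>\<^sub>M i\<in>{1..n}. borel))"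
      using measurable_compose[OF measurable_Pair[OF measurable_snd measurable_fst] gamma_kde_measurable[of n b]]
      unfolding fst_conv snd_conv .
    show "(\<lambda>(x, X). ennreal (\<bar>gamma_kde n b X x - f x\<bar> powr p) * indicator {0..} x)
        \<in> borel_measurable (lborel \<Otimes>\<^sub>M sample_law n f)"
      unfolding case_prod_beta by measurable
  qed
  also have "\<dots> = (\<integral>\<^sup>+x. G x * indicator {0..} x \<partial>lborel)"
    unfolding G_def by (intro nn_integral_cong nn_integral_multc) measurable
  also have "\<dots> \<le> (\<integral>\<^sup>+x. ennreal a1 * (ennreal (x powr (- (p / 4))) * indicator {0..2} x)
      + ennreal a2 * (ennreal (x powr (- q')) * indicator {0..2} x)
      + ennreal a3 * indicator {0..2} x
      + ennreal a4 * (ennreal (x powr (- (2 * p))) * indicator {2..} x) \<partial>lborel)"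
  proof (rule nn_integral_mono_AE)
    have "AE x in lborel. x \<noteq> (0::real)" by (rule AE_lborel_singleton)
    then show "AE x in lborel. G x * indicator {0..} x \<le> ennreal a1 * (ennreal (x powr (- (p / 4))) * indicator {0..2} x)
      + ennreal a2 * (ennreal (x powr (- q')) * indicator {0..2} x)
      + ennreal a3 * indicator {0..2} x
      + ennreal a4 * (ennreal (x powr (- (2 * p))) * indicator {2..} x)"
    proof eventually_elim
      case (elim x)
      consider "x < 0" | "0 < x" "x \<le> 2" | "2 < x" using elim by linarith
      then show ?case
      proof cases
        case 2
        have "G x \<le> ennreal (2 powr p * (5 * (stochastic_coeff L b n (p / 2) (p / 4) * x powr (- (p / 4))
            + (if p > 2 then stochastic_coeff L b n (p - 1) q * x powr (- q) else 0))
            + (L * (4 + 3 * c) * b powr (\<beta> / 2)) powr p))"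
          unfolding G_def using p q 2 by (intro pointwise_risk_inner[OF f L beta b n]) auto
        also have "\<dots> = ennreal (a1 * x powr (- (p / 4)) + a2 * x powr (- q') + a3)"
          by (intro arg_cong[where f = ennreal]) (simp add: a1_def a2_def a3_def q'_def algebra_simps)
        also have "\<dots> = ennreal a1 * ennreal (x powr (- (p / 4))) + ennreal a2 * ennreal (x powr (- q')) + ennreal a3"
          using nn by (simp add: ennreal_mult)
        finally show ?thesis using 2 by (simp add: add_increasing2)
      next
        case 3
        then show ?thesis
          using pointwise_risk_tail[OF f b(1) n p(1) 3] by (simp add: G_def a4_def ennreal_mult)
      qed simp
    qed
  qed
  also have "\<dots> = ennreal a1 * (\<integral>\<^sup>+x. ennreal (x powr (- (p / 4))) * indicator {0..2} x \<partial>lborel)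
      + ennreal a2 * (\<integral>\<^sup>+x. ennreal (x powr (- q')) * indicator {0..2} x \<partial>lborel)
      + ennreal a3 * (\<integral>\<^sup>+x. indicator {0..2::real} x \<partial>lborel)
      + ennreal a4 * (\<integral>\<^sup>+x. ennreal (x powr (- (2 * p))) * indicator {2..} x \<partial>lborel)"
    by (simp add: nn_integral_add nn_integral_cmult)
  also have "\<dots> \<le> ennreal a1 * ennreal (2 powr (1 - p / 4) / (1 - p / 4))
      + ennreal a2 * ennreal (2 powr (1 - q') / (1 - q')) + ennreal a3 * ennreal 2 + ennreal a4 * ennreal 1"
    using p q nn_integral_powr_near_0[of "p / 4"] nn_integral_powr_near_0[of q'] nn_integral_powr_tail[OF p(1)]
    by (intro add_mono mult_left_mono) (auto simp: q'_def)
  also have "\<dots> = ennreal (a1 * (2 powr (1 - p / 4) / (1 - p / 4)) + a2 * (2 powr (1 - q') / (1 - q')) + a3 * 2 + a4 * 1)"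
  proof -
    have "0 \<le> 2 powr (1 - p / 4) / (1 - p / 4)" "0 \<le> 2 powr (1 - q') / (1 - q')"
      using p q by (auto simp: q'_def)
    then show ?thesis using nn by (simp only: ennreal_plus ennreal_mult add_nonneg_nonneg mult_nonneg_nonneg zero_le_one zero_le_numeral)
  qed
  also have "a1 * (2 powr (1 - p / 4) / (1 - p / 4)) + a2 * (2 powr (1 - q') / (1 - q')) + a3 * 2 + a4 * 1
     = 2 powr p * (5 * (stochastic_coeff L b n (p / 2) (p / 4) * (2 powr (1 - p / 4) / (1 - p / 4))
        + (if p > 2 then stochastic_coeff L b n (p - 1) q * (2 powr (1 - q) / (1 - q)) else 0))
      + 2 * (L * (4 + 3 * c) * b powr (\<beta> / 2)) powr p) + (72 * b) powr p"
    by (simp add: a1_def a2_def a3_def a4_def q'_def distrib_left mult.assoc)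
  finally show ?thesis .
qed

section \<open>Rates\<close>

text \<open>
  The condition on \<open>q\<close> says that the exponent of \<open>n\<close> does not exceed \<open>- p * \<beta> / (2 * \<beta> + 1)\<close>. For
  \<open>r = p / 2\<close> and \<open>q = p / 4\<close> it holds with equality.
\<close>

lemma stochastic_coeff_rate:
  assumes n: "n \<ge> 1" and L: "L > 0" and c: "c > 0" and beta: "\<beta> > 0"
    and le: "r * (1 - 2 * \<beta>) + p * \<beta> \<le> 2 * q"
  shows "stochastic_coeff L (c * real n powr (- 2 / (2 * \<beta> + 1))) n r q
    \<le> L powr r * 9 powr q * c powr (q - r) * (real n powr (- \<beta> / (2 * \<beta> + 1))) powr p"
proof -
  define N where "N = real n"
  have N: "N \<ge> 1" using n by (simp add: N_def)
  have "stochastic_coeff L (c * N powr (- 2 / (2 * \<beta> + 1))) n r q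
      = L powr r * 9 powr q * c powr (q - r) * (N powr (- r) * N powr (- 2 / (2 * \<beta> + 1) * (q - r)))"
    using N L c unfolding stochastic_coeff_def N_def[symmetric]
    by (simp add: powr_divide powr_mult powr_powr powr_minus_divide)
  also have "N powr (- r) * N powr (- 2 / (2 * \<beta> + 1) * (q - r)) = N powr (- r + - 2 / (2 * \<beta> + 1) * (q - r))"
    by (rule powr_add[symmetric])
  also have "L powr r * 9 powr q * c powr (q - r) * \<dots>
      \<le> L powr r * 9 powr q * c powr (q - r) * N powr (- \<beta> / (2 * \<beta> + 1) * p)"
  proof (intro mult_left_mono powr_mono N)
    have "- r + - 2 / (2 * \<beta> + 1) * (q - r) = (r * (1 - 2 * \<beta>) - 2 * q) / (2 * \<beta> + 1)"
      using beta by (simp add: field_simps)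
    also have "\<dots> \<le> (- (p * \<beta>)) / (2 * \<beta> + 1)"
      using le beta by (intro divide_right_mono) auto
    also have "\<dots> = - \<beta> / (2 * \<beta> + 1) * p" by simp
    finally show "- r + - 2 / (2 * \<beta> + 1) * (q - r) \<le> - \<beta> / (2 * \<beta> + 1) * p" .
  qed auto
  finally show ?thesis by (simp add: N_def powr_powr)
qed

text \<open>
  Every term of the loss bound is a constant times the \<open>p\<close>-th power of the rate, with a constant that does not depend
  on the density.
\<close>

lemma max_risk_gamma_kde_upper:
  assumes beta: "0 < \<beta>" "\<beta> \<le> 2" and p: "1 \<le> p" "p < 4"
    and region: "p > 2 \<Longrightarrow> p - 3 < \<beta> * (p - 2)"
    and L: "L \<ge> 1" and c: "c > 0"
  obtains C where "C > 0" and "\<And>n. n \<ge> 1 \<Longrightarrow>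
    max_risk p n (gamma_kde n (c * real n powr (- 2 / (2 * \<beta> + 1)))) (holder_class \<beta> L)
      \<le> ennreal (C * real n powr (- \<beta> / (2 * \<beta> + 1)))"
proof -
  \<comment> \<open>The smallest exponent for which the \<open>v powr (p - 1)\<close> term has the right order; the region
    is exactly the condition that it is below \<open>1\<close>.\<close>
  define q where "q = max 0 ((p - 1 - \<beta> * (p - 2)) / 2)"
  have q: "0 \<le> q \<and> 2 * q \<le> p - 1 \<and> q < 1" if "p > 2"
    using region[OF that] that beta by (auto simp: q_def max_def)
  define A1 A2 where "A1 = 2 powr (1 - p / 4) / (1 - p / 4)" and "A2 = 2 powr (1 - q) / (1 - q)"
  define e where "e r q = L powr r * 9 powr q * c powr (q - r)" for r q
  define D where "D = 2 powr p * (5 * (e (p / 2) (p / 4) * A1 + (if p > 2 then e (p - 1) q * A2 else 0))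
      + 2 * (L * (4 + 3 * c) * c powr (\<beta> / 2)) powr p) + (72 * c) powr p"
  have A1: "A1 \<ge> 0" and A2: "p > 2 \<Longrightarrow> A2 \<ge> 0"
    using p q by (auto simp: A1_def A2_def)
  have e: "e r q \<ge> 0" for r q by (simp add: e_def)
  have D: "D > 0"
    unfolding D_def using A1 A2 e c by (intro add_nonneg_pos mult_nonneg_nonneg add_nonneg_nonneg) auto
  have "max_risk p n (gamma_kde n (c * real n powr (- 2 / (2 * \<beta> + 1)))) (holder_class \<beta> L)
      \<le> ennreal (D powr (1 / p) * real n powr (- \<beta> / (2 * \<beta> + 1)))" if n: "n \<ge> 1" for n
    unfolding max_risk_def
  proof (rule SUP_least)
    fix f assume f: "f \<in> holder_class \<beta> L"
    define b where "b = c * real n powr (- 2 / (2 * \<beta> + 1))"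
    define R where "R = real n powr (- \<beta> / (2 * \<beta> + 1))"
    have n0: "real n > 0" using n by simp
    have R: "R > 0" using n0 by (simp add: R_def)
    have b0: "b > 0" using c n0 by (simp add: b_def)
    have le1: "real n powr (- 2 / (2 * \<beta> + 1)) \<le> R"
      unfolding R_def using n beta by (intro powr_mono divide_right_mono) auto
    have "R \<le> real n powr 0"
      unfolding R_def using n beta by (intro powr_mono) auto
    then have R1: "R \<le> 1" using n0 by simp
    have bR: "b \<le> c * R" unfolding b_def using le1 c by (intro mult_left_mono) auto
    also have "c * R \<le> c * 1" using R1 c by (intro mult_left_mono) auto
    finally have bc: "b \<le> c" by simp
    have bb: "b powr (\<beta> / 2) = c powr (\<beta> / 2) * R"
      unfolding b_def R_def using c n0 by (simp add: powr_mult powr_powr field_simps)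
    have s1: "stochastic_coeff L b n (p / 2) (p / 4) \<le> e (p / 2) (p / 4) * R powr p"
      unfolding b_def e_def R_def using n L c beta by (intro stochastic_coeff_rate) (auto simp: field_simps)
    have s2: "stochastic_coeff L b n (p - 1) q \<le> e (p - 1) q * R powr p"
      unfolding b_def e_def R_def using n L c beta by (intro stochastic_coeff_rate) (auto simp: q_def max_def field_simps)
    show "risk p n (gamma_kde n (c * real n powr (- 2 / (2 * \<beta> + 1)))) f
        \<le> ennreal (D powr (1 / p) * real n powr (- \<beta> / (2 * \<beta> + 1)))"
      unfolding b_def[symmetric] R_def[symmetric]
    proof (rule risk_le[OF p(1)])
      have "(\<integral>\<^sup>+X. (\<integral>\<^sup>+x. ennreal (\<bar>gamma_kde n b X x - f x\<bar> powr p) * indicator {0..} x \<partial>lborel) \<partial>sample_law n f)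
        \<le> ennreal (2 powr p * (5 * (stochastic_coeff L b n (p / 2) (p / 4) * A1
            + (if p > 2 then stochastic_coeff L b n (p - 1) q * A2 else 0))
          + 2 * (L * (4 + 3 * c) * b powr (\<beta> / 2)) powr p) + (72 * b) powr p)"
        unfolding A1_def A2_def by (rule gamma_kde_loss_bound[OF f L beta b0 bc n p q])
      also have "\<dots> \<le> ennreal (2 powr p * (5 * (e (p / 2) (p / 4) * R powr p * A1
            + (if p > 2 then e (p - 1) q * R powr p * A2 else 0))
          + 2 * (L * (4 + 3 * c) * (c powr (\<beta> / 2) * R)) powr p) + (72 * (c * R)) powr p)"
        unfolding bb using s1 s2 A1 A2 bR b0 p L c R
        by (intro ennreal_leI add_mono mult_left_mono powr_mono2) (auto intro!: mult_right_mono)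
      also have "\<dots> = ennreal (D * R powr p)"
      proof (rule arg_cong[where f = ennreal])
        have "(L * (4 + 3 * c) * (c powr (\<beta> / 2) * R)) powr p = (L * (4 + 3 * c) * c powr (\<beta> / 2)) powr p * R powr p"
          using R by (simp add: powr_mult[symmetric] mult.assoc)
        moreover have "(72 * (c * R)) powr p = (72 * c) powr p * R powr p"
          using R by (simp add: powr_mult[symmetric] mult.assoc)
        ultimately show "2 powr p * (5 * (e (p / 2) (p / 4) * R powr p * A1
            + (if p > 2 then e (p - 1) q * R powr p * A2 else 0))
          + 2 * (L * (4 + 3 * c) * (c powr (\<beta> / 2) * R)) powr p) + (72 * (c * R)) powr p = D * R powr p"
          by (simp add: D_def algebra_simps)
      qed
      also have "D * R powr p = (D powr (1 / p) * R) powr p"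
        using D R p by (simp add: powr_mult powr_powr)
      finally show "(\<integral>\<^sup>+X. (\<integral>\<^sup>+x. ennreal (\<bar>gamma_kde n b X x - f x\<bar> powr p) * indicator {0..} x \<partial>lborel) \<partial>sample_law n f)
        \<le> ennreal ((D powr (1 / p) * R) powr p)" .
    qed (use R in simp)
  qed
  moreover have "D powr (1 / p) > 0" using D by simp
  ultimately show ?thesis using that by blast
qed

theorem theorem1:
  fixes \<beta> :: real
  shows "\<exists>L\<^sub>0>0. \<forall>p. (p, \<beta>) \<in> {1..<3} \<times> {0<..2} \<or> (p, \<beta>) \<in> S_region \<longrightarrow>
    (\<forall>L\<ge>L\<^sub>0. \<forall>c>0. \<forall>b :: nat \<Rightarrow> real.
      (\<forall>n\<ge>1. b n = c * real n powr (- 2 / (2 * \<beta> + 1))) \<longrightarrow>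
      limsup (\<lambda>n. max_risk p n (gamma_kde n (b n)) (holder_class \<beta> L) /
                   minimax_risk p n (holder_class \<beta> L)) < \<top>)"
proof (intro exI[of _ 12] conjI allI impI)
  fix p L c :: real and b :: "nat \<Rightarrow> real"
  assume pb: "(p, \<beta>) \<in> {1..<3} \<times> {0<..2} \<or> (p, \<beta>) \<in> S_region"
    and L: "12 \<le> L" and c: "0 < c" and b: "\<forall>n\<ge>1. b n = c * real n powr (- 2 / (2 * \<beta> + 1))"
  have beta: "0 < \<beta>" "\<beta> \<le> 2" and p: "1 \<le> p" "p < 4"
    using pb by (auto simp: S_region_def)
  have region: "p - 3 < \<beta> * (p - 2)" if "p > 2"
  proof (cases "p < 3")
    case True
    have "0 < \<beta> * (p - 2)" using that beta by simp
    then show ?thesis using True by linarith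
  next
    case False
    then show ?thesis using pb that by (auto simp: S_region_def divide_less_eq)
  qed
  obtain C where C: "C > 0" and upper: "\<And>n. n \<ge> 1 \<Longrightarrow>
    max_risk p n (gamma_kde n (c * real n powr (- 2 / (2 * \<beta> + 1)))) (holder_class \<beta> L)
      \<le> ennreal (C * real n powr (- \<beta> / (2 * \<beta> + 1)))"
    using max_risk_gamma_kde_upper[OF beta p region _ c, of L] L by auto
  have "\<forall>\<^sub>F n in sequentially. max_risk p n (gamma_kde n (b n)) (holder_class \<beta> L) /
      minimax_risk p n (holder_class \<beta> L) \<le> ennreal (C * 98304)"
    using eventually_ge_at_top[of 1]
  proof eventually_elim
    case (elim n)
    define R where "R = real n powr (- \<beta> / (2 * \<beta> + 1))"
    have R: "R > 0" using elim by (simp add: R_def)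
    have low: "ennreal (R / 98304) \<le> minimax_risk p n (holder_class \<beta> L)"
      unfolding R_def by (rule minimax_risk_lower[OF beta L p(1) elim])
    show ?case
    proof (rule divide_le_posI_ennreal)
      show "0 < minimax_risk p n (holder_class \<beta> L)"
        using R low by (intro less_le_trans[OF _ low]) simp
      have "max_risk p n (gamma_kde n (b n)) (holder_class \<beta> L) \<le> ennreal (C * R)"
        using upper[OF elim] b elim by (simp add: R_def)
      also have "\<dots> = ennreal (R / 98304) * ennreal (C * 98304)"
        using R C by (subst ennreal_mult[symmetric]) auto
      also have "\<dots> \<le> minimax_risk p n (holder_class \<beta> L) * ennreal (C * 98304)"
        by (intro mult_right_mono low) simp
      finally show "max_risk p n (gamma_kde n (b n)) (holder_class \<beta> L)
          \<le> minimax_risk p n (holder_class \<beta> L) * ennreal (C * 98304)" .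
    qed
  qed
  then have "limsup (\<lambda>n. max_risk p n (gamma_kde n (b n)) (holder_class \<beta> L) /
      minimax_risk p n (holder_class \<beta> L)) \<le> ennreal (C * 98304)"
    by (rule Limsup_bounded)
  then show "limsup (\<lambda>n. max_risk p n (gamma_kde n (b n)) (holder_class \<beta> L) /
      minimax_risk p n (holder_class \<beta> L)) < \<top>"
    by (rule le_less_trans) simp
qed simp

end
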